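(* Let $\lambda,\mu$ be sigma-finite measures on a measurable space $(S,\mathcal S)$ such that $\lambda\ll\mu$ and $H(\lambda,\mu)<\infty$, where $H$ is the Hellinger distance, and let $P_\lambda,P_\mu$ be the Poisson PP distributions with intensity measures $\lambda,\mu$. Let $\phi=\frac{d\lambda}{d\mu}:S\to[0,\infty)$ be a density of $\lambda$ with respect to $\mu$. Then $P_\lambda\ll P_\mu$, and a likelihood ratio (density of $P_\lambda$ with respect to $P_\mu$) is given by $$\frac{dP_\lambda}{dP_\mu}(\eta)=1_{M_{\lambda,\mu}}(\eta)\,\exp(\ell_{\lambda,\mu}(\eta)),$$ where $$\ell_{\lambda,\mu}(\eta)=\int_{\{|\log\phi|\le1\}}\log\phi\,d(\eta-\mu)+\int_{\{|\log\phi|>1\}}\log\phi\,d\eta+\int_{\{|\log\phi|\le1\}}(\log\phi+1-\phi)\,d\mu+\int_{\{|\log\phi|>1\}}(1-\phi)\,d\mu,$$ the first integral being a compensated integral, and $$M_{\lambda,\mu}=\{\eta\in N(S):\eta\{\phi=0\}=0\}.$$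
   Context: Point patterns: $N(S)$ is the set of measures on $(S,\mathcal S)$ that can be written as a countable sum of integer-valued finite measures, equipped with the sigma-algebra $\mathcal N(S)$ generated by the evaluation maps $\eta\mapsto\eta(B)$, $B\in\mathcal S$. Poisson PP distribution: for a sigma-finite measure $\lambda$ on $(S,\mathcal S)$, $P_\lambda$ is the unique probability measure on $(N(S),\mathcal N(S))$ under which $\eta(B_1),\dots,\eta(B_n)$ are independent for all $n\ge1$ and mutually disjoint $B_1,\dots,B_n\in\mathcal S$, and $\eta(B)$ is Poisson distributed with mean $\lambda(B)$ for every $B\in\mathcal S$ (with $\mathrm{Poi}(0)=\delta_0$, $\mathrm{Poi}(\infty)=\delta_\infty$). Hellinger distance of sigma-finite measures: $H(\lambda,\mu)=\left(\frac12\int_S(\sqrt f-\sqrt g)^2\,d\nu\right)^{1/2}\in[0,\infty]$, where $f,g$ are densities of $\lambda,\mu$ with respect to a sigma-finite measure $\nu$ (the value does not depend on the choice). Compensated integral: fix measurable sets $S_n\uparrow S$ with $\mu(S_n)<\infty$ for all $n$. For measurable $h$ and $A\in\mathcal S$, $$\int_A h\,d(\eta-\mu)=\lim_{n\to\infty}\left(\int_{A\cap S_n}h\,d\eta-\int_{A\cap S_n}h\,d\mu\right),$$ which is said to converge if $\int_{A\cap S_n}|h|\,d\eta+\int_{A\cap S_n}|h|\,d\mu<\infty$ for all $n$ and the limit exists in $\mathbb R$. Conventions: $\log0=-\infty$, so $\{\phi=0\}\subset\{|\log\phi|>1\}$; the product $1_{M_{\lambda,\mu}}(\eta)\exp(\ell_{\lambda,\mu}(\eta))$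 is read as $0$ when $\eta\notin M_{\lambda,\mu}$. The formula is understood for $P_\mu$-almost every $\eta$: part of the meaning is that the integrals are well defined and converge for $P_\mu$-almost every $\eta\in M_{\lambda,\mu}$. *)

theory Defs
  imports "HOL-Probability.Probability"
begin

subsection \<open>Point patterns\<close>

definition point_patterns :: "'a measure \<Rightarrow> 'a measure set" where
  "point_patterns S = {\<eta>. sets \<eta> = sets S \<and>
     (\<exists>m :: nat \<Rightarrow> 'a measure.
        (\<forall>i. finite_measure (m i) \<and> sets (m i) = sets S \<and>
             (\<forall>B\<in>sets S. emeasure (m i) B \<in> \<nat>)) \<and>
        (\<forall>B\<in>sets S. emeasure \<eta> B = (\<Sum>i. emeasure (m i) B)))}"

definition point_pattern_algebra :: "'a measure \<Rightarrow> 'a measure measure" where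
  "point_pattern_algebra S = sigma (point_patterns S)
     {(\<lambda>\<eta>. emeasure \<eta> B) -` E \<inter> point_patterns S | B E. B \<in> sets S \<and> E \<in> sets borel}"


subsection \<open>Poisson point pattern distributions\<close>

text \<open>The case distinction is needed because \<^const>\<open>poisson_pmf\<close> is only
  meaningful for positive rates.\<close>

definition poisson_law :: "ennreal \<Rightarrow> ennreal measure" where
  "poisson_law r =
     (if r = 0 then return borel 0
      else if r = \<infinity> then return borel \<infinity>
      else distr (measure_pmf (poisson_pmf (enn2real r))) borel of_nat)"

text \<open>These properties determine \<open>P\<close> uniquely when \<open>\<Lambda>\<close> is sigma-finite.\<close>

definition poisson_pp_distribution :: "'a measure \<Rightarrow> 'a measure measure \<Rightarrow> bool" where
  "poisson_pp_distribution \<Lambda> P \<longleftrightarrow>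
     prob_space P \<and> sets P = sets (point_pattern_algebra \<Lambda>) \<and>
     (\<forall>(n::nat) B. n \<ge> 1 \<longrightarrow> B ` {..<n} \<subseteq> sets \<Lambda> \<longrightarrow> disjoint_family_on B {..<n} \<longrightarrow>
        prob_space.indep_vars P (\<lambda>_. borel) (\<lambda>i \<eta>. emeasure \<eta> (B i)) {..<n}) \<and>
     (\<forall>B\<in>sets \<Lambda>. distr P borel (\<lambda>\<eta>. emeasure \<eta> B) = poisson_law (emeasure \<Lambda> B))"


subsection \<open>Hellinger distance of sigma-finite measures\<close>

definition sqrt_ennreal :: "ennreal \<Rightarrow> ennreal" where
  "sqrt_ennreal r = (if r = \<infinity> then \<infinity> else ennreal (sqrt (enn2real r)))"

definition is_density :: "'a measure \<Rightarrow> 'a measure \<Rightarrow> ('a \<Rightarrow> real) \<Rightarrow> bool" where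
  "is_density \<Lambda> \<nu> f \<longleftrightarrow>
     f \<in> borel_measurable \<nu> \<and> (\<forall>x\<in>space \<nu>. 0 \<le> f x) \<and> \<Lambda> = density \<nu> (\<lambda>x. ennreal (f x))"

definition hellinger_densities :: "'a measure \<Rightarrow> ('a \<Rightarrow> real) \<Rightarrow> ('a \<Rightarrow> real) \<Rightarrow> ennreal" where
  "hellinger_densities \<nu> f g =
     sqrt_ennreal ((\<integral>\<^sup>+x. ennreal ((sqrt (f x) - sqrt (g x))\<^sup>2) \<partial>\<nu>) / 2)"

text \<open>The common value over all choices of \<open>\<nu>\<close>, \<open>f\<close>, \<open>g\<close>; independence of the choice is
  \<open>hellinger_eq\<close> below.\<close>

definition hellinger :: "'a measure \<Rightarrow> 'a measure \<Rightarrow> ennreal" where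
  "hellinger \<Lambda> M = (THE h. \<exists>\<nu> f g. sigma_finite_measure \<nu> \<and>
     is_density \<Lambda> \<nu> f \<and> is_density M \<nu> g \<and> h = hellinger_densities \<nu> f g)"

lemma hellinger_aux:
  assumes s: "sigma_finite_measure \<nu>" and f: "is_density \<Lambda> \<nu> f" and g: "is_density M \<nu> g"
  defines "\<tau> \<equiv> density \<nu> (\<lambda>x. ennreal (f x + g x))"
  shows "sigma_finite_measure \<tau>" "sets \<tau> = sets \<Lambda>"
    "\<And>A. A \<in> sets \<Lambda> \<Longrightarrow> emeasure \<tau> A = emeasure \<Lambda> A + emeasure M A"
    "is_density \<Lambda> \<tau> (\<lambda>x. f x / (f x + g x))" "is_density M \<tau> (\<lambda>x. g x / (f x + g x))"
    "hellinger_densities \<tau> (\<lambda>x. f x / (f x + g x)) (\<lambda>x. g x / (f x + g x)) =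
       hellinger_densities \<nu> f g"
proof -
  have [measurable]: "f \<in> borel_measurable \<nu>" "g \<in> borel_measurable \<nu>"
    and f0: "\<And>x. x \<in> space \<nu> \<Longrightarrow> 0 \<le> f x" and g0: "\<And>x. x \<in> space \<nu> \<Longrightarrow> 0 \<le> g x"
    and fd: "\<Lambda> = density \<nu> (\<lambda>x. ennreal (f x))" and gd: "M = density \<nu> (\<lambda>x. ennreal (g x))"
    using f g by (auto simp: is_density_def)
  show "sigma_finite_measure \<tau>" unfolding \<tau>_def
    by (subst sigma_finite_measure.sigma_finite_iff_density_finite[OF s]) auto
  show "sets \<tau> = sets \<Lambda>" by (simp add: \<tau>_def fd)
  show "emeasure \<tau> A = emeasure \<Lambda> A + emeasure M A" if "A \<in> sets \<Lambda>" for A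
  proof -
    have [measurable]: "A \<in> sets \<nu>" using that fd by simp
    have "emeasure \<tau> A = (\<integral>\<^sup>+x. ennreal (f x) * indicator A x + ennreal (g x) * indicator A x \<partial>\<nu>)"
      unfolding \<tau>_def
      by (subst emeasure_density, measurable)
         (auto intro!: nn_integral_cong simp: f0 g0 split: split_indicator)
    then show ?thesis
      unfolding fd gd by (simp add: emeasure_density nn_integral_add)
  qed
  have q: "ennreal (f x + g x) * ennreal (u / (f x + g x)) = ennreal u"
    if "x \<in> space \<nu>" "0 \<le> u" "u \<le> f x + g x" for x u
  proof (cases "f x + g x = 0")
    case True
    then show ?thesis using that by simp
  next
    case False
    then have "0 < f x + g x" using f0[OF that(1)] g0[OF that(1)] by linarith
    then show ?thesis using that by (simp flip: ennreal_mult)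
  qed
  show "is_density \<Lambda> \<tau> (\<lambda>x. f x / (f x + g x))"
    unfolding is_density_def \<tau>_def fd
    by (subst density_density_eq)
       (auto intro!: density_cong AE_I2 simp: q f0 g0 simp del: ennreal_plus)
  show "is_density M \<tau> (\<lambda>x. g x / (f x + g x))"
    unfolding is_density_def \<tau>_def gd
    by (subst density_density_eq)
       (auto intro!: density_cong AE_I2 simp: q f0 g0 simp del: ennreal_plus)
  have "ennreal (f x + g x) * ennreal ((sqrt (f x / (f x + g x)) - sqrt (g x / (f x + g x)))\<^sup>2)
      = ennreal ((sqrt (f x) - sqrt (g x))\<^sup>2)" if x: "x \<in> space \<nu>" for x
  proof (cases "f x + g x = 0")
    case True
    then show ?thesis using f0[OF x] g0[OF x] by simp
  next
    case False
    then have "0 < f x + g x" using f0[OF x] g0[OF x] by linarith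
    moreover have "(sqrt (f x / (f x + g x)) - sqrt (g x / (f x + g x)))\<^sup>2 =
        (sqrt (f x) - sqrt (g x))\<^sup>2 / (f x + g x)"
      using \<open>0 < f x + g x\<close>
      by (simp add: real_sqrt_divide power_divide flip: diff_divide_distrib)
    ultimately show ?thesis by (simp flip: ennreal_mult)
  qed
  then show "hellinger_densities \<tau> (\<lambda>x. f x / (f x + g x)) (\<lambda>x. g x / (f x + g x)) =
       hellinger_densities \<nu> f g"
    unfolding hellinger_densities_def \<tau>_def
    by (subst nn_integral_density, measurable) (simp cong: nn_integral_cong)
qed

lemma hellinger_densities_unique:
  assumes "sigma_finite_measure \<nu>1" "is_density \<Lambda> \<nu>1 f1" "is_density M \<nu>1 g1"
  assumes "sigma_finite_measure \<nu>2" "is_density \<Lambda> \<nu>2 f2" "is_density M \<nu>2 g2"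
  shows "hellinger_densities \<nu>1 f1 g1 = hellinger_densities \<nu>2 f2 g2"
proof -
  note a1 = hellinger_aux[OF assms(1-3)] and a2 = hellinger_aux[OF assms(4-6)]
  define \<tau> where "\<tau> = density \<nu>1 (\<lambda>x. ennreal (f1 x + g1 x))"
  have eq: "density \<nu>2 (\<lambda>x. ennreal (f2 x + g2 x)) = \<tau>"
    unfolding \<tau>_def by (rule measure_eqI) (use a1(2,3) a2(2,3) in simp_all)
  note a1 = a1[folded \<tau>_def] and a2 = a2[unfolded eq]
  have ae: "AE x in \<tau>. f x = g x" if "is_density K \<tau> f" "is_density K \<tau> g" for K f g
  proof -
    have "AE x in \<tau>. ennreal (f x) = ennreal (g x)"
      using that a1(1) unfolding is_density_def
      by (subst sigma_finite_measure.density_unique_iff[symmetric]) auto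
    then show ?thesis
      using that by (auto simp: is_density_def)
  qed
  show ?thesis
    unfolding a1(6)[symmetric] a2(6)[symmetric]
    unfolding hellinger_densities_def
    using ae[OF a1(4) a2(4)] ae[OF a1(5) a2(5)]
    by (intro arg_cong[where f=sqrt_ennreal] arg_cong2[where f="(/)"] nn_integral_cong_AE) auto
qed

lemma hellinger_eq:
  assumes "sigma_finite_measure \<nu>" "is_density \<Lambda> \<nu> f" "is_density M \<nu> g"
  shows "hellinger \<Lambda> M = hellinger_densities \<nu> f g"
  unfolding hellinger_def
  by (rule the_equality) (use assms hellinger_densities_unique in blast)+


subsection \<open>Compensated integrals\<close>

text \<open>\<open>T\<close> is the exhausting sequence of sets of finite \<open>\<mu>\<close>-measure.\<close>

definition compensated_integral_converges ::
    "(nat \<Rightarrow> 'a set) \<Rightarrow> 'a measure \<Rightarrow> 'a measure \<Rightarrow> 'a set \<Rightarrow> ('a \<Rightarrow> real) \<Rightarrow> bool" where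
  "compensated_integral_converges T \<mu> \<eta> A h \<longleftrightarrow>
     (\<forall>n. (\<integral>\<^sup>+x\<in>A \<inter> T n. ennreal \<bar>h x\<bar> \<partial>\<eta>) + (\<integral>\<^sup>+x\<in>A \<inter> T n. ennreal \<bar>h x\<bar> \<partial>\<mu>) < \<infinity>) \<and>
     convergent (\<lambda>n. (LINT x:A \<inter> T n|\<eta>. h x) - (LINT x:A \<inter> T n|\<mu>. h x))"

definition compensated_integral ::
    "(nat \<Rightarrow> 'a set) \<Rightarrow> 'a measure \<Rightarrow> 'a measure \<Rightarrow> 'a set \<Rightarrow> ('a \<Rightarrow> real) \<Rightarrow> real" where
  "compensated_integral T \<mu> \<eta> A h =
     lim (\<lambda>n. (LINT x:A \<inter> T n|\<eta>. h x) - (LINT x:A \<inter> T n|\<mu>. h x))"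


subsection \<open>The likelihood ratio\<close>

definition log_ext :: "real \<Rightarrow> ereal" where
  "log_ext t = (if t = 0 then -\<infinity> else ereal (ln t))"

definition log_small :: "'a measure \<Rightarrow> ('a \<Rightarrow> real) \<Rightarrow> 'a set" where
  "log_small \<mu> \<phi> = {x\<in>space \<mu>. \<bar>log_ext (\<phi> x)\<bar> \<le> 1}"

definition log_large :: "'a measure \<Rightarrow> ('a \<Rightarrow> real) \<Rightarrow> 'a set" where
  "log_large \<mu> \<phi> = {x\<in>space \<mu>. \<bar>log_ext (\<phi> x)\<bar> > 1}"

definition no_zero_patterns :: "'a measure \<Rightarrow> ('a \<Rightarrow> real) \<Rightarrow> 'a measure set" where
  "no_zero_patterns \<mu> \<phi> = {\<eta>\<in>point_patterns \<mu>. emeasure \<eta> {x\<in>space \<mu>. \<phi> x = 0} = 0}"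

text \<open>The integrands use the real logarithm, whose value at \<open>0\<close> is a junk value.  This is harmless:
  the exponent only matters for patterns in \<^const>\<open>no_zero_patterns\<close>, and for these the set where
  \<open>\<phi>\<close> vanishes is a null set; that set is moreover disjoint from \<^const>\<open>log_small\<close>.\<close>

definition log_likelihood_ratio ::
    "(nat \<Rightarrow> 'a set) \<Rightarrow> 'a measure \<Rightarrow> ('a \<Rightarrow> real) \<Rightarrow> 'a measure \<Rightarrow> real" where
  "log_likelihood_ratio T \<mu> \<phi> \<eta> =
     compensated_integral T \<mu> \<eta> (log_small \<mu> \<phi>) (\<lambda>x. ln (\<phi> x))
     + (LINT x:log_large \<mu> \<phi>|\<eta>. ln (\<phi> x))
     + (LINT x:log_small \<mu> \<phi>|\<mu>. ln (\<phi> x) + 1 - \<phi> x)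
     + (LINT x:log_large \<mu> \<phi>|\<mu>. 1 - \<phi> x)"

definition likelihood_ratio ::
    "(nat \<Rightarrow> 'a set) \<Rightarrow> 'a measure \<Rightarrow> ('a \<Rightarrow> real) \<Rightarrow> 'a measure \<Rightarrow> real" where
  "likelihood_ratio T \<mu> \<phi> \<eta> =
     indicator (no_zero_patterns \<mu> \<phi>) \<eta> * exp (log_likelihood_ratio T \<mu> \<phi> \<eta>)"

end

(* The Laplace functional E exp(int ln w d eta) = exp(int (w - 1) d mu) of a Poisson pattern, for
   weights w on a set of finite intensity, carries the whole argument. Expanding it in powers of
   its weights shows that it determines the law of a pattern. It also shows that on T n the law
   P_Lambda has density L_n = exp(int ln phi d eta - int (phi - 1) d mu) with respect to P_mu, and
   that E sqrt(L_n L_m) = exp(-1/2 int (sqrt phi - 1)^2 d mu) over T n - T m. Finiteness of the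
   Hellinger distance makes sqrt L_n a Cauchy sequence in L^2, so that an almost sure limit of L_n
   is a density of P_Lambda on all of N(S). The almost sure convergence of L_n reduces to that of
   the compensated sums, which follows from a maximal inequality for exponentials. *)
theory Submission
  imports Defs
begin

section \<open>Point patterns\<close>

text \<open>A sequence of likelihood ratios may converge almost surely and still lose mass in the
  limit. Convergence of the square roots in L^2 excludes this, and the integral of (sqrt \<phi> -
  1)^2, which a finite Hellinger distance makes finite, is exactly what controls it. The same
  integrand explains the split at |log \<phi>| = 1. Where |log \<phi>| > 1 it is bounded below by a
  positive constant, so almost surely only finitely many points lie there and their logarithms form
  a finite sum. Where |log \<phi>| \<le> 1 it dominates (log \<phi>)^2 up to a constant, but not
  |log \<phi>|; the sum over the points has to be compensated, and log \<phi> + 1 - \<phi> is what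
  remains of the normalising exponent.

  A further obstacle is independence. The definition of a Poisson pattern grants it for finitely
  many counts only, whereas the convergence of the compensated sums needs it for the whole
  restrictions of a pattern to disjoint sets. This is again obtained by comparing Laplace
  functionals, of a weighted law and of a multiple of the unweighted one.\<close>

lemma space_point_pattern_algebra [simp]: "space (point_pattern_algebra M) = point_patterns M"
  unfolding point_pattern_algebra_def by (rule space_measure_of) auto

lemma point_patterns_cong: "sets M = sets M' \<Longrightarrow> point_patterns M = point_patterns M'"
  by (simp add: point_patterns_def)

lemma point_pattern_algebra_cong:
  "sets M = sets M' \<Longrightarrow> point_pattern_algebra M = point_pattern_algebra M'"
  by (simp add: point_pattern_algebra_def point_patterns_cong[of M M'])

lemma measurable_emeasure_point_pattern [measurable]:
  assumes "B \<in> sets M"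
  shows "(\<lambda>\<eta>. emeasure \<eta> B) \<in> borel_measurable (point_pattern_algebra M)"
proof (rule measurableI)
  fix E :: "ennreal set" assume "E \<in> sets borel"
  then show "(\<lambda>\<eta>. emeasure \<eta> B) -` E \<inter> space (point_pattern_algebra M)
      \<in> sets (point_pattern_algebra M)"
    using assms unfolding space_point_pattern_algebra
    unfolding point_pattern_algebra_def
    by (subst sets_measure_of) (auto intro!: sigma_sets.Basic)
qed simp

lemma measurable_point_pattern_algebraI:
  assumes "\<And>x. x \<in> space X \<Longrightarrow> f x \<in> point_patterns M"
    and "\<And>B. B \<in> sets M \<Longrightarrow> (\<lambda>x. emeasure (f x) B) \<in> borel_measurable X"
  shows "f \<in> measurable X (point_pattern_algebra M)"
  unfolding point_pattern_algebra_def
proof (rule measurable_measure_of)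
  fix A assume "A \<in> {(\<lambda>\<eta>. emeasure \<eta> B) -` E \<inter> point_patterns M |B E.
     B \<in> sets M \<and> E \<in> sets borel}"
  then obtain B E where A: "A = (\<lambda>\<eta>. emeasure \<eta> B) -` E \<inter> point_patterns M"
    and "B \<in> sets M" "E \<in> sets borel" by auto
  moreover have "f -` A \<inter> space X = (\<lambda>x. emeasure (f x) B) -` E \<inter> space X"
    using assms(1) by (auto simp: A)
  ultimately show "f -` A \<inter> space X \<in> sets X"
    using measurable_sets[OF assms(2)] by metis
qed (use assms(1) in auto)

lemma sets_point_pattern: "\<eta> \<in> point_patterns M \<Longrightarrow> sets \<eta> = sets M"
  by (simp add: point_patterns_def)

lemma space_point_pattern: "\<eta> \<in> point_patterns M \<Longrightarrow> space \<eta> = space M"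
  by (rule sets_eq_imp_space_eq) (rule sets_point_pattern)

lemma measurable_point_pattern:
  "\<eta> \<in> point_patterns M \<Longrightarrow> f \<in> measurable M K \<Longrightarrow> f \<in> measurable \<eta> K"
  by (simp add: measurable_cong_sets[OF sets_point_pattern])

text \<open>If the sum is finite, its terms tend to 0; being integers, they vanish from some index
  on.\<close>

lemma suminf_Nats_ennreal:
  fixes c :: "nat \<Rightarrow> ennreal"
  assumes c: "\<And>i. c i \<in> \<nat>"
  shows "(\<Sum>i. c i) = \<infinity> \<or> (\<exists>k. (\<Sum>i. c i) = of_nat k)"
proof (cases "(\<Sum>i. c i) = \<infinity>")
  case False
  from c have "\<forall>i. \<exists>k. c i = of_nat k" by (auto simp: Nats_def)
  then obtain d :: "nat \<Rightarrow> nat" where d: "\<And>i. c i = of_nat (d i)" by metis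
  have "(\<Sum>i. ennreal (real (d i))) \<noteq> top"
    using False by (simp add: d ennreal_of_nat_eq_real_of_nat)
  then have "summable (\<lambda>i. real (d i))" by (intro summable_suminf_not_top) auto
  then have "(\<lambda>i. real (d i)) \<longlonglongrightarrow> 0" by (rule summable_LIMSEQ_zero)
  then have "eventually (\<lambda>i. real (d i) < 1) sequentially" by (rule order_tendstoD) simp
  then obtain n where n: "\<And>i. i \<ge> n \<Longrightarrow> d i = 0" by (auto simp: eventually_sequentially)
  have "(\<Sum>i. c i) = (\<Sum>i<n. c i)"
    by (rule suminf_finite) (auto simp: d n not_less)
  also have "\<dots> = of_nat (\<Sum>i<n. d i)" by (simp add: d)
  finally show ?thesis by blast
qed simp

lemma emeasure_point_pattern_cases:
  assumes "\<eta> \<in> point_patterns M"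
  shows "emeasure \<eta> B = \<infinity> \<or> (\<exists>k. emeasure \<eta> B = of_nat k)"
proof (cases "B \<in> sets M")
  case True
  moreover from assms obtain m :: "nat \<Rightarrow> 'a measure" where
    "\<And>i B. B \<in> sets M \<Longrightarrow> emeasure (m i) B \<in> \<nat>"
    "\<And>B. B \<in> sets M \<Longrightarrow> emeasure \<eta> B = (\<Sum>i. emeasure (m i) B)"
    unfolding point_patterns_def by blast
  ultimately show ?thesis
    using suminf_Nats_ennreal[of "\<lambda>i. emeasure (m i) B"] by simp
next
  case False
  \<comment> \<open>Outside the sigma-algebra \<open>emeasure\<close> has the default value 0, which
    is an integer too.\<close>
  then have "emeasure \<eta> B = of_nat 0"
    using sets_point_pattern[OF assms] by (simp add: emeasure_notin_sets)
  then show ?thesis by blast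
qed

lemma emeasure_point_pattern_zero:
  assumes "\<eta> \<in> point_patterns M" "emeasure \<eta> B < 1"
  shows "emeasure \<eta> B = 0"
proof -
  from emeasure_point_pattern_cases[OF assms(1), of B] assms(2)
  obtain k where k: "emeasure \<eta> B = of_nat k" by auto
  with assms(2) have "of_nat k < (of_nat 1 :: ennreal)" by simp
  then have "k = 0" by (subst (asm) of_nat_less_iff) simp
  with k show ?thesis by simp
qed

text \<open>An integer-valued measure cannot charge a sequence of sets decreasing to a null set, so
  every function is essentially bounded on a set carrying finitely many points.\<close>

lemma point_pattern_decseq_null:
  assumes \<eta>: "\<eta> \<in> point_patterns M" and A: "\<And>n. A n \<in> sets M" "decseq A"
    and fin: "emeasure \<eta> (A 0) < \<infinity>" and null: "emeasure \<eta> (\<Inter>n. A n) = 0"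
  shows "\<exists>n. \<forall>m\<ge>n. emeasure \<eta> (A m) = 0"
proof -
  have *: "emeasure \<eta> (A n) \<noteq> \<infinity>" for n
    using emeasure_mono[of "A n" "A 0" \<eta>] A fin decseqD[OF A(2), of 0 n]
    by (auto simp: sets_point_pattern[OF \<eta>] top_unique)
  have "(\<lambda>n. emeasure \<eta> (A n)) \<longlonglongrightarrow> 0"
    unfolding null[symmetric]
    by (rule Lim_emeasure_decseq) (use A * in \<open>auto simp: sets_point_pattern[OF \<eta>]\<close>)
  then have "eventually (\<lambda>n. emeasure \<eta> (A n) < 1) sequentially"
    by (rule order_tendstoD) simp
  then show ?thesis
    using emeasure_point_pattern_zero[OF \<eta>] by (auto simp: eventually_sequentially)
qed

text \<open>This makes integrals of logarithms over sets with finitely many points genuine for every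
  measurable weight; they never fall back to the default value 0.\<close>

lemma point_pattern_set_integrable:
  fixes f :: "'a \<Rightarrow> real"
  assumes \<eta>: "\<eta> \<in> point_patterns M" and A: "A \<in> sets M" "emeasure \<eta> A < \<infinity>"
    and f: "f \<in> borel_measurable M"
  shows "set_integrable \<eta> A f"
proof -
  note [measurable] = A(1) f
  note [measurable_cong] = sets_point_pattern[OF \<eta>]
  have "\<exists>n. \<forall>m\<ge>n. emeasure \<eta> {x\<in>space M. x \<in> A \<and> real m < \<bar>f x\<bar>} = 0"
  proof (rule point_pattern_decseq_null[OF \<eta>])
    show "decseq (\<lambda>n. {x\<in>space M. x \<in> A \<and> real n < \<bar>f x\<bar>})"
      by (auto simp: decseq_def)
    have "emeasure \<eta> {x\<in>space M. x \<in> A \<and> real 0 < \<bar>f x\<bar>} \<le> emeasure \<eta> A"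
      by (rule emeasure_mono) (use A sets_point_pattern[OF \<eta>] in blast)+
    then show "emeasure \<eta> {x\<in>space M. x \<in> A \<and> real 0 < \<bar>f x\<bar>} < \<infinity>"
      using A(2) by (rule order_le_less_trans)
    have "(\<Inter>n. {x\<in>space M. x \<in> A \<and> real n < \<bar>f x\<bar>}) = {}"
      
    proof (intro equalityI subsetI)
      fix x assume x: "x \<in> (\<Inter>n. {x\<in>space M. x \<in> A \<and> real n < \<bar>f x\<bar>})"
      obtain n where "\<bar>f x\<bar> < real n" using reals_Archimedean2 by blast
      with x show "x \<in> {}" by (auto dest!: spec[of _ n])
    qed simp
    then show "emeasure \<eta> (\<Inter>n. {x\<in>space M. x \<in> A \<and> real n < \<bar>f x\<bar>}) = 0" by simp
  qed measurable
  then obtain n where n: "emeasure \<eta> {x\<in>space M. x \<in> A \<and> real n < \<bar>f x\<bar>} = 0" by blast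
  have "AE x in \<eta>. \<not> (x \<in> A \<and> real n < \<bar>f x\<bar>)"
    by (rule AE_I[OF _ n]) (auto simp: space_point_pattern[OF \<eta>] sets_point_pattern[OF \<eta>])
  then have "AE x in \<eta>. norm (indicator A x *\<^sub>R f x) \<le> norm (indicator A x *\<^sub>R real n)"
    by eventually_elim (auto split: split_indicator)
  moreover have "set_integrable \<eta> A (\<lambda>_. real n)"
    using A by (simp add: set_integrable_def integrable_indicator_iff sets_point_pattern[OF \<eta>] integrable_mult_left)
  ultimately show ?thesis
    unfolding set_integrable_def
    by (elim Bochner_Integration.integrable_bound[rotated -1]) measurable
qed

text \<open>The measurability prover would pick these rules for integrals as functions of the measure,
  but point patterns are not subprobability measures.\<close>

declare nn_integral_measurable_subprob_algebra [measurable del]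
  measurable_emeasure_subprob_algebra [measurable del]
  integral_measurable_subprob_algebra [measurable del]

section \<open>Integrals as measurable functions of the pattern\<close>

lemma measurable_nn_integral_point_pattern [measurable]:
  assumes "f \<in> borel_measurable M"
  shows "(\<lambda>\<eta>. \<integral>\<^sup>+x. f x \<partial>\<eta>) \<in> borel_measurable (point_pattern_algebra M)"
  using assms
proof (induction f rule: borel_measurable_induct)
  case (cong f g)
  have *: "(\<integral>\<^sup>+x. f x \<partial>\<eta>) = (\<integral>\<^sup>+x. g x \<partial>\<eta>)" if "\<eta> \<in> space (point_pattern_algebra M)" for \<eta>
    using cong(3) that by (intro nn_integral_cong) (simp add: space_point_pattern[of _ M])
  with cong(4) show ?case by (intro iffD2[OF measurable_cong, OF *])
next
  case (set A)
  have *: "(\<integral>\<^sup>+x. indicator A x \<partial>\<eta>) = emeasure \<eta> A" if "\<eta> \<in> space (point_pattern_algebra M)" for \<eta>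
    using that set by (simp add: sets_point_pattern[of _ M])
  with set show ?case by (intro iffD2[OF measurable_cong, OF *]) measurable
next
  case (mult u c)
  have *: "(\<integral>\<^sup>+x. c * u x \<partial>\<eta>) = c * (\<integral>\<^sup>+x. u x \<partial>\<eta>)" if "\<eta> \<in> space (point_pattern_algebra M)" for \<eta>
    using that mult(2) by (intro nn_integral_cmult) (simp add: measurable_point_pattern)
  with mult(4) show ?case by (intro iffD2[OF measurable_cong, OF *]) measurable
next
  case (add u v)
  have *: "(\<integral>\<^sup>+x. v x + u x \<partial>\<eta>) = (\<integral>\<^sup>+x. v x \<partial>\<eta>) + (\<integral>\<^sup>+x. u x \<partial>\<eta>)"
    if "\<eta> \<in> space (point_pattern_algebra M)" for \<eta>
    using that add by (intro nn_integral_add) (simp_all add: measurable_point_pattern)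
  with add.IH show ?case by (intro iffD2[OF measurable_cong, OF *]) measurable
next
  case (seq U)
  have *: "(\<integral>\<^sup>+x. (SUP i. U i) x \<partial>\<eta>) = (SUP i. \<integral>\<^sup>+x. U i x \<partial>\<eta>)"
    if "\<eta> \<in> space (point_pattern_algebra M)" for \<eta>
    using that seq unfolding SUP_apply
    by (intro nn_integral_monotone_convergence_SUP) (simp_all add: measurable_point_pattern)
  with seq.IH show ?case by (intro iffD2[OF measurable_cong, OF *]) measurable
qed

lemma measurable_integral_point_pattern [measurable]:
  fixes f :: "'a \<Rightarrow> real"
  assumes f: "f \<in> borel_measurable M"
  shows "(\<lambda>\<eta>. \<integral>x. f x \<partial>\<eta>) \<in> borel_measurable (point_pattern_algebra M)"
proof -
  \<comment> \<open>The conditional reproduces the default value 0 of the Bochner integral at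
    patterns for which f is not integrable; what is left consists of nonnegative integrals.\<close>
  have *: "(\<integral>x. f x \<partial>\<eta>) = (if (\<integral>\<^sup>+x. ennreal \<bar>f x\<bar> \<partial>\<eta>) < \<infinity>
      then enn2real (\<integral>\<^sup>+x. ennreal (f x) \<partial>\<eta>) - enn2real (\<integral>\<^sup>+x. ennreal (- f x) \<partial>\<eta>) else 0)"
    if \<eta>: "\<eta> \<in> space (point_pattern_algebra M)" for \<eta>
  proof -
    have f': "f \<in> borel_measurable \<eta>" using \<eta> f by (simp add: measurable_point_pattern)
    show ?thesis
    proof (cases "integrable \<eta> f")
      case True
      then show ?thesis
        by (simp add: real_lebesgue_integral_def) (simp add: integrable_iff_bounded)
    next
      case False
      with f' have "\<not> (\<integral>\<^sup>+x. ennreal \<bar>f x\<bar> \<partial>\<eta>) < \<infinity>"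
        by (simp add: integrable_iff_bounded)
      with False show ?thesis by (simp add: not_integrable_integral_eq)
    qed
  qed
  have [measurable]: "(\<lambda>\<eta>. \<integral>\<^sup>+x. ennreal (f x) \<partial>\<eta>) \<in> borel_measurable (point_pattern_algebra M)"
    "(\<lambda>\<eta>. \<integral>\<^sup>+x. ennreal (- f x) \<partial>\<eta>) \<in> borel_measurable (point_pattern_algebra M)"
    "(\<lambda>\<eta>. \<integral>\<^sup>+x. ennreal \<bar>f x\<bar> \<partial>\<eta>) \<in> borel_measurable (point_pattern_algebra M)"
    using f by (auto intro!: measurable_nn_integral_point_pattern)
  show ?thesis by (intro iffD2[OF measurable_cong, OF *]) measurable
qed

lemma measurable_set_integral_point_pattern [measurable]:
  fixes f :: "'a \<Rightarrow> real"
  assumes "A \<in> sets M" "f \<in> borel_measurable M"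
  shows "(\<lambda>\<eta>. LINT x:A|\<eta>. f x) \<in> borel_measurable (point_pattern_algebra M)"
  using assms unfolding set_lebesgue_integral_def by measurable

text \<open>A density instead of a restricted space: the underlying space and sigma-algebra stay
  those of M, so restriction maps the point patterns of M to themselves.\<close>

definition restrict_pattern :: "'a set \<Rightarrow> 'a measure \<Rightarrow> 'a measure" where
  "restrict_pattern C \<eta> = density \<eta> (indicator C)"

lemma emeasure_restrict_pattern:
  assumes "\<eta> \<in> point_patterns M" "C \<in> sets M" "B \<in> sets M"
  shows "emeasure (restrict_pattern C \<eta>) B = emeasure \<eta> (C \<inter> B)"
  using assms unfolding restrict_pattern_def
  by (intro emeasure_restricted) (simp_all add: sets_point_pattern)

lemma restrict_pattern_point_patterns:
  assumes \<eta>: "\<eta> \<in> point_patterns M" and C: "C \<in> sets M"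
  shows "restrict_pattern C \<eta> \<in> point_patterns M"
proof -
  from \<eta> obtain m :: "nat \<Rightarrow> 'a measure" where m: "\<And>i. finite_measure (m i)"
    "\<And>i. sets (m i) = sets M" "\<And>i B. B \<in> sets M \<Longrightarrow> emeasure (m i) B \<in> \<nat>"
    "\<And>B. B \<in> sets M \<Longrightarrow> emeasure \<eta> B = (\<Sum>i. emeasure (m i) B)"
    unfolding point_patterns_def by blast
  have e: "emeasure (density (m i) (indicator C)) B = emeasure (m i) (C \<inter> B)"
    if "B \<in> sets M" for i B
    using that C m by (intro emeasure_restricted) auto
  show ?thesis
    unfolding point_patterns_def
  proof (intro CollectI conjI exI[of _ "\<lambda>i. density (m i) (indicator C)"] allI ballI)
    show "sets (restrict_pattern C \<eta>) = sets M"
      using \<eta> by (simp add: restrict_pattern_def sets_point_pattern)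
    show "finite_measure (density (m i) (indicator C))" for i
      using m C by (intro finite_measure.finite_measure_restricted) auto
    show "sets (density (m i) (indicator C)) = sets M" for i using m by simp
    show "emeasure (density (m i) (indicator C)) B \<in> \<nat>" if "B \<in> sets M" for i B
      using that C m by (simp add: e sets.Int)
    show "emeasure (restrict_pattern C \<eta>) B = (\<Sum>i. emeasure (density (m i) (indicator C)) B)"
      if "B \<in> sets M" for B
      using that C m \<eta> by (simp add: e emeasure_restrict_pattern sets.Int)
  qed
qed

lemma measurable_restrict_pattern [measurable]:
  assumes C: "C \<in> sets M"
  shows "restrict_pattern C \<in> measurable (point_pattern_algebra M) (point_pattern_algebra M)"
proof (rule measurable_point_pattern_algebraI)
  fix B assume B: "B \<in> sets M"
  have "(\<lambda>\<eta>. emeasure \<eta> (C \<inter> B)) \<in> borel_measurable (point_pattern_algebra M)"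
    using B C by measurable
  then show "(\<lambda>\<eta>. emeasure (restrict_pattern C \<eta>) B) \<in> borel_measurable (point_pattern_algebra M)"
    using B C by (subst measurable_cong[OF emeasure_restrict_pattern]) simp_all
qed (use C in \<open>simp add: restrict_pattern_point_patterns\<close>)

lemma set_integral_restrict_pattern:
  fixes f :: "'a \<Rightarrow> real"
  assumes \<eta>: "\<eta> \<in> point_patterns M" and [measurable]: "A \<in> sets M" "C \<in> sets M" "f \<in> borel_measurable M"
  shows "(LINT x:A|restrict_pattern C \<eta>. f x) = (LINT x:A \<inter> C|\<eta>. f x)"
proof -
  note [measurable_cong] = sets_point_pattern[OF \<eta>]
  have "restrict_pattern C \<eta> = density \<eta> (\<lambda>x. ennreal (indicator C x))"
    by (simp add: restrict_pattern_def ennreal_indicator)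
  then show ?thesis
    unfolding set_lebesgue_integral_def
    by (simp add: integral_density)
      (auto intro!: Bochner_Integration.integral_cong split: split_indicator)
qed

section \<open>Products over the points of a pattern\<close>

text \<open>The product of \<open>w\<close> over the points of the pattern in \<open>A\<close>, for \<open>w \<ge> 0\<close>. Points where \<open>w\<close>
  vanishes need their own case because \<open>ln 0 = 0\<close>.\<close>

definition pp_prod :: "'a set \<Rightarrow> ('a \<Rightarrow> real) \<Rightarrow> 'a measure \<Rightarrow> real" where
  "pp_prod A w \<eta> = (if emeasure \<eta> {x\<in>A. w x = 0} = 0 then exp (LINT x:A|\<eta>. ln (w x)) else 0)"

lemma pp_prod_nonneg [simp]: "0 \<le> pp_prod A w \<eta>"
  by (simp add: pp_prod_def)

lemma sets_zeros:
  fixes w :: "'a \<Rightarrow> real"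
  assumes "A \<in> sets M" "w \<in> borel_measurable M"
  shows "{x\<in>A. w x = 0} \<in> sets M"
proof -
  have "{x\<in>A. w x = 0} = A \<inter> {x\<in>space M. w x = 0}"
    using sets.sets_into_space[OF assms(1)] by auto
  then show ?thesis using assms by simp
qed

lemma measurable_pp_prod [measurable]:
  assumes [measurable]: "A \<in> sets M" "w \<in> borel_measurable M"
  shows "pp_prod A w \<in> borel_measurable (point_pattern_algebra M)"
proof -
  note [measurable] = sets_zeros[OF assms]
  show ?thesis unfolding pp_prod_def by measurable
qed

lemma pp_prod_cong:
  assumes "\<And>x. x \<in> A \<Longrightarrow> w x = v x"
  shows "pp_prod A w \<eta> = pp_prod A v \<eta>"
proof -
  have "{x\<in>A. w x = 0} = {x\<in>A. v x = 0}" using assms by auto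
  moreover have "(LINT x:A|\<eta>. ln (w x)) = (LINT x:A|\<eta>. ln (v x))"
    unfolding set_lebesgue_integral_def
    by (rule Bochner_Integration.integral_cong) (auto simp: assms split: split_indicator)
  ultimately show ?thesis by (simp add: pp_prod_def)
qed

lemma pp_prod_one [simp]: "pp_prod A (\<lambda>_. 1) \<eta> = 1"
  by (simp add: pp_prod_def)

lemma pp_prod_positive:
  "(\<And>x. x \<in> A \<Longrightarrow> w x \<noteq> 0) \<Longrightarrow> pp_prod A w \<eta> = exp (LINT x:A|\<eta>. ln (w x))"
  by (simp add: pp_prod_def) (metis (mono_tags, lifting) emeasure_empty empty_Collect_eq)

lemma pp_prod_const:
  assumes A: "A \<in> sets \<eta>" "emeasure \<eta> A = of_nat k" and c: "0 \<le> c"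
  shows "pp_prod A (\<lambda>_. c) \<eta> = c ^ k"
proof (cases "c = 0")
  case True
  \<comment> \<open>All of A is a zero of the weight. For k = 0 it is a null set, and the product is
    1, in accordance with \<open>0 ^ 0 = 1\<close>.\<close>
  then show ?thesis using A by (auto simp: pp_prod_def)
next
  case False
  with c have "0 < c" by simp
  have "measure \<eta> A = k"
    using A by (simp add: measure_def ennreal_of_nat_eq_real_of_nat)
  then have "(LINT x:A|\<eta>. ln c) = real k * ln c"
    using A by (simp add: set_lebesgue_integral_def)
  then show ?thesis
    using \<open>0 < c\<close> by (simp add: pp_prod_def exp_of_nat_mult)
qed

context
  fixes M :: "'a measure" and \<eta> :: "'a measure"
  assumes \<eta>: "\<eta> \<in> point_patterns M"
begin

text \<open>The zeros of a product are those of its factors. Off them \<open>ln\<close> is additive,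
  also for negative arguments because \<open>ln (- t) = ln t\<close>, and all logarithms are
  integrable since A carries finitely many points.\<close>

lemma pp_prod_mult:
  assumes A: "A \<in> sets M" "emeasure \<eta> A < \<infinity>"
    and wv: "w \<in> borel_measurable M" "v \<in> borel_measurable M"
  shows "pp_prod A (\<lambda>x. w x * v x) \<eta> = pp_prod A w \<eta> * pp_prod A v \<eta>"
proof -
  note [measurable_cong] = sets_point_pattern[OF \<eta>]
  note [measurable] = A(1) wv sets_zeros[OF A(1) wv(1)] sets_zeros[OF A(1) wv(2)]
  have "{x\<in>A. w x * v x = 0} = {x\<in>A. w x = 0} \<union> {x\<in>A. v x = 0}" by auto
  then have *: "emeasure \<eta> {x\<in>A. w x * v x = 0} = 0 \<longleftrightarrow>
      emeasure \<eta> {x\<in>A. w x = 0} = 0 \<and> emeasure \<eta> {x\<in>A. v x = 0} = 0"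
    by (simp add: emeasure_Un_null_set[unfolded null_sets_def])
      (metis (no_types, lifting) emeasure_mono emeasure_Un_null_set le_zero_eq null_setsI
        sets.Un sets_point_pattern[OF \<eta>] sets_zeros[OF A(1) wv(1)] sets_zeros[OF A(1) wv(2)]
        sup_ge1 sup_ge2)
  show ?thesis
  proof (cases "emeasure \<eta> {x\<in>A. w x * v x = 0} = 0")
    case True
    with * have n: "{x\<in>A. w x = 0} \<in> null_sets \<eta>" "{x\<in>A. v x = 0} \<in> null_sets \<eta>"
      by (auto simp: null_sets_def)
    have "AE x\<in>A in \<eta>. ln (w x * v x) = ln (w x) + ln (v x)"
      using AE_not_in[OF n(1)] AE_not_in[OF n(2)] by eventually_elim (auto simp: ln_mult)
    then have "(LINT x:A|\<eta>. ln (w x * v x)) = (LINT x:A|\<eta>. ln (w x) + ln (v x))"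
      by (intro set_lebesgue_integral_cong_AE) measurable
    also have "\<dots> = (LINT x:A|\<eta>. ln (w x)) + (LINT x:A|\<eta>. ln (v x))"
      using A by (intro set_integral_add point_pattern_set_integrable[OF \<eta>]) measurable
    finally show ?thesis using True * by (simp add: pp_prod_def exp_add)
  qed (use * in \<open>auto simp: pp_prod_def\<close>)
qed

lemma pp_prod_Un:
  assumes A: "A \<in> sets M" "emeasure \<eta> A < \<infinity>" and B: "B \<in> sets M" "emeasure \<eta> B < \<infinity>"
    and AB: "A \<inter> B = {}" and w: "w \<in> borel_measurable M"
  shows "pp_prod (A \<union> B) w \<eta> = pp_prod A w \<eta> * pp_prod B w \<eta>"
proof -
  note s = sets_zeros[OF A(1) w] sets_zeros[OF B(1) w]
  have "{x\<in>A \<union> B. w x = 0} = {x\<in>A. w x = 0} \<union> {x\<in>B. w x = 0}" by auto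
  then have *: "emeasure \<eta> {x\<in>A \<union> B. w x = 0} = emeasure \<eta> {x\<in>A. w x = 0} + emeasure \<eta> {x\<in>B. w x = 0}"
    using s AB by (auto intro!: plus_emeasure[symmetric] simp: sets_point_pattern[OF \<eta>])
  have "(LINT x:A \<union> B|\<eta>. ln (w x)) = (LINT x:A|\<eta>. ln (w x)) + (LINT x:B|\<eta>. ln (w x))"
    using A B AB w by (intro set_integral_Un point_pattern_set_integrable[OF \<eta>]) auto
  then show ?thesis using * by (auto simp: pp_prod_def exp_add)
qed

lemma pp_prod_UN:
  assumes "finite I" "disjoint_family_on B I"
    and B: "\<And>i. i \<in> I \<Longrightarrow> B i \<in> sets M" "\<And>i. i \<in> I \<Longrightarrow> emeasure \<eta> (B i) < \<infinity>"
    and w: "w \<in> borel_measurable M"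
  shows "pp_prod (\<Union>i\<in>I. B i) w \<eta> = (\<Prod>i\<in>I. pp_prod (B i) w \<eta>)"
  using assms(1,2) B
proof (induction I)
  case empty
  then show ?case by (simp add: pp_prod_def set_lebesgue_integral_def)
next
  case (insert i I)
  have d: "B i \<inter> (\<Union>i\<in>I. B i) = {}"
    using insert(2,4) by (auto simp: disjoint_family_on_def)
  have "emeasure \<eta> (\<Union>i\<in>I. B i) \<le> (\<Sum>i\<in>I. emeasure \<eta> (B i))"
    using insert by (intro emeasure_subadditive_finite) (auto simp: sets_point_pattern[OF \<eta>])
  also have "\<dots> < \<infinity>" using insert by auto
  finally have "emeasure \<eta> (\<Union>i\<in>I. B i) < \<infinity>" .
  moreover have "disjoint_family_on B I" using insert(4) by (auto simp: disjoint_family_on_def)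
  ultimately show ?case using insert d w by (simp add: pp_prod_Un sets.finite_UN)
qed

lemma pp_prod_mono:
  assumes A: "A \<in> sets M" "emeasure \<eta> A < \<infinity>"
    and [measurable]: "w \<in> borel_measurable M" "v \<in> borel_measurable M"
    and le: "\<And>x. x \<in> A \<Longrightarrow> 0 \<le> w x" "\<And>x. x \<in> A \<Longrightarrow> w x \<le> v x"
  shows "pp_prod A w \<eta> \<le> pp_prod A v \<eta>"
proof (cases "emeasure \<eta> {x\<in>A. w x = 0} = 0")
  case True
  note [measurable_cong] = sets_point_pattern[OF \<eta>]
  have z: "{x\<in>A. w x = 0} \<in> sets \<eta>" "{x\<in>A. v x = 0} \<in> sets \<eta>"
    using A by (auto intro!: sets_zeros simp: sets_point_pattern[OF \<eta>])
  then have n: "{x\<in>A. w x = 0} \<in> null_sets \<eta>" using True by (auto simp: null_sets_def)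
  have "emeasure \<eta> {x\<in>A. v x = 0} \<le> emeasure \<eta> {x\<in>A. w x = 0}"
    using le z by (intro emeasure_mono) fastforce+
  with True have "emeasure \<eta> {x\<in>A. v x = 0} = 0" by simp
  moreover have "(LINT x:A|\<eta>. ln (w x)) \<le> (LINT x:A|\<eta>. ln (v x))"
  proof -
    have "AE x in \<eta>. indicator A x *\<^sub>R ln (w x) \<le> indicator A x *\<^sub>R ln (v x)"
      using AE_not_in[OF n]
    proof eventually_elim
      case (elim x)
      then show ?case using le[of x] by (cases "x \<in> A") auto
    qed
    moreover have "set_integrable \<eta> A (\<lambda>x. ln (w x))" "set_integrable \<eta> A (\<lambda>x. ln (v x))"
      using A by (auto intro!: point_pattern_set_integrable[OF \<eta>])
    ultimately show ?thesis
      unfolding set_lebesgue_integral_def set_integrable_def by (intro integral_mono_AE)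
  qed
  ultimately show ?thesis using True by (simp add: pp_prod_def)
qed (simp add: pp_prod_def)

text \<open>The difficulty lies in points where \<open>w i\<close> vanishes but v does not: there
  \<open>ln 0 = 0\<close> spoils the monotonicity of the logarithms. The zero sets
  \<open>Z i\<close> decrease to the zeros of v, so by integrality they carry no point from some
  index n on. From then on the logarithms lie between \<open>ln (w n x)\<close> and
  \<open>ln (v x)\<close>, and dominated convergence applies.\<close>

lemma pp_prod_LIMSEQ:
  assumes A: "A \<in> sets M" "emeasure \<eta> A < \<infinity>"
    and [measurable]: "\<And>i. w i \<in> borel_measurable M" "v \<in> borel_measurable M"
    and w: "\<And>i x. 0 \<le> w i x" "\<And>x. incseq (\<lambda>i. w i x)" "\<And>x. (\<lambda>i. w i x) \<longlonglongrightarrow> v x"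
  shows "(\<lambda>i. pp_prod A (w i) \<eta>) \<longlonglongrightarrow> pp_prod A v \<eta>"
proof -
  note [measurable_cong] = sets_point_pattern[OF \<eta>]
  note [measurable] = A(1)
  have wv: "w i x \<le> v x" for i x by (rule incseq_le[OF w(2,3)])
  show ?thesis
  proof (cases "emeasure \<eta> {x\<in>A. v x = 0} = 0")
    case False
    have "pp_prod A (w i) \<eta> = 0" for i
      using pp_prod_mono[OF A, of "w i" v] wv w(1) False
      by (simp add: pp_prod_def[of A v] order_antisym)
    moreover have "pp_prod A v \<eta> = 0" using False by (simp add: pp_prod_def)
    ultimately show ?thesis by simp
  next
    case True
    define Z where "Z i = {x\<in>A. w i x = 0}" for i
    have Z: "Z i \<in> sets M" for i unfolding Z_def by (rule sets_zeros) (use A in auto)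
    have "(\<Inter>i. Z i) = {x\<in>A. v x = 0}"
    proof (intro equalityI subsetI)
      fix x assume "x \<in> (\<Inter>i. Z i)"
      then have "x \<in> A" "\<And>i. w i x = 0" by (auto simp: Z_def)
      moreover from this(2) w(3)[of x] have "v x = 0" by (simp add: LIMSEQ_const_iff)
      ultimately show "x \<in> {x\<in>A. v x = 0}" by simp
    next
      fix x assume "x \<in> {x\<in>A. v x = 0}"
      then show "x \<in> (\<Inter>i. Z i)" using wv[of _ x] w(1)[of _ x] by (auto simp: Z_def order_antisym)
    qed
    moreover have "decseq Z"
      unfolding decseq_def
    proof (intro allI impI subsetI)
      fix i j x assume "i \<le> j" "x \<in> Z j"
      then have "x \<in> A" "w i x \<le> 0" using incseqD[OF w(2), of i j x] by (auto simp: Z_def)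
      then show "x \<in> Z i" using w(1)[of i x] by (simp add: Z_def order_antisym)
    qed
    moreover have "emeasure \<eta> (Z 0) < \<infinity>"
      by (rule order_le_less_trans[OF emeasure_mono A(2)])
        (use A in \<open>auto simp: Z_def sets_point_pattern[OF \<eta>]\<close>)
    ultimately obtain n where n: "\<And>m. m \<ge> n \<Longrightarrow> emeasure \<eta> (Z m) = 0"
      using point_pattern_decseq_null[OF \<eta>, of Z] Z True by auto
    have ae: "AE x\<in>A in \<eta>. 0 < w n x"
    proof (rule AE_I[OF _ n[OF order_refl]])
      show "{x\<in>space \<eta>. \<not> (x \<in> A \<longrightarrow> 0 < w n x)} \<subseteq> Z n"
        using w(1)[of n] by (auto simp: Z_def not_less order_antisym)
    qed (use Z in \<open>simp add: sets_point_pattern[OF \<eta>]\<close>)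
    have "(\<lambda>i. LINT x:A|\<eta>. ln (w (i + n) x)) \<longlonglongrightarrow> (LINT x:A|\<eta>. ln (v x))"
      unfolding set_lebesgue_integral_def
    proof (rule integral_dominated_convergence)
      have "set_integrable \<eta> A (\<lambda>x. \<bar>ln (w n x)\<bar> + \<bar>ln (v x)\<bar>)"
        using A by (intro point_pattern_set_integrable[OF \<eta>]) measurable
      then show "integrable \<eta> (\<lambda>x. indicator A x *\<^sub>R (\<bar>ln (w n x)\<bar> + \<bar>ln (v x)\<bar>))"
        by (simp add: set_integrable_def)
      show "AE x in \<eta>. (\<lambda>i. indicator A x *\<^sub>R ln (w (i + n) x)) \<longlonglongrightarrow> indicator A x *\<^sub>R ln (v x)"
        using ae
      proof eventually_elim
        case (elim x)
        show ?case
        proof (cases "x \<in> A")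
          case True
          with elim have "0 < v x" using wv[of n x] by simp
          then show ?thesis using w(3)[of x]
            by (intro tendsto_intros LIMSEQ_ignore_initial_segment) auto
        qed simp
      qed
      show "AE x in \<eta>. norm (indicator A x *\<^sub>R ln (w (i + n) x)) \<le> indicator A x *\<^sub>R (\<bar>ln (w n x)\<bar> + \<bar>ln (v x)\<bar>)" for i
        using ae
      proof eventually_elim
        case (elim x)
        show ?case
        proof (cases "x \<in> A")
          case True
          have "w n x \<le> w (i + n) x" by (rule incseqD[OF w(2)]) simp
          moreover have "w (i + n) x \<le> v x" by (rule wv)
          ultimately have "ln (w n x) \<le> ln (w (i + n) x)" "ln (w (i + n) x) \<le> ln (v x)"
            using True elim by auto
          then show ?thesis using True by simp
        qed simp
      qed
    qed measurable
    then have "(\<lambda>i. exp (LINT x:A|\<eta>. ln (w (i + n) x))) \<longlonglongrightarrow> pp_prod A v \<eta>"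
      using True by (simp add: pp_prod_def tendsto_exp)
    moreover have "pp_prod A (w (i + n)) \<eta> = exp (LINT x:A|\<eta>. ln (w (i + n) x))" for i
      using n[of "i + n"] by (simp add: pp_prod_def Z_def)
    ultimately show ?thesis by (subst LIMSEQ_offset[where k=n]) auto
  qed
qed

lemma pp_prod_restrict_pattern:
  assumes [measurable]: "A \<in> sets M" "C \<in> sets M" "w \<in> borel_measurable M"
  shows "pp_prod A w (restrict_pattern C \<eta>) = pp_prod (A \<inter> C) w \<eta>"
proof -
  have "C \<inter> {x\<in>A. w x = 0} = {x\<in>A \<inter> C. w x = 0}" by auto
  then show ?thesis
    by (simp add: pp_prod_def emeasure_restrict_pattern[OF \<eta>] sets_zeros set_integral_restrict_pattern[OF \<eta>])
qed

end

section \<open>The Laplace functional of a Poisson pattern\<close>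

lemma nn_integral_LIMSEQ_AE:
  assumes f [measurable]: "\<And>i. f i \<in> borel_measurable N"
    and mono: "AE x in N. \<forall>i. f i x \<le> f (Suc i) x"
    and lim: "AE x in N. (\<lambda>i. f i x) \<longlonglongrightarrow> (u x :: ennreal)"
  shows "(\<lambda>i. \<integral>\<^sup>+x. f i x \<partial>N) \<longlonglongrightarrow> (\<integral>\<^sup>+x. u x \<partial>N)"
proof -
  have "incseq (\<lambda>i. \<integral>\<^sup>+x. f i x \<partial>N)"
    using mono by (intro incseq_SucI nn_integral_mono_AE) auto
  then have "(\<lambda>i. \<integral>\<^sup>+x. f i x \<partial>N) \<longlonglongrightarrow> (SUP i. \<integral>\<^sup>+x. f i x \<partial>N)"
    by (rule LIMSEQ_SUP)
  also have "(SUP i. \<integral>\<^sup>+x. f i x \<partial>N) = (\<integral>\<^sup>+x. (SUP i. f i x) \<partial>N)"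
    using mono by (intro nn_integral_monotone_convergence_SUP_AE[symmetric]) auto
  also have "\<dots> = (\<integral>\<^sup>+x. u x \<partial>N)"
  proof (rule nn_integral_cong_AE)
    show "AE x in N. (SUP i. f i x) = u x"
      using mono lim
    proof eventually_elim
      case (elim x)
      then have "incseq (\<lambda>i. f i x)" by (simp add: incseq_Suc_iff)
      then show ?case using elim(2) LIMSEQ_SUP LIMSEQ_unique by blast
    qed
  qed
  finally show ?thesis .
qed

text \<open>The probability generating function of the Poisson law at c. The exponent turns an
  extended nonnegative real back into the natural number that it almost surely is.\<close>

lemma nn_integral_poisson_law_power:
  assumes r: "r < \<infinity>" and c: "0 \<le> c"
  shows "(\<integral>\<^sup>+x. ennreal (c ^ nat \<lfloor>enn2real x\<rfloor>) \<partial>poisson_law r) = ennreal (exp ((c - 1) * enn2real r))"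
proof (cases "r = 0")
  case True
  then show ?thesis by (simp add: poisson_law_def nn_integral_return)
next
  case False
  define m where "m = enn2real r"
  have m: "0 < m" using r False by (simp add: m_def enn2real_positive_iff zero_less_iff_neq_zero)
  have law: "poisson_law r = distr (measure_pmf (poisson_pmf m)) borel of_nat"
    using r False by (auto simp: poisson_law_def m_def)
  have nat: "nat \<lfloor>enn2real (of_nat k)\<rfloor> = k" for k
    by (simp add: ennreal_of_nat_eq_real_of_nat)
  have "(\<integral>\<^sup>+x. ennreal (c ^ nat \<lfloor>enn2real x\<rfloor>) \<partial>poisson_law r)
      = (\<integral>\<^sup>+k. ennreal (c ^ k) \<partial>measure_pmf (poisson_pmf m))"
    unfolding law by (subst nn_integral_distr) (simp_all add: nat)
  also have "\<dots> = (\<Sum>k. ennreal (pmf (poisson_pmf m) k) * ennreal (c ^ k))"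
    by (simp add: nn_integral_measure_pmf nn_integral_count_space_nat)
  also have "\<dots> = (\<Sum>k. ennreal (exp (- m) * ((c * m) ^ k / fact k)))"
    using m c by (intro suminf_cong) (simp add: ennreal_mult[symmetric] power_mult_distrib field_simps)
  also have "\<dots> = ennreal (exp (- m) * exp (c * m))"
  proof (rule suminf_ennreal_eq)
    have "(\<lambda>k. (c * m) ^ k / fact k) sums exp (c * m)"
      using exp_converges[of "c * m"] by (simp add: field_simps)
    then show "(\<lambda>k. exp (- m) * ((c * m) ^ k / fact k)) sums (exp (- m) * exp (c * m))"
      by (rule sums_mult)
  qed (use m c in simp)
  also have "exp (- m) * exp (c * m) = exp ((c - 1) * m)"
    by (simp add: exp_add[symmetric] algebra_simps)
  finally show ?thesis by (simp add: m_def)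
qed

locale poisson_pattern = prob_space P for P :: "'a measure measure" +
  fixes M :: "'a measure"
  assumes poisson: "poisson_pp_distribution M P"
begin

lemma sets_P [measurable_cong]: "sets P = sets (point_pattern_algebra M)"
  using poisson by (simp add: poisson_pp_distribution_def)

lemma space_P: "space P = point_patterns M"
  using sets_eq_imp_space_eq[OF sets_P] by simp

lemma AE_emeasure_finite:
  assumes A: "A \<in> sets M" "emeasure M A < \<infinity>"
  shows "AE \<eta> in P. emeasure \<eta> A < \<infinity>"
proof -
  have [measurable]: "(\<lambda>\<eta>. emeasure \<eta> A) \<in> borel_measurable P"
    using A measurable_emeasure_point_pattern[of A M] by (simp add: measurable_cong_sets[OF sets_P])
  have "distr P borel (\<lambda>\<eta>. emeasure \<eta> A) = poisson_law (emeasure M A)"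
    using poisson A by (simp add: poisson_pp_distribution_def)
  moreover have "AE x in poisson_law (emeasure M A). x < \<infinity>"
  proof (cases "emeasure M A = 0")
    case True
    then have *: "poisson_law (emeasure M A) = return borel 0" by (simp add: poisson_law_def)
    show ?thesis unfolding * by (subst AE_return) auto
  next
    case False
    with A(2) have "poisson_law (emeasure M A)
        = distr (measure_pmf (poisson_pmf (enn2real (emeasure M A)))) borel of_nat"
      by (auto simp: poisson_law_def)
    then show ?thesis by (simp only:) (subst AE_distr_iff, auto simp: of_nat_less_top)
  qed
  ultimately have "AE x in distr P borel (\<lambda>\<eta>. emeasure \<eta> A). x < \<infinity>" by (simp only:)
  then show ?thesis by (subst (asm) AE_distr_iff) auto
qed

lemma pp_prod_const_eq:
  assumes "\<eta> \<in> point_patterns M" "A \<in> sets M" "emeasure \<eta> A < \<infinity>" "0 \<le> c"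
  shows "pp_prod A (\<lambda>_. c) \<eta> = c ^ nat \<lfloor>enn2real (emeasure \<eta> A)\<rfloor>"
proof -
  from emeasure_point_pattern_cases[OF assms(1), of A] assms(3)
  obtain k where k: "emeasure \<eta> A = of_nat k" by auto
  moreover have "nat \<lfloor>enn2real (of_nat k)\<rfloor> = k"
    by (simp add: ennreal_of_nat_eq_real_of_nat)
  ultimately show ?thesis
    using assms by (simp add: pp_prod_const sets_point_pattern)
qed

lemma expectation_power_emeasure:
  assumes A: "A \<in> sets M" "emeasure M A < \<infinity>" and c: "0 \<le> c"
  shows "(\<integral>\<^sup>+\<eta>. ennreal (c ^ nat \<lfloor>enn2real (emeasure \<eta> A)\<rfloor>) \<partial>P)
    = ennreal (exp ((c - 1) * measure M A))"
proof -
  have [measurable]: "(\<lambda>\<eta>. emeasure \<eta> A) \<in> borel_measurable P"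
    using A measurable_emeasure_point_pattern[of A M] by (simp add: measurable_cong_sets[OF sets_P])
  have "(\<integral>\<^sup>+\<eta>. ennreal (c ^ nat \<lfloor>enn2real (emeasure \<eta> A)\<rfloor>) \<partial>P)
      = (\<integral>\<^sup>+x. ennreal (c ^ nat \<lfloor>enn2real x\<rfloor>) \<partial>distr P borel (\<lambda>\<eta>. emeasure \<eta> A))"
    by (subst nn_integral_distr) auto
  also have "distr P borel (\<lambda>\<eta>. emeasure \<eta> A) = poisson_law (emeasure M A)"
    using poisson A by (simp add: poisson_pp_distribution_def)
  finally show ?thesis
    using A c by (simp add: nn_integral_poisson_law_power measure_def)
qed

text \<open>On the level set \<open>B i\<close> of w in A the product equals \<open>e i\<close> to
  the power of the number of points. The level sets are disjoint, so these numbers are independent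
  Poisson variables and the expectation splits into their generating functions.\<close>

lemma laplace_simple:
  assumes A: "A \<in> sets M" "emeasure M A < \<infinity>"
    and w: "simple_function M w" "\<And>x. 0 \<le> (w x::real)"
  shows "(\<integral>\<^sup>+\<eta>. ennreal (pp_prod A w \<eta>) \<partial>P) = ennreal (exp (LINT x:A|M. w x - 1))"
proof -
  have wm [measurable]: "w \<in> borel_measurable M"
    using w(1) by (rule borel_measurable_simple_function)
  \<comment> \<open>The extra value 0 keeps V nonempty even if the space is empty; the independence
    clause for a Poisson pattern speaks of at least one set.\<close>
  define V where "V = insert 0 (w ` space M)"
  have "finite V" using w(1) by (simp add: V_def simple_function_def)
  then obtain e where e: "bij_betw e {..<card V} V"
    using ex_bij_betw_nat_finite[of V] by (auto simp: atLeast0LessThan)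
  define n where "n = card V"
  have n: "n \<ge> 1" using \<open>finite V\<close> by (simp add: n_def V_def Suc_le_eq card_gt_0_iff)
  have e0: "0 \<le> e i" if "i < n" for i
    proof -
    have "e i \<in> V" using bij_betwE[OF e] that by (auto simp: n_def)
    then show ?thesis using w(2) by (auto simp: V_def)
  qed
  define B where "B i = {x\<in>A. w x = e i}" for i
  have BA: "B i = A \<inter> {x\<in>space M. w x = e i}" for i
    using sets.sets_into_space[OF A(1)] by (auto simp: B_def)
  have B [measurable]: "B i \<in> sets M" for i unfolding BA using A by measurable
  have BM: "emeasure M (B i) < \<infinity>" for i
    by (rule order_le_less_trans[OF emeasure_mono A(2)]) (use A in \<open>auto simp: B_def\<close>)
  have d: "disjoint_family_on B {..<n}"
    using bij_betw_imp_inj_on[OF e] by (auto simp: disjoint_family_on_def B_def n_def inj_on_def)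
  have U: "(\<Union>i<n. B i) = A"
  proof (intro equalityI subsetI)
    fix x assume "x \<in> A"
    then have "w x \<in> V" using sets.sets_into_space[OF A(1)] by (auto simp: V_def)
    then obtain i where "i < n" "w x = e i" using e by (auto simp: bij_betw_def n_def)
    with \<open>x \<in> A\<close> show "x \<in> (\<Union>i<n. B i)" by (auto simp: B_def)
  qed (auto simp: B_def)
  have "AE \<eta> in P. \<forall>i\<in>{..<n}. emeasure \<eta> (B i) < \<infinity>"
    by (intro AE_ball_countable' AE_emeasure_finite[OF B BM]) simp
  then have "AE \<eta> in P. pp_prod A w \<eta> = (\<Prod>i<n. e i ^ nat \<lfloor>enn2real (emeasure \<eta> (B i))\<rfloor>)"
    using AE_space
  proof eventually_elim
    case (elim \<eta>)
    then have \<eta>: "\<eta> \<in> point_patterns M" by (simp add: space_P)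
    have "pp_prod A w \<eta> = (\<Prod>i<n. pp_prod (B i) w \<eta>)"
      unfolding U[symmetric] by (rule pp_prod_UN[OF \<eta> _ d]) (use elim in auto)
    also have "\<dots> = (\<Prod>i<n. e i ^ nat \<lfloor>enn2real (emeasure \<eta> (B i))\<rfloor>)"
    proof (rule prod.cong[OF refl])
      fix i assume i: "i \<in> {..<n}"
      have "pp_prod (B i) w \<eta> = pp_prod (B i) (\<lambda>_. e i) \<eta>"
        by (rule pp_prod_cong) (simp add: B_def)
      also have "\<dots> = e i ^ nat \<lfloor>enn2real (emeasure \<eta> (B i))\<rfloor>"
        using i elim(1) e0 by (intro pp_prod_const_eq[OF \<eta>]) auto
      finally show "pp_prod (B i) w \<eta> = e i ^ nat \<lfloor>enn2real (emeasure \<eta> (B i))\<rfloor>" .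
    qed
    finally show ?case .
  qed
  then have "(\<integral>\<^sup>+\<eta>. ennreal (pp_prod A w \<eta>) \<partial>P)
      = (\<integral>\<^sup>+\<eta>. (\<Prod>i<n. ennreal (e i ^ nat \<lfloor>enn2real (emeasure \<eta> (B i))\<rfloor>)) \<partial>P)"
    by (intro nn_integral_cong_AE, eventually_elim) (subst prod_ennreal, auto simp: e0)
  also have "\<dots> = (\<Prod>i<n. \<integral>\<^sup>+\<eta>. ennreal (e i ^ nat \<lfloor>enn2real (emeasure \<eta> (B i))\<rfloor>) \<partial>P)"
  proof (rule indep_vars_nn_integral)
    have "indep_vars (\<lambda>_. borel) (\<lambda>i \<eta>. emeasure \<eta> (B i)) {..<n}"
      using poisson n d B unfolding poisson_pp_distribution_def by (metis image_subsetI)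
    then show "indep_vars (\<lambda>_. borel)
        (\<lambda>i \<eta>. ennreal (e i ^ nat \<lfloor>enn2real (emeasure \<eta> (B i))\<rfloor>)) {..<n}"
      by (rule indep_vars_compose2) measurable
  qed auto
  also have "\<dots> = (\<Prod>i<n. ennreal (exp ((e i - 1) * measure M (B i))))"
    by (intro prod.cong refl expectation_power_emeasure[OF B BM]) (simp add: e0)
  also have "\<dots> = ennreal (exp (\<Sum>i<n. (e i - 1) * measure M (B i)))"
    by (simp add: prod_ennreal exp_sum)
  also have "(\<Sum>i<n. (e i - 1) * measure M (B i)) = (\<Sum>i<n. LINT x:B i|M. w x - 1)"
  proof (rule sum.cong[OF refl])
    fix i
    have "(LINT x:B i|M. w x - 1) = (LINT x:B i|M. e i - 1)"
      using B by (rule set_lebesgue_integral_cong) (simp add: B_def)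
    then show "(e i - 1) * measure M (B i) = (LINT x:B i|M. w x - 1)"
      using B[of i] BM[of i] by (simp add: set_lebesgue_integral_def)
  qed
  also have "\<dots> = (LINT x:A|M. w x - 1)"
    unfolding U[symmetric]
  proof (rule set_integral_finite_Union[symmetric])
    fix i
    have "set_integrable M (B i) (\<lambda>x. w x - 1) \<longleftrightarrow> set_integrable M (B i) (\<lambda>x. e i - 1)"
      by (rule set_integrable_cong) (auto simp: B_def)
    then show "set_integrable M (B i) (\<lambda>x. w x - 1)"
      using B[of i] BM[of i] by (simp add: set_integrable_def)
  qed (use d in auto)
  finally show ?thesis .
qed

text \<open>Simple functions increase to w. The products over the points converge monotonically, and
  the exponents converge by domination with \<open>w x + 1\<close> on A.\<close>

theorem laplace:
  assumes A: "A \<in> sets M" "emeasure M A < \<infinity>"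
    and w [measurable]: "w \<in> borel_measurable M" and w0: "\<And>x. x \<in> A \<Longrightarrow> 0 \<le> (w x::real)"
    and int: "set_integrable M A w"
  shows "(\<integral>\<^sup>+\<eta>. ennreal (pp_prod A w \<eta>) \<partial>P) = ennreal (exp (LINT x:A|M. w x - 1))"
proof -
  note [measurable] = A(1)
  have one: "set_integrable M A (\<lambda>_. 1::real)"
    using A by (simp add: set_integrable_def)
  \<comment> \<open>The approximation by simple functions asks for a function that is nonnegative
    everywhere, whereas w is so on A only.\<close>
  define v where "v x = max 0 (w x)" for x
  have v [measurable]: "v \<in> borel_measurable M" unfolding v_def by measurable
  have vw: "v x = w x" if "x \<in> A" for x using w0[OF that] by (simp add: v_def)
  have "\<exists>f. incseq f \<and> (\<forall>i. simple_function M (f i)) \<and> (\<forall>x. bdd_above (range (\<lambda>i. f i x))) \<and>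
             (\<forall>i x. 0 \<le> f i x) \<and> v = (SUP i. f i)"
    by (rule borel_measurable_implies_simple_function_sequence_real) (auto simp: v_def)
  then obtain f where f: "incseq f" "\<And>i. simple_function M (f i)"
      "\<And>x. bdd_above (range (\<lambda>i. f i x))" "\<And>i x. 0 \<le> f i x" "v = (SUP i. f i)"
    by blast
  have fm [measurable]: "f i \<in> borel_measurable M" for i
    using f(2) by (rule borel_measurable_simple_function)
  have finc: "incseq (\<lambda>i. f i x)" for x
    using f(1) by (auto simp: incseq_def le_fun_def)
  have flim: "(\<lambda>i. f i x) \<longlonglongrightarrow> v x" for x
    using LIMSEQ_incseq_SUP[OF f(3) finc, of x] by (simp add: f(5) image_image)
  have fle: "f i x \<le> v x" for i x by (rule incseq_le[OF finc flim])
  have "(\<lambda>i. \<integral>\<^sup>+\<eta>. ennreal (pp_prod A (f i) \<eta>) \<partial>P) \<longlonglongrightarrow> (\<integral>\<^sup>+\<eta>. ennreal (pp_prod A v \<eta>) \<partial>P)"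
  proof -
    have good: "AE \<eta> in P. \<eta> \<in> point_patterns M \<and> emeasure \<eta> A < \<infinity>"
      using AE_emeasure_finite[OF A] AE_space by eventually_elim (simp add: space_P)
    show ?thesis
    proof (rule nn_integral_LIMSEQ_AE)
      show "AE \<eta> in P. \<forall>i. ennreal (pp_prod A (f i) \<eta>) \<le> ennreal (pp_prod A (f (Suc i)) \<eta>)"
        using good by eventually_elim
          (use A f(4) finc in \<open>auto intro!: ennreal_leI pp_prod_mono simp: incseq_Suc_iff\<close>)
      show "AE \<eta> in P. (\<lambda>i. ennreal (pp_prod A (f i) \<eta>)) \<longlonglongrightarrow> ennreal (pp_prod A v \<eta>)"
        using good by eventually_elim
          (use A f(4) finc flim in \<open>auto intro!: tendsto_ennrealI pp_prod_LIMSEQ\<close>)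
    qed measurable
  qed
  moreover have "(\<lambda>i. ennreal (exp (LINT x:A|M. f i x - 1))) \<longlonglongrightarrow> ennreal (exp (LINT x:A|M. v x - 1))"
  proof (intro tendsto_ennrealI tendsto_exp)
    show "(\<lambda>i. LINT x:A|M. f i x - 1) \<longlonglongrightarrow> (LINT x:A|M. v x - 1)"
      unfolding set_lebesgue_integral_def
    proof (rule integral_dominated_convergence)
      have "set_integrable M A (\<lambda>x. w x + 1)" by (rule set_integral_add(1)[OF int one])
      then show "integrable M (\<lambda>x. indicator A x *\<^sub>R (w x + 1))" by (simp add: set_integrable_def)
      show "AE x in M. (\<lambda>i. indicator A x *\<^sub>R (f i x - 1)) \<longlonglongrightarrow> indicator A x *\<^sub>R (v x - 1)"
        by (intro AE_I2 tendsto_intros flim)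
      show "AE x in M. norm (indicator A x *\<^sub>R (f i x - 1)) \<le> indicator A x *\<^sub>R (w x + 1)" for i
      proof (intro AE_I2)
        fix x
        show "norm (indicator A x *\<^sub>R (f i x - 1)) \<le> indicator A x *\<^sub>R (w x + 1)"
          using f(4)[of i x] fle[of i x] vw[of x] by (cases "x \<in> A") auto
      qed
    qed measurable
  qed
  ultimately have "(\<integral>\<^sup>+\<eta>. ennreal (pp_prod A v \<eta>) \<partial>P) = ennreal (exp (LINT x:A|M. v x - 1))"
    unfolding laplace_simple[OF A f(2,4)] by (rule LIMSEQ_unique)
  moreover have "pp_prod A v \<eta> = pp_prod A w \<eta>" for \<eta> by (rule pp_prod_cong) (rule vw)
  moreover have "(LINT x:A|M. v x - 1) = (LINT x:A|M. w x - 1)"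
    by (rule set_lebesgue_integral_cong) (use A vw in auto)
  ultimately show ?thesis by simp
qed

end

section \<open>The Laplace functional determines the law\<close>

text \<open>Only s in (0, 1) is available, since the weights of the Laplace functional will be
  positive and at most 1. By induction the lower coefficients of the difference series d vanish;
  dividing by \<open>s ^ k\<close> and letting s tend to 0 from the right isolates
  \<open>d k\<close>.\<close>

lemma powser_coeff_unique:
  fixes a b :: "nat \<Rightarrow> real"
  assumes nn: "\<And>k. 0 \<le> a k" "\<And>k. 0 \<le> b k" and sm: "summable a" "summable b"
    and eq: "\<And>s. 0 < s \<Longrightarrow> s < 1 \<Longrightarrow> (\<Sum>k. a k * s ^ k) = (\<Sum>k. b k * s ^ k)"
  shows "a k = b k"
proof -
  have sp: "summable (\<lambda>k. c k * x ^ k)" if "\<And>k. 0 \<le> c k" "summable c" "norm x < 1"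
    for c :: "nat \<Rightarrow> real" and x
  proof (rule summable_comparison_test'[OF that(2), of 0])
    fix n
    have "\<bar>x\<bar> ^ n \<le> 1" using that(3) by (intro power_le_one) auto
    then show "norm (c n * x ^ n) \<le> c n"
      using that(1)[of n] by (simp add: abs_mult power_abs mult_left_le)
  qed
  define d where "d k = a k - b k" for k
  have ds: "summable (\<lambda>k. d k * x ^ k)" if "norm x < 1" for x
    using summable_diff[OF sp[OF nn(1) sm(1) that] sp[OF nn(2) sm(2) that]]
    by (simp add: d_def left_diff_distrib)
  have d0: "(\<Sum>k. d k * s ^ k) = 0" if "0 < s" "s < 1" for s
    using suminf_diff[OF sp[OF nn(1) sm(1), of s] sp[OF nn(2) sm(2), of s]] eq[OF that] that
    by (simp add: d_def left_diff_distrib)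
  have "d k = 0"
  proof (induction k rule: less_induct)
    case (less k)
    define g where "g s = (\<Sum>j. d (j + k) * s ^ j)" for s
    have dsk: "summable (\<lambda>j. d (j + k) * s ^ j)" if "norm s < 1" "s \<noteq> 0" for s
    proof -
      have "summable (\<lambda>j. (d (j + k) * s ^ (j + k)) * inverse (s ^ k))"
        using ds[OF that(1)] by (intro summable_mult2) (rule summable_ignore_initial_segment)
      then show ?thesis using that(2) by (simp add: power_add field_simps)
    qed
    have "(g \<longlongrightarrow> d (0 + k)) (at 0)"
      by (rule powser_limit_0_strong[of 1 "\<lambda>j. d (j + k)"]) (auto simp: g_def intro!: summable_sums dsk)
    then have "(g \<longlongrightarrow> d k) (at_right 0)"
      by (auto intro: tendsto_mono[OF at_le])
    moreover have "(g \<longlongrightarrow> 0) (at_right 0)"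
    proof (rule tendsto_eventually)
      have "g s = 0" if s: "0 < s" "s < 1" for s
      proof -
        have "(\<Sum>j. d j * s ^ j) = (\<Sum>j. d (j + k) * s ^ (j + k)) + (\<Sum>j<k. d j * s ^ j)"
          using s by (intro suminf_split_initial_segment ds) auto
        also have "(\<Sum>j<k. d j * s ^ j) = 0" using less by simp
        also have "(\<Sum>j. d (j + k) * s ^ (j + k)) = g s * s ^ k"
          unfolding g_def using s by (subst suminf_mult2[OF dsk]) (auto simp: power_add mult.assoc)
        finally show ?thesis using d0[OF s] s by simp
      qed
      then show "\<forall>\<^sub>F s in at_right 0. g s = 0"
        by (intro eventually_at_rightI[of 0 1]) auto
    qed
    ultimately show "d k = 0" by (rule tendsto_unique[rotated]) simp
  qed
  then show ?thesis by (simp add: d_def)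
qed

lemma ennreal_powser_coeff_unique:
  fixes c d :: "nat \<Rightarrow> ennreal"
  assumes fin: "(\<Sum>k. c k) < \<infinity>" "(\<Sum>k. d k) < \<infinity>"
    and eq: "\<And>s. 0 < s \<Longrightarrow> s < 1 \<Longrightarrow>
      (\<Sum>k. ennreal (s ^ k) * c k) = (\<Sum>k. ennreal (s ^ k) * d k)"
  shows "c k = d k"
proof -
  have f: "c k \<noteq> \<infinity>" "d k \<noteq> \<infinity>" for k
    using ennreal_suminf_lessD[OF fin(1), of k] ennreal_suminf_lessD[OF fin(2), of k] by simp_all
  define a b where "a k = enn2real (c k)" and "b k = enn2real (d k)" for k
  have c: "c k = ennreal (a k)" and d: "d k = ennreal (b k)" for k
    using f[of k] by (simp_all add: a_def b_def less_top)
  have nn: "0 \<le> a k" "0 \<le> b k" for k by (auto simp: a_def b_def)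
  have sm: "summable a" "summable b"
    using fin nn by (simp_all add: c d summable_suminf_not_top)
  have *: "(\<Sum>k. ennreal (s ^ k) * ennreal (h k)) = ennreal (\<Sum>k. h k * s ^ k)"
    if s: "0 < s" "s < 1" and h: "\<And>k. 0 \<le> h k" "summable h" for s and h :: "nat \<Rightarrow> real"
  proof -
    have "summable (\<lambda>k. h k * s ^ k)"
      by (rule summable_comparison_test'[OF h(2), of 0])
        (use s h(1) in \<open>simp add: power_le_one mult_left_le\<close>)
    then have "(\<Sum>k. ennreal (h k * s ^ k)) = ennreal (\<Sum>k. h k * s ^ k)"
      using h s by (intro suminf_ennreal_eq) auto
    then show ?thesis using h s by (simp add: ennreal_mult mult.commute)
  qed
  have "a k = b k"
  proof (rule powser_coeff_unique[OF nn sm])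
    fix s :: real assume s: "0 < s" "s < 1"
    have "ennreal (\<Sum>k. a k * s ^ k) = ennreal (\<Sum>k. b k * s ^ k)"
      using eq[OF s] *[OF s nn(1) sm(1)] *[OF s nn(2) sm(2)] by (simp add: c d)
    moreover have "summable (\<lambda>k. h k * s ^ k)" if "\<And>k. 0 \<le> h k" "summable h" for h :: "nat \<Rightarrow> real"
      by (rule summable_comparison_test'[OF that(2), of 0])
        (use s that(1) in \<open>simp add: power_le_one mult_left_le\<close>)
    ultimately show "(\<Sum>k. a k * s ^ k) = (\<Sum>k. b k * s ^ k)"
      using nn sm s by (subst (asm) ennreal_inj) (auto intro!: suminf_nonneg)
  qed
  then show ?thesis by (simp add: c d)
qed

section \<open>Events prescribing finitely many counts\<close>

definition count_event :: "'a measure \<Rightarrow> ('a set \<times> nat) set \<Rightarrow> 'a measure set" where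
  "count_event M F = {\<eta>\<in>point_patterns M. \<forall>(B, k)\<in>F. emeasure \<eta> B = of_nat k}"

lemma sets_count_event:
  assumes "finite F" "fst ` F \<subseteq> sets M"
  shows "count_event M F \<in> sets (point_pattern_algebra M)"
proof -
  have "count_event M F = {\<eta>\<in>space (point_pattern_algebra M). \<forall>p\<in>F. emeasure \<eta> (fst p) = of_nat (snd p)}"
    by (auto simp: count_event_def)
  also have "\<dots> \<in> sets (point_pattern_algebra M)"
  proof (rule sets.sets_Collect_finite_All)
    fix p assume "p \<in> F"
    then have [measurable]: "fst p \<in> sets M" using assms by auto
    show "{\<eta>\<in>space (point_pattern_algebra M). emeasure \<eta> (fst p) = of_nat (snd p)}
        \<in> sets (point_pattern_algebra M)"
      by measurable
  qed (rule assms)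
  finally show ?thesis .
qed

locale exhaustion =
  fixes M :: "'a measure" and T :: "nat \<Rightarrow> 'a set"
  assumes sets_T [measurable]: "\<And>n. T n \<in> sets M"
    and inc_T: "incseq T" and UN_T: "(\<Union>n. T n) = space M"
begin

text \<open>All constraints live in a common \<open>T n\<close>, so that one Laplace functional over
  \<open>T n\<close> sees all of them. An intersection of two events is obtained by uniting their
  constraint sets, the larger of the two sets \<open>T n\<close> serving for both.\<close>

definition count_events :: "'a measure set set" where
  "count_events = {count_event M F | F. finite F \<and> (\<exists>n. \<forall>p\<in>F. fst p \<in> sets M \<and> fst p \<subseteq> T n)}"

lemma count_events_subset: "count_events \<subseteq> Pow (point_patterns M)"
  by (auto simp: count_events_def count_event_def)

lemma Int_stable_count_events: "Int_stable count_events"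
proof (rule Int_stableI)
  fix a b assume "a \<in> count_events" "b \<in> count_events"
  then obtain F G m n where F: "a = count_event M F" "finite F" "\<forall>p\<in>F. fst p \<in> sets M \<and> fst p \<subseteq> T m"
    and G: "b = count_event M G" "finite G" "\<forall>p\<in>G. fst p \<in> sets M \<and> fst p \<subseteq> T n"
    by (auto simp: count_events_def)
  have "a \<inter> b = count_event M (F \<union> G)" by (auto simp: F G count_event_def)
  moreover have "T m \<subseteq> T (max m n)" "T n \<subseteq> T (max m n)"
    using incseqD[OF inc_T] by auto
  ultimately show "a \<inter> b \<in> count_events"
    unfolding count_events_def using F(2,3) G(2,3)
    by (intro CollectI exI[of _ "F \<union> G"] conjI exI[of _ "max m n"]) blast+
qed

text \<open>For B inside some \<open>T n\<close> the count is recovered from the events that it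
  equals k, with the value \<infinity> on the complement of their union. The count of an arbitrary B
  is the supremum of the counts of \<open>B \<inter> T n\<close>.\<close>

lemma sets_point_pattern_algebra_eq:
  "sets (point_pattern_algebra M) = sigma_sets (point_patterns M) count_events"
proof (intro equalityI)
  define N where "N = sigma (point_patterns M) count_events"
  have sN: "sets N = sigma_sets (point_patterns M) count_events"
    unfolding N_def by (rule sets_measure_of) (rule count_events_subset)
  have spN: "space N = point_patterns M"
    unfolding N_def by (rule space_measure_of) (rule count_events_subset)
  have *: "(\<lambda>\<eta>. emeasure \<eta> B) \<in> borel_measurable N" if B: "B \<in> sets M" "B \<subseteq> T n" for B n
  proof -
    have [measurable]: "count_event M {(B, k)} \<in> sets N" for k
      unfolding sN count_events_def using B by (intro sigma_sets.Basic) force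
    have "(\<lambda>\<eta>. if \<eta> \<in> (\<Union>k. count_event M {(B, k)})
        then \<Sum>k. of_nat k * indicator (count_event M {(B, k)}) \<eta> else (\<infinity>::ennreal)) \<in> borel_measurable N"
      by measurable
    also have "?this \<longleftrightarrow> (\<lambda>\<eta>. emeasure \<eta> B) \<in> borel_measurable N"
    proof (rule measurable_cong)
      fix \<eta> assume "\<eta> \<in> space N"
      then have \<eta>: "\<eta> \<in> point_patterns M" by (simp add: spN)
      show "(if \<eta> \<in> (\<Union>k. count_event M {(B, k)})
        then \<Sum>k. of_nat k * indicator (count_event M {(B, k)}) \<eta> else (\<infinity>::ennreal)) = emeasure \<eta> B"
      proof (cases "emeasure \<eta> B = \<infinity>")
        case True
        then show ?thesis by (auto simp: count_event_def)
      next
        case False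
        with emeasure_point_pattern_cases[OF \<eta>, of B] obtain j where j: "emeasure \<eta> B = of_nat j"
          by blast
        then have i: "\<eta> \<in> count_event M {(B, k)} \<longleftrightarrow> k = j" for k
          using \<eta> by (auto simp: count_event_def)
        have "(\<Sum>k. of_nat k * indicator (count_event M {(B, k)}) \<eta>)
          = (\<Sum>k\<in>{j}. of_nat k * indicator (count_event M {(B, k)}) \<eta> :: ennreal)"
          by (rule suminf_finite) (auto simp: i)
        then show ?thesis using j i by auto
      qed
    qed
    finally show ?thesis .
  qed
  have "(\<lambda>\<eta>. \<eta>) \<in> measurable N (point_pattern_algebra M)"
  proof (rule measurable_point_pattern_algebraI)
    fix B assume B: "B \<in> sets M"
    have "(\<lambda>\<eta>. SUP n. emeasure \<eta> (B \<inter> T n)) \<in> borel_measurable N"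
      using B by (intro borel_measurable_SUP *) auto
    also have "?this \<longleftrightarrow> (\<lambda>\<eta>. emeasure \<eta> B) \<in> borel_measurable N"
    proof (rule measurable_cong)
      fix \<eta> assume "\<eta> \<in> space N"
      then have \<eta>: "\<eta> \<in> point_patterns M" by (simp add: spN)
      have "(SUP n. emeasure \<eta> (B \<inter> T n)) = emeasure \<eta> (\<Union>n. B \<inter> T n)"
      proof (rule SUP_emeasure_incseq)
        show "range (\<lambda>n. B \<inter> T n) \<subseteq> sets \<eta>" using B by (auto simp: sets_point_pattern[OF \<eta>])
        show "incseq (\<lambda>n. B \<inter> T n)" using inc_T by (auto simp: incseq_def)
      qed
      also have "(\<Union>n. B \<inter> T n) = B"
        using sets.sets_into_space[OF B] by (simp add: Int_UN_distrib[symmetric] UN_T Int_absorb2)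
      finally show "(SUP n. emeasure \<eta> (B \<inter> T n)) = emeasure \<eta> B" .
    qed
    finally show "(\<lambda>\<eta>. emeasure \<eta> B) \<in> borel_measurable N" .
  qed (simp add: spN)
  then have "A \<in> sets N" if "A \<in> sets (point_pattern_algebra M)" for A
    using measurable_sets[OF _ that, of "\<lambda>\<eta>. \<eta>" N] sets.sets_into_space[OF that]
    by (simp add: spN Int_absorb2)
  then show "sets (point_pattern_algebra M) \<subseteq> sigma_sets (point_patterns M) count_events"
    by (auto simp: sN)
  show "sigma_sets (point_patterns M) count_events \<subseteq> sets (point_pattern_algebra M)"
    unfolding space_point_pattern_algebra[symmetric]
    by (rule sets.sigma_sets_subset) (auto simp: count_events_def intro!: sets_count_event)
qed

text \<open>Expanding the Laplace functional in powers of one weight at a time turns it into the joint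
  law of the numbers of points.\<close>

lemma nn_integral_count_event_expand:
  assumes sP [measurable_cong]: "sets P = sets (point_pattern_algebra M)"
    and fin: "AE \<eta> in P. emeasure \<eta> (T n) < \<infinity>"
    and F: "finite F" "fst ` F \<subseteq> sets M" and B: "B \<in> sets M" "B \<subseteq> T n"
    and v [measurable]: "v \<in> borel_measurable M" and s: "0 < s"
  shows "(\<integral>\<^sup>+\<eta>. indicator (count_event M F) \<eta> * ennreal (pp_prod (T n) (\<lambda>x. v x * (if x \<in> B then s else 1)) \<eta>) \<partial>P)
    = (\<Sum>k. ennreal (s ^ k) * (\<integral>\<^sup>+\<eta>. indicator (count_event M (insert (B, k) F)) \<eta> * ennreal (pp_prod (T n) v \<eta>) \<partial>P))"
proof -
  note [measurable] = B(1) sets_count_event[OF F]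
  have [measurable]: "count_event M (insert (B, k) F) \<in> sets (point_pattern_algebra M)" for k
    using F B by (intro sets_count_event) auto
  have "(\<Sum>k. ennreal (s ^ k) * (\<integral>\<^sup>+\<eta>. indicator (count_event M (insert (B, k) F)) \<eta> * ennreal (pp_prod (T n) v \<eta>) \<partial>P))
     = (\<integral>\<^sup>+\<eta>. (\<Sum>k. ennreal (s ^ k) * (indicator (count_event M (insert (B, k) F)) \<eta> * ennreal (pp_prod (T n) v \<eta>))) \<partial>P)"
    by (subst nn_integral_suminf) (auto intro!: suminf_cong nn_integral_cmult[symmetric])
  also have "\<dots> = (\<integral>\<^sup>+\<eta>. indicator (count_event M F) \<eta> * ennreal (pp_prod (T n) (\<lambda>x. v x * (if x \<in> B then s else 1)) \<eta>) \<partial>P)"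
  proof (rule nn_integral_cong_AE)
    show "AE \<eta> in P. (\<Sum>k. ennreal (s ^ k) * (indicator (count_event M (insert (B, k) F)) \<eta> * ennreal (pp_prod (T n) v \<eta>)))
      = indicator (count_event M F) \<eta> * ennreal (pp_prod (T n) (\<lambda>x. v x * (if x \<in> B then s else 1)) \<eta>)"
      using fin AE_space
    proof eventually_elim
      case (elim \<eta>)
      then have \<eta>: "\<eta> \<in> point_patterns M"
        using sets_eq_imp_space_eq[OF sP] by simp
      have fB: "emeasure \<eta> B < \<infinity>" "emeasure \<eta> (T n - B) < \<infinity>"
        by (rule order_le_less_trans[OF emeasure_mono elim(1)]; use B in \<open>auto simp: sets_point_pattern[OF \<eta>]\<close>)+
      with emeasure_point_pattern_cases[OF \<eta>, of B] obtain j where j: "emeasure \<eta> B = of_nat j"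
        by auto
      have "pp_prod (T n) (\<lambda>x. if x \<in> B then s else 1) \<eta>
          = pp_prod (B \<union> (T n - B)) (\<lambda>x. if x \<in> B then s else 1) \<eta>"
        using B by (simp add: Un_absorb1)
      also have "\<dots> = pp_prod B (\<lambda>x. if x \<in> B then s else 1) \<eta> * pp_prod (T n - B) (\<lambda>x. if x \<in> B then s else 1) \<eta>"
        using fB by (intro pp_prod_Un[OF \<eta>]) auto
      also have "pp_prod B (\<lambda>x. if x \<in> B then s else 1) \<eta> = pp_prod B (\<lambda>_. s) \<eta>"
        by (rule pp_prod_cong) simp
      also have "\<dots> = s ^ j" using s j B by (intro pp_prod_const) (auto simp: sets_point_pattern[OF \<eta>])
      also have "pp_prod (T n - B) (\<lambda>x. if x \<in> B then s else 1) \<eta> = pp_prod (T n - B) (\<lambda>_. 1) \<eta>"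
        by (rule pp_prod_cong) simp
      finally have "pp_prod (T n) (\<lambda>x. if x \<in> B then s else 1) \<eta> = s ^ j" by simp
      then have 1: "pp_prod (T n) (\<lambda>x. v x * (if x \<in> B then s else 1)) \<eta> = pp_prod (T n) v \<eta> * s ^ j"
        using elim(1) by (subst pp_prod_mult[OF \<eta>]) auto
      \<comment> \<open>Only the term with k = j, the actual number of points in B, survives in the
        series.\<close>
      have i: "\<eta> \<in> count_event M (insert (B, k) F) \<longleftrightarrow> k = j \<and> \<eta> \<in> count_event M F" for k
        using \<eta> j by (auto simp: count_event_def)
      have "(\<Sum>k. ennreal (s ^ k) * (indicator (count_event M (insert (B, k) F)) \<eta> * ennreal (pp_prod (T n) v \<eta>)))
        = (\<Sum>k\<in>{j}. ennreal (s ^ k) * (indicator (count_event M (insert (B, k) F)) \<eta> * ennreal (pp_prod (T n) v \<eta>)))"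
        by (rule suminf_finite) (auto simp: i)
      also have "\<dots> = indicator (count_event M F) \<eta> * (ennreal (pp_prod (T n) v \<eta>) * ennreal (s ^ j))"
        by (simp add: i indicator_def mult_ac)
      finally show ?case using s by (simp add: 1 ennreal_mult)
    qed
  qed
  finally show ?thesis ..
qed

theorem measure_eqI_laplace:
  assumes PQ: "sets P = sets (point_pattern_algebra M)" "sets Q = sets (point_pattern_algebra M)"
    and fm: "finite_measure P" "finite_measure Q"
    and fin: "\<And>n. AE \<eta> in P. emeasure \<eta> (T n) < \<infinity>" "\<And>n. AE \<eta> in Q. emeasure \<eta> (T n) < \<infinity>"
    and eq: "\<And>n v. v \<in> borel_measurable M \<Longrightarrow> (\<And>x. 0 < v x) \<Longrightarrow> (\<And>x. v x \<le> 1) \<Longrightarrow>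
      (\<integral>\<^sup>+\<eta>. ennreal (pp_prod (T n) v \<eta>) \<partial>P) = (\<integral>\<^sup>+\<eta>. ennreal (pp_prod (T n) v \<eta>) \<partial>Q)"
  shows "P = Q"
proof -
  have bound: "(\<integral>\<^sup>+\<eta>. indicator (count_event M F) \<eta> * ennreal (pp_prod (T n) v \<eta>) \<partial>R) < \<infinity>"
    if sR: "sets R = sets (point_pattern_algebra M)" and "finite_measure R"
      "AE \<eta> in R. emeasure \<eta> (T n) < \<infinity>"
      and v: "v \<in> borel_measurable M" "\<And>x. 0 < v x" "\<And>x. v x \<le> 1" for R F n v
  proof -
    have "(\<integral>\<^sup>+\<eta>. indicator (count_event M F) \<eta> * ennreal (pp_prod (T n) v \<eta>) \<partial>R) \<le> (\<integral>\<^sup>+\<eta>. 1 \<partial>R)"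
    proof (rule nn_integral_mono_AE)
      show "AE \<eta> in R. indicator (count_event M F) \<eta> * ennreal (pp_prod (T n) v \<eta>) \<le> 1"
        using that(3) AE_space
      proof eventually_elim
        case (elim \<eta>)
        then have \<eta>: "\<eta> \<in> point_patterns M"
          using sets_eq_imp_space_eq[OF sR] by simp
        have "pp_prod (T n) v \<eta> \<le> pp_prod (T n) (\<lambda>_. 1) \<eta>"
          using v elim(1) by (intro pp_prod_mono[OF \<eta>]) (auto intro: less_imp_le)
        then show ?case by (auto simp: indicator_def)
      qed
    qed
    also have "\<dots> < \<infinity>"
      using finite_measure.emeasure_finite[OF that(2)] by (simp add: less_top[symmetric])
    finally show ?thesis .
  qed
  have claim: "(\<integral>\<^sup>+\<eta>. indicator (count_event M F) \<eta> * ennreal (pp_prod (T n) v \<eta>) \<partial>P)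
      = (\<integral>\<^sup>+\<eta>. indicator (count_event M F) \<eta> * ennreal (pp_prod (T n) v \<eta>) \<partial>Q)"
    if "finite F" "\<forall>p\<in>F. fst p \<in> sets M \<and> fst p \<subseteq> T n"
      and v: "v \<in> borel_measurable M" "\<And>x. 0 < v x" "\<And>x. v x \<le> 1" for F n v
    using that
  proof (induction F arbitrary: v)
    case empty
    have "(\<integral>\<^sup>+\<eta>. indicator (count_event M {}) \<eta> * ennreal (pp_prod (T n) v \<eta>) \<partial>R)
       = (\<integral>\<^sup>+\<eta>. ennreal (pp_prod (T n) v \<eta>) \<partial>R)" if "sets R = sets (point_pattern_algebra M)" for R
      using sets_eq_imp_space_eq[OF that]
      by (intro nn_integral_cong) (simp add: count_event_def)
    then show ?case using PQ eq[OF empty(2-)] by simp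
  next
    case (insert p F)
    obtain B j where p: "p = (B, j)" by (cases p)
    have B: "B \<in> sets M" "B \<subseteq> T n" and F: "fst ` F \<subseteq> sets M" using insert by (auto simp: p)
    note [measurable] = B(1) insert(5)
    define c where "c R k = (\<integral>\<^sup>+\<eta>. indicator (count_event M (insert (B, k) F)) \<eta> * ennreal (pp_prod (T n) v \<eta>) \<partial>R)" for R k
    have expand: "(\<integral>\<^sup>+\<eta>. indicator (count_event M F) \<eta> * ennreal (pp_prod (T n) (\<lambda>x. v x * (if x \<in> B then s else 1)) \<eta>) \<partial>P)
        = (\<Sum>k. ennreal (s ^ k) * c P k)"
       "(\<integral>\<^sup>+\<eta>. indicator (count_event M F) \<eta> * ennreal (pp_prod (T n) (\<lambda>x. v x * (if x \<in> B then s else 1)) \<eta>) \<partial>Q)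
        = (\<Sum>k. ennreal (s ^ k) * c Q k)"
      if "0 < s" for s
      unfolding c_def using nn_integral_count_event_expand[OF _ _ insert(1) F B insert(5) that] PQ fin by auto
    have vs: "(\<lambda>x. v x * (if x \<in> B then s else 1)) \<in> borel_measurable M"
      "0 < v x * (if x \<in> B then s else 1)" "v x * (if x \<in> B then s else 1) \<le> 1" if "0 < s" "s \<le> 1" for s x
      using that insert(6,7)[of x] by (auto intro: mult_le_one)
    have "c P j = c Q j"
    proof (rule ennreal_powser_coeff_unique)
      \<comment> \<open>For s = 1 the expansion identifies the sum of the coefficients with an
        integral that is at most the total mass.\<close>
      show "(\<Sum>k. c P k) < \<infinity>" "(\<Sum>k. c Q k) < \<infinity>"
        using expand[of 1] bound[OF PQ(1) fm(1) fin(1) insert(5-7), of F n]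
          bound[OF PQ(2) fm(2) fin(2) insert(5-7), of F n]
        by (simp_all only: if_cancel mult_1_right power_one ennreal_1 mult_1 zero_less_one simp_thms True_implies_equals)
      fix s :: real assume s: "0 < s" "s < 1"
      show "(\<Sum>k. ennreal (s ^ k) * c P k) = (\<Sum>k. ennreal (s ^ k) * c Q k)"
        unfolding expand[OF s(1), symmetric]
        by (rule insert.IH) (use insert(4) vs s in auto)
    qed
    then show ?case by (simp add: c_def p)
  qed
  show ?thesis
  proof (rule measure_eqI_generator_eq[OF Int_stable_count_events count_events_subset])
    fix X assume "X \<in> count_events"
    then obtain F n where F: "X = count_event M F" "finite F" "\<forall>p\<in>F. fst p \<in> sets M \<and> fst p \<subseteq> T n"
      by (auto simp: count_events_def)
    have X: "X \<in> sets (point_pattern_algebra M)"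
      unfolding F(1) using F by (intro sets_count_event) auto
    \<comment> \<open>With the weight 1 the product over the points is 1, and the claim compares the
      measures of the event.\<close>
    show "emeasure P X = emeasure Q X"
      using claim[OF F(2,3), of "\<lambda>_. 1"] X PQ by (simp add: F(1))
  next
    show "sets P = sigma_sets (point_patterns M) count_events" "sets Q = sigma_sets (point_patterns M) count_events"
      using PQ by (simp_all add: sets_point_pattern_algebra_eq)
    have "count_event M {} \<in> count_events" unfolding count_events_def by blast
    then show "range (\<lambda>_::nat. point_patterns M) \<subseteq> count_events"
      by (simp add: count_event_def image_subset_iff)
    show "emeasure P (point_patterns M) \<noteq> \<infinity>"
      using finite_measure.emeasure_finite[OF fm(1)] by simp
  qed simp
qed

end

section \<open>Independence and exponential moments of compensated sums\<close>

lemma set_integrable_bounded: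
  fixes f :: "'a \<Rightarrow> real"
  assumes A: "A \<in> sets M" "emeasure M A < \<infinity>" and [measurable]: "f \<in> borel_measurable M"
    and b: "\<And>x. x \<in> A \<Longrightarrow> \<bar>f x\<bar> \<le> C"
  shows "set_integrable M A f"
proof -
  note [measurable] = A(1)
  have "integrable M (\<lambda>x. indicator A x *\<^sub>R C)"
    using A by simp
  then show ?thesis
    unfolding set_integrable_def
    by (rule Bochner_Integration.integrable_bound) (auto intro!: AE_I2 simp: indicator_def dest!: b)
qed

text \<open>For x < 0 this follows from \<open>exp (- x) \<ge> 1 - x\<close> and (1 + x + x^2)(1 -
  x) = 1 - x^3 \<ge> 1. It controls both the exponential moments of compensated sums and, with x =
  ln \<phi>, the integrand ln \<phi> + 1 - \<phi>.\<close>

lemma exp_minus_one_minus_le_square: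
  fixes x :: real
  assumes "\<bar>x\<bar> \<le> 1"
  shows "exp x - 1 - x \<le> x\<^sup>2"
proof (cases "0 \<le> x")
  case True
  then show ?thesis using exp_bound[of x] assms by simp
next
  case False
  have "(1 + x + x\<^sup>2) * (1 - x) = 1 - x ^ 3"
    by (simp add: power2_eq_square power3_eq_cube algebra_simps)
  moreover have "x ^ 3 \<le> 0" using False by (simp add: power_le_zero_eq)
  ultimately have *: "1 \<le> (1 + x + x\<^sup>2) * (1 - x)" by simp
  have "exp x = 1 / exp (- x)" by (simp add: exp_minus field_simps)
  also have "\<dots> \<le> 1 / (1 - x)"
    using False exp_ge_add_one_self[of "- x"] by (intro divide_left_mono) auto
  also have "\<dots> \<le> 1 + x + x\<^sup>2" using * False by (simp add: pos_divide_le_eq)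
  finally show ?thesis by simp
qed

text \<open>With y = |x| / 2, the quantity exp x + exp (- x) - 2 is the square of exp y - exp (- y),
  which is at least y; y^2 accounts for the factor 1/4.\<close>

lemma exp_plus_exp_uminus_ge:
  fixes x :: real
  shows "x\<^sup>2 / 4 + 2 \<le> exp x + exp (- x)"
proof -
  define y where "y = \<bar>x\<bar> / 2"
  have y: "0 \<le> y" by (simp add: y_def)
  have e: "exp y * exp (- y) = 1" by (simp flip: exp_add)
  have "1 + y \<le> exp y" "exp (- y) \<le> 1" using y by (auto intro: exp_ge_add_one_self)
  then have "y\<^sup>2 \<le> (exp y - exp (- y))\<^sup>2" using y by (intro power_mono) linarith+
  also have "\<dots> = exp (2 * y) + exp (- (2 * y)) - 2"
    using exp_double[of y] exp_double[of "- y"] e by (simp add: power2_diff)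
  also have "\<dots> = exp x + exp (- x) - 2" by (simp add: y_def abs_if)
  finally show ?thesis by (simp add: y_def power_divide)
qed

section \<open>Independence over disjoint sets\<close>

context poisson_pattern
begin

text \<open>Independence in Laplace form: the two weights are glued to a single weight u on the
  disjoint union, where the exponent of the Laplace functional is additive.\<close>

lemma laplace_Un:
  assumes A: "A \<in> sets M" "emeasure M A < \<infinity>" and B: "B \<in> sets M" "emeasure M B < \<infinity>"
    and AB: "A \<inter> B = {}"
    and w [measurable]: "w \<in> borel_measurable M" and w0: "\<And>x. x \<in> A \<Longrightarrow> 0 \<le> w x"
      "set_integrable M A w"
    and v [measurable]: "v \<in> borel_measurable M" and v0: "\<And>x. x \<in> B \<Longrightarrow> 0 \<le> v x"
      "set_integrable M B v"
  shows "(\<integral>\<^sup>+\<eta>. ennreal (pp_prod A w \<eta>) * ennreal (pp_prod B v \<eta>) \<partial>P)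
    = ennreal (exp (LINT x:A|M. w x - 1)) * ennreal (exp (LINT x:B|M. v x - 1))"
proof -
  note [measurable] = A(1) B(1)
  define u where "u x = (if x \<in> A then w x else v x)" for x
  have [measurable]: "u \<in> borel_measurable M" unfolding u_def by measurable
  have uA: "u x = w x" if "x \<in> A" for x using that by (simp add: u_def)
  have uB: "u x = v x" if "x \<in> B" for x using that AB by (auto simp: u_def)
  have one: "set_integrable M A (\<lambda>_. 1::real)" "set_integrable M B (\<lambda>_. 1::real)"
    using A B by (auto simp: set_integrable_def)
  have iA: "set_integrable M A u" using w0(2) by (subst set_integrable_cong[OF refl refl uA])
  have iB: "set_integrable M B u" using v0(2) by (subst set_integrable_cong[OF refl refl uB])
  have "AE \<eta> in P. pp_prod A w \<eta> * pp_prod B v \<eta> = pp_prod (A \<union> B) u \<eta>"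
    using AE_emeasure_finite[OF A] AE_emeasure_finite[OF B] AE_space
  proof eventually_elim
    case (elim \<eta>)
    then show ?case
      using AB pp_prod_cong[of A u w, OF uA] pp_prod_cong[of B u v, OF uB]
      by (subst pp_prod_Un[of \<eta> M]) (auto simp: space_P)
  qed
  then have "(\<integral>\<^sup>+\<eta>. ennreal (pp_prod A w \<eta>) * ennreal (pp_prod B v \<eta>) \<partial>P)
      = (\<integral>\<^sup>+\<eta>. ennreal (pp_prod (A \<union> B) u \<eta>) \<partial>P)"
    by (intro nn_integral_cong_AE, eventually_elim) (simp add: ennreal_mult[symmetric])
  also have "\<dots> = ennreal (exp (LINT x:A \<union> B|M. u x - 1))"
  proof (rule laplace)
    show "emeasure M (A \<union> B) < \<infinity>"
      using emeasure_subadditive[of A M B] A B by (auto simp: less_top[symmetric] top_unique)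
    show "set_integrable M (A \<union> B) u" by (rule set_integrable_Un[OF iA iB]) auto
  qed (use w0 v0 uA uB in auto)
  also have "(LINT x:A \<union> B|M. u x - 1) = (LINT x:A|M. u x - 1) + (LINT x:B|M. u x - 1)"
    using AB iA iB one by (intro set_integral_Un set_integral_diff) auto
  also have "(LINT x:A|M. u x - 1) = (LINT x:A|M. w x - 1)"
    by (rule set_lebesgue_integral_cong) (auto simp: uA)
  also have "(LINT x:B|M. u x - 1) = (LINT x:B|M. v x - 1)"
    by (rule set_lebesgue_integral_cong) (auto simp: uB)
  finally show ?thesis by (simp add: exp_add ennreal_mult)
qed

end

locale poisson_exhaustion = poisson_pattern P M + exhaustion M T
  for P :: "'a measure measure" and M T +
  assumes finite_T: "\<And>n. emeasure M (T n) < \<infinity>"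
begin

lemma AE_finite_T: "AE \<eta> in P. \<forall>n. emeasure \<eta> (T n) < \<infinity>"
  unfolding AE_all_countable using AE_emeasure_finite[OF sets_T finite_T] by simp

text \<open>Weighting by a product over points outside \<open>T k\<close> only rescales the law of the
  restriction to \<open>T k\<close>; this expresses the independence of the two restrictions.\<close>

lemma nn_integral_pp_prod_restrict:
  assumes A: "A \<in> sets M" "emeasure M A < \<infinity>" "A \<inter> T k = {}"
    and w [measurable]: "w \<in> borel_measurable M" and w0: "\<And>x. x \<in> A \<Longrightarrow> 0 \<le> w x"
      "set_integrable M A w"
    and Y [measurable]: "Y \<in> borel_measurable (point_pattern_algebra M)"
  shows "(\<integral>\<^sup>+\<eta>. ennreal (pp_prod A w \<eta>) * Y (restrict_pattern (T k) \<eta>) \<partial>P)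
    = ennreal (exp (LINT x:A|M. w x - 1)) * (\<integral>\<^sup>+\<eta>. Y (restrict_pattern (T k) \<eta>) \<partial>P)"
proof -
  note [measurable] = A(1)
  let ?N = "point_pattern_algebra M" and ?\<rho> = "restrict_pattern (T k)"
  define c where "c = ennreal (exp (LINT x:A|M. w x - 1))"
  \<comment> \<open>The weighted law of the restricted pattern, and below c times its plain law.
    Both are finite measures of total mass c; that their Laplace functionals agree follows from
    \<open>laplace_Un\<close>, since the restricted pattern has points only in \<open>T k\<close>,
    which is disjoint from A.\<close>
  define R1 where "R1 = distr (density P (\<lambda>\<eta>. ennreal (pp_prod A w \<eta>))) ?N ?\<rho>"
  define R2 where "R2 = distr (density P (\<lambda>_. c)) ?N ?\<rho>"
  have [measurable]: "pp_prod A w \<in> borel_measurable P" "?\<rho> \<in> measurable P ?N" by measurable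
  have i1: "(\<integral>\<^sup>+\<eta>. Z \<eta> \<partial>R1) = (\<integral>\<^sup>+\<eta>. ennreal (pp_prod A w \<eta>) * Z (?\<rho> \<eta>) \<partial>P)"
    and i2: "(\<integral>\<^sup>+\<eta>. Z \<eta> \<partial>R2) = c * (\<integral>\<^sup>+\<eta>. Z (?\<rho> \<eta>) \<partial>P)"
    if [measurable]: "Z \<in> borel_measurable ?N" for Z
    unfolding R1_def R2_def
    by (simp_all add: nn_integral_distr nn_integral_density nn_integral_cmult)
  have mass: "(\<integral>\<^sup>+\<eta>. ennreal (pp_prod A w \<eta>) \<partial>P) = c"
    unfolding c_def by (rule laplace) (use A w0 in auto)
  have "AE \<eta> in P. emeasure (?\<rho> \<eta>) (T n) < \<infinity>" for n
    using AE_finite_T AE_space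
  proof eventually_elim
    case (elim \<eta>)
    then have \<eta>: "\<eta> \<in> point_patterns M" by (simp add: space_P)
    have "emeasure \<eta> (T k \<inter> T n) \<le> emeasure \<eta> (T k)"
      by (rule emeasure_mono) (auto simp: sets_point_pattern[OF \<eta>])
    then show ?case using elim(1) by (simp add: emeasure_restrict_pattern[OF \<eta>] order_le_less_trans)
  qed
  note * = this
  have m: "{\<eta> \<in> space ?N. emeasure \<eta> (T n) < \<infinity>} \<in> sets ?N" for n by measurable
  have fin: "AE \<eta> in R1. emeasure \<eta> (T n) < \<infinity>" "AE \<eta> in R2. emeasure \<eta> (T n) < \<infinity>" for n
    unfolding R1_def R2_def using *[of n] by (subst AE_distr_iff[OF _ m]; auto simp: AE_density)+
  have "R1 = R2"
  proof (rule measure_eqI_laplace)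
    show "sets R1 = sets ?N" "sets R2 = sets ?N" by (simp_all add: R1_def R2_def)
    show "finite_measure R1"
      using i1[of "\<lambda>_. 1"] mass by (intro finite_measureI) (simp add: c_def)
    show "finite_measure R2"
      using i2[of "\<lambda>_. 1"] by (intro finite_measureI) (simp add: c_def emeasure_space_1)
    fix n and v :: "'a \<Rightarrow> real"
    assume v [measurable]: "v \<in> borel_measurable M" and v0: "\<And>x. 0 < v x" "\<And>x. v x \<le> 1"
    have r: "pp_prod (T n) v (?\<rho> \<eta>) = pp_prod (T n \<inter> T k) v \<eta>" if "\<eta> \<in> space P" for \<eta>
      using that by (intro pp_prod_restrict_pattern[where M=M]) (auto simp: space_P)
    have fB: "emeasure M (T n \<inter> T k) < \<infinity>"
      by (rule order_le_less_trans[OF emeasure_mono finite_T[of k]]) auto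
    have v1: "\<bar>v x\<bar> \<le> 1" for x using v0[of x] by (simp add: abs_of_pos)
    have iv: "set_integrable M (T n \<inter> T k) v"
      by (rule set_integrable_bounded[where C=1]) (use fB v1 in auto)
    have "(\<integral>\<^sup>+\<eta>. ennreal (pp_prod (T n) v \<eta>) \<partial>R1)
        = (\<integral>\<^sup>+\<eta>. ennreal (pp_prod A w \<eta>) * ennreal (pp_prod (T n \<inter> T k) v \<eta>) \<partial>P)"
      by (subst i1) (auto intro!: nn_integral_cong simp: r)
    also have "\<dots> = c * ennreal (exp (LINT x:T n \<inter> T k|M. v x - 1))"
      unfolding c_def by (rule laplace_Un) (use A w0 fB iv v0 in \<open>auto intro: less_imp_le\<close>)
    also have "ennreal (exp (LINT x:T n \<inter> T k|M. v x - 1)) = (\<integral>\<^sup>+\<eta>. ennreal (pp_prod (T n \<inter> T k) v \<eta>) \<partial>P)"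
      by (rule laplace[symmetric]) (use fB iv v0 in \<open>auto intro: less_imp_le\<close>)
    also have "c * \<dots> = (\<integral>\<^sup>+\<eta>. ennreal (pp_prod (T n) v \<eta>) \<partial>R2)"
      by (subst i2) (auto intro!: nn_integral_cong arg_cong2[where f="(*)"] simp: r)
    finally show "(\<integral>\<^sup>+\<eta>. ennreal (pp_prod (T n) v \<eta>) \<partial>R1) = (\<integral>\<^sup>+\<eta>. ennreal (pp_prod (T n) v \<eta>) \<partial>R2)" .
  qed (use fin in auto)
  then show ?thesis using i1[OF Y] i2[OF Y] by (simp add: c_def)
qed

text \<open>The approximants of a compensated integral over the whole space. A set A of integration
  is absorbed into the integrand, as \<open>indicator A x * g x\<close>.\<close>

definition comp_sum :: "('a \<Rightarrow> real) \<Rightarrow> nat \<Rightarrow> 'a measure \<Rightarrow> real" where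
  "comp_sum g n \<eta> = (LINT x:T n|\<eta>. g x) - (LINT x:T n|M. g x)"

lemma measurable_comp_sum [measurable]:
  assumes [measurable]: "g \<in> borel_measurable M"
  shows "comp_sum g n \<in> borel_measurable (point_pattern_algebra M)"
  unfolding comp_sum_def by measurable

lemma comp_sum_uminus: "comp_sum (\<lambda>x. - g x) n \<eta> = - comp_sum g n \<eta>"
  by (simp add: comp_sum_def set_lebesgue_integral_def)

text \<open>This is adaptedness: restriction to \<open>T k\<close> plays the role of the k-th member
  of a filtration.\<close>

lemma comp_sum_restrict_pattern:
  assumes "\<eta> \<in> point_patterns M" "g \<in> borel_measurable M" "j \<le> k"
  shows "comp_sum g j (restrict_pattern (T k) \<eta>) = comp_sum g j \<eta>"
proof -
  have "T j \<inter> T k = T j" using incseqD[OF inc_T assms(3)] by auto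
  then show ?thesis
    using assms by (simp add: comp_sum_def set_integral_restrict_pattern)
qed

end

text \<open>Meant for ln \<phi> cut off to the set where |ln \<phi>| \<le> 1. The bound 1 gives
  access to the quadratic estimate of the exponential, and the integrability of the square is what
  the Hellinger condition supplies.\<close>

locale bounded_integrand = poisson_exhaustion +
  fixes g :: "'a \<Rightarrow> real"
  assumes g [measurable]: "g \<in> borel_measurable M" and g1: "\<And>x. \<bar>g x\<bar> \<le> 1"
    and g2: "integrable M (\<lambda>x. (g x)\<^sup>2)"
begin

lemma exp_comp_sum:
  assumes kn: "k \<le> n"
  shows "AE \<eta> in P. exp (comp_sum g n \<eta> - comp_sum g k \<eta>)
    = pp_prod (T n - T k) (\<lambda>x. exp (g x)) \<eta> * exp (- (LINT x:T n - T k|M. g x))"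
  using AE_finite_T AE_space
proof eventually_elim
  case (elim \<eta>)
  then have \<eta>: "\<eta> \<in> point_patterns M" by (simp add: space_P)
  have sub: "T k \<subseteq> T n" using incseqD[OF inc_T kn] .
  then have U: "T n = T k \<union> (T n - T k)" by auto
  have fd: "emeasure \<eta> (T n - T k) < \<infinity>"
    by (rule order_le_less_trans[OF emeasure_mono]) (use elim in \<open>auto simp: sets_point_pattern[OF \<eta>]\<close>)
  have fM: "emeasure M (T n - T k) < \<infinity>"
    by (rule order_le_less_trans[OF emeasure_mono finite_T[of n]]) auto
  have "(LINT x:T k \<union> (T n - T k)|\<eta>. g x) = (LINT x:T k|\<eta>. g x) + (LINT x:T n - T k|\<eta>. g x)"
    using elim fd by (intro set_integral_Un point_pattern_set_integrable[OF \<eta>]) auto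
  moreover have "(LINT x:T k \<union> (T n - T k)|M. g x) = (LINT x:T k|M. g x) + (LINT x:T n - T k|M. g x)"
    using finite_T fM g1 by (intro set_integral_Un set_integrable_bounded[where C=1]) auto
  ultimately have *: "comp_sum g n \<eta> - comp_sum g k \<eta> = (LINT x:T n - T k|\<eta>. g x) - (LINT x:T n - T k|M. g x)"
    unfolding comp_sum_def U[symmetric] by simp
  show ?case by (simp add: * pp_prod_positive flip: exp_add)
qed

lemma finite_diff_T: "emeasure M (T n - T k) < \<infinity>"
  by (rule order_le_less_trans[OF emeasure_mono finite_T[of n]]) auto

lemma set_integrable_diff_T:
  "set_integrable M (T n - T k) (\<lambda>x. exp (g x))" "set_integrable M (T n - T k) g"
  "set_integrable M (T n - T k) (\<lambda>x. (g x)\<^sup>2)" "set_integrable M (T n - T k) (\<lambda>x. 1::real)"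
proof -
  have "(g x)\<^sup>2 \<le> 1" "g x \<le> 1" for x
    using g1[of x] by (simp_all add: abs_square_le_1)
  note g' = this
  show "set_integrable M (T n - T k) (\<lambda>x. exp (g x))"
    using finite_diff_T[of n k] g' by (auto intro!: set_integrable_bounded[where C="exp 1"])
  show "set_integrable M (T n - T k) (\<lambda>x. (g x)\<^sup>2)"
    using finite_diff_T[of n k] g' by (auto intro!: set_integrable_bounded[where C=1])
  show "set_integrable M (T n - T k) g" "set_integrable M (T n - T k) (\<lambda>x. 1::real)"
    using finite_diff_T[of n k] g1 by (auto intro!: set_integrable_bounded[where C=1])
qed

text \<open>The increment from k to n involves only points outside \<open>T k\<close>, and Y only
  those inside, so its exponential moment splits off as a factor. The exponent combines exp g - 1
  from the Laplace functional with - g from the compensator.\<close>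

lemma nn_integral_exp_comp_sum_restrict:
  assumes kn: "k \<le> n" and Y [measurable]: "Y \<in> borel_measurable (point_pattern_algebra M)"
  shows "(\<integral>\<^sup>+\<eta>. ennreal (exp (comp_sum g n \<eta> - comp_sum g k \<eta>)) * Y (restrict_pattern (T k) \<eta>) \<partial>P)
    = ennreal (exp (LINT x:T n - T k|M. exp (g x) - 1 - g x)) * (\<integral>\<^sup>+\<eta>. Y (restrict_pattern (T k) \<eta>) \<partial>P)"
proof -
  let ?c = "exp (- (LINT x:T n - T k|M. g x))"
  have "(\<integral>\<^sup>+\<eta>. ennreal (exp (comp_sum g n \<eta> - comp_sum g k \<eta>)) * Y (restrict_pattern (T k) \<eta>) \<partial>P)
     = (\<integral>\<^sup>+\<eta>. ennreal ?c * (ennreal (pp_prod (T n - T k) (\<lambda>x. exp (g x)) \<eta>) * Y (restrict_pattern (T k) \<eta>)) \<partial>P)"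
    using exp_comp_sum[OF kn]
    by (intro nn_integral_cong_AE, eventually_elim) (simp add: ennreal_mult mult_ac)
  also have "\<dots> = ennreal ?c * (\<integral>\<^sup>+\<eta>. (ennreal (pp_prod (T n - T k) (\<lambda>x. exp (g x)) \<eta>) * Y (restrict_pattern (T k) \<eta>)) \<partial>P)"
    by (rule nn_integral_cmult) measurable
  also have "\<dots> = ennreal ?c * (ennreal (exp (LINT x:T n - T k|M. exp (g x) - 1)) * (\<integral>\<^sup>+\<eta>. Y (restrict_pattern (T k) \<eta>) \<partial>P))"
    by (subst nn_integral_pp_prod_restrict) (use finite_diff_T set_integrable_diff_T in auto)
  also have "\<dots> = ennreal (?c * exp (LINT x:T n - T k|M. exp (g x) - 1)) * (\<integral>\<^sup>+\<eta>. Y (restrict_pattern (T k) \<eta>) \<partial>P)"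
    by (simp add: ennreal_mult mult.assoc)
  also have "?c * exp (LINT x:T n - T k|M. exp (g x) - 1) = exp (LINT x:T n - T k|M. exp (g x) - 1 - g x)"
    using set_integrable_diff_T[of n k]
    by (subst (2) set_integral_diff(2)) (auto simp: mult_exp_exp)
  finally show ?thesis .
qed

text \<open>The submartingale property: exp g - 1 - g \<ge> 0, so the factor that splits off is at
  least 1.\<close>

lemma nn_integral_exp_comp_sum_ge:
  assumes kn: "k \<le> n" and Y: "Y \<in> borel_measurable (point_pattern_algebra M)"
  shows "(\<integral>\<^sup>+\<eta>. Y (restrict_pattern (T k) \<eta>) \<partial>P)
    \<le> (\<integral>\<^sup>+\<eta>. ennreal (exp (comp_sum g n \<eta> - comp_sum g k \<eta>)) * Y (restrict_pattern (T k) \<eta>) \<partial>P)"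
proof -
  have "0 \<le> (LINT x:T n - T k|M. exp (g x) - 1 - g x)"
    unfolding set_lebesgue_integral_def
    by (rule Bochner_Integration.integral_nonneg)
      (simp add: indicator_def, metis add.commute diff_ge_0_iff_ge exp_ge_add_one_self diff_diff_eq)
  then have "1 \<le> ennreal (exp (LINT x:T n - T k|M. exp (g x) - 1 - g x))" by simp
  then have "1 * (\<integral>\<^sup>+\<eta>. Y (restrict_pattern (T k) \<eta>) \<partial>P) \<le> ennreal (exp (LINT x:T n - T k|M. exp (g x) - 1 - g x)) * (\<integral>\<^sup>+\<eta>. Y (restrict_pattern (T k) \<eta>) \<partial>P)"
    by (rule mult_right_mono) simp
  then show ?thesis unfolding nn_integral_exp_comp_sum_restrict[OF kn Y] by simp
qed

text \<open>The case Y = 1 with the quadratic estimate. Integrating over the complement of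
  \<open>T k\<close> makes the bound uniform in n.\<close>

lemma nn_integral_exp_comp_sum_le:
  assumes kn: "k \<le> n"
  shows "(\<integral>\<^sup>+\<eta>. ennreal (exp (comp_sum g n \<eta> - comp_sum g k \<eta>)) \<partial>P)
    \<le> ennreal (exp (LINT x:space M - T k|M. (g x)\<^sup>2))"
proof -
  have i: "set_integrable M (space M - T k) (\<lambda>x. (g x)\<^sup>2)"
    unfolding set_integrable_def using g2 by (intro integrable_mult_indicator) auto
  have "(LINT x:T n - T k|M. exp (g x) - 1 - g x) \<le> (LINT x:T n - T k|M. (g x)\<^sup>2)"
    using set_integrable_diff_T[of n k] exp_minus_one_minus_le_square[OF g1]
    by (intro set_integral_mono set_integral_diff) auto
  also have "\<dots> \<le> (LINT x:space M - T k|M. (g x)\<^sup>2)"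
    using i set_integrable_diff_T(3)[of n k] sets.sets_into_space[OF sets_T[of n]]
    unfolding set_integrable_def set_lebesgue_integral_def
    by (intro integral_mono) (auto split: split_indicator)
  finally show ?thesis
    using nn_integral_exp_comp_sum_restrict[OF kn, of "\<lambda>_. 1"] by (simp add: emeasure_space_1)
qed

end

section \<open>Almost sure convergence of compensated sums\<close>

lemma (in exhaustion) tail_tendsto_zero:
  fixes h :: "'a \<Rightarrow> real"
  assumes h: "integrable M h"
  shows "(\<lambda>m. LINT x:space M - T m|M. h x) \<longlonglongrightarrow> 0"
proof -
  have "(\<lambda>m. LINT x|M. indicator (space M - T m) x *\<^sub>R h x) \<longlonglongrightarrow> (LINT x|M. 0)"
  proof (rule integral_dominated_convergence[OF _ _ integrable_norm[OF h]])
    show "AE x in M. (\<lambda>m. indicator (space M - T m) x *\<^sub>R h x) \<longlonglongrightarrow> 0"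
    proof (rule AE_I2)
      fix x assume "x \<in> space M"
      then obtain n where "x \<in> T n" using UN_T by auto
      then have "x \<in> T m" if "m \<ge> n" for m using incseqD[OF inc_T that] by auto
      then have "eventually (\<lambda>m. indicator (space M - T m) x *\<^sub>R h x = 0) sequentially"
        by (auto simp: eventually_sequentially intro!: exI[of _ n])
      then show "(\<lambda>m. indicator (space M - T m) x *\<^sub>R h x) \<longlonglongrightarrow> 0"
        by (rule tendsto_eventually)
    qed
  qed (use h in \<open>auto split: split_indicator\<close>)
  then show ?thesis by (simp add: set_lebesgue_integral_def)
qed

context bounded_integrand
begin

lemma bounded_integrand_uminus: "bounded_integrand P M T (\<lambda>x. - g x)"
  by unfold_locales (auto simp: g1 g2)

text \<open>\<open>inv\<close> expresses that A is decided by the points in \<open>T k\<close>. The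
  integrand on the left is then a function of the restricted pattern, and weighting it with the
  exponential of the later increment does not decrease its integral.\<close>

lemma exp_comp_sum_submartingale:
  assumes mk: "m \<le> k" "k \<le> n" and A [measurable]: "A \<in> sets P"
    and inv: "\<And>\<eta>. \<eta> \<in> space P \<Longrightarrow> restrict_pattern (T k) \<eta> \<in> A \<longleftrightarrow> \<eta> \<in> A"
  shows "(\<integral>\<^sup>+\<eta>. ennreal (exp (comp_sum g k \<eta> - comp_sum g m \<eta>)) * indicator A \<eta> \<partial>P)
    \<le> (\<integral>\<^sup>+\<eta>. ennreal (exp (comp_sum g n \<eta> - comp_sum g m \<eta>)) * indicator A \<eta> \<partial>P)"
proof -
  have [measurable]: "A \<in> sets (point_pattern_algebra M)" using A by (simp add: sets_P)
  define Y where "Y \<eta> = ennreal (exp (comp_sum g k \<eta> - comp_sum g m \<eta>)) * indicator A \<eta>" for \<eta>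
  have Y: "Y \<in> borel_measurable (point_pattern_algebra M)" unfolding Y_def by measurable
  have r: "Y (restrict_pattern (T k) \<eta>) = Y \<eta>" if "\<eta> \<in> space P" for \<eta>
    using that mk inv[OF that] by (simp add: Y_def comp_sum_restrict_pattern space_P indicator_def)
  have "(\<integral>\<^sup>+\<eta>. Y \<eta> \<partial>P) = (\<integral>\<^sup>+\<eta>. Y (restrict_pattern (T k) \<eta>) \<partial>P)"
    by (intro nn_integral_cong) (simp add: r)
  also have "\<dots> \<le> (\<integral>\<^sup>+\<eta>. ennreal (exp (comp_sum g n \<eta> - comp_sum g k \<eta>)) * Y (restrict_pattern (T k) \<eta>) \<partial>P)"
    by (rule nn_integral_exp_comp_sum_ge[OF mk(2) Y])
  also have "\<dots> = (\<integral>\<^sup>+\<eta>. ennreal (exp (comp_sum g n \<eta> - comp_sum g m \<eta>)) * indicator A \<eta> \<partial>P)"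
  proof (rule nn_integral_cong)
    fix \<eta> assume \<eta>: "\<eta> \<in> space P"
    have "ennreal (exp (comp_sum g n \<eta> - comp_sum g k \<eta>)) * ennreal (exp (comp_sum g k \<eta> - comp_sum g m \<eta>))
      = ennreal (exp (comp_sum g n \<eta> - comp_sum g m \<eta>))"
      by (simp add: ennreal_mult[symmetric] mult_exp_exp)
    then show "ennreal (exp (comp_sum g n \<eta> - comp_sum g k \<eta>)) * Y (restrict_pattern (T k) \<eta>)
      = ennreal (exp (comp_sum g n \<eta> - comp_sum g m \<eta>)) * indicator A \<eta>"
      by (simp add: r[OF \<eta>]) (simp add: Y_def mult.assoc[symmetric])
  qed
  finally show ?thesis by (simp add: Y_def)
qed

text \<open>Doob's maximal inequality for the submartingale \<open>exp R + exp (-R) - 2\<close>, which dominates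
  \<open>R\<^sup>2 / 4\<close>; exponentials are used because their expectations are given by the Laplace functional.\<close>

lemma maximal_inequality:
  assumes mn: "m \<le> n" and \<epsilon>: "0 < \<epsilon>"
  shows "prob {\<eta>\<in>space P. \<exists>k\<in>{m..n}. \<epsilon> \<le> \<bar>comp_sum g k \<eta> - comp_sum g m \<eta>\<bar>}
    \<le> 8 / \<epsilon>\<^sup>2 * (exp (LINT x:space M - T m|M. (g x)\<^sup>2) - 1)"
proof -
  interpret neg: bounded_integrand P M T "\<lambda>x. - g x" by (rule bounded_integrand_uminus)
  define R where "R k \<eta> = comp_sum g k \<eta> - comp_sum g m \<eta>" for k \<eta>
  have R [measurable]: "R k \<in> borel_measurable P" for k unfolding R_def by measurable
  \<comment> \<open>The event that k is the first index from m on at which |R| reaches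
    \<epsilon>.\<close>
  define A where "A k = {\<eta>\<in>space P. \<epsilon> \<le> \<bar>R k \<eta>\<bar> \<and> (\<forall>j\<in>{m..<k}. \<bar>R j \<eta>\<bar> < \<epsilon>)}" for k
  have A [measurable]: "A k \<in> sets P" for k unfolding A_def by measurable
  define U where "U = {\<eta>\<in>space P. \<exists>k\<in>{m..n}. \<epsilon> \<le> \<bar>R k \<eta>\<bar>}"
  have U [measurable]: "U \<in> sets P" unfolding U_def by measurable
  define F where "F \<eta> = ennreal (exp (R n \<eta>)) + ennreal (exp (- R n \<eta>))" for \<eta>
  have F [measurable]: "F \<in> borel_measurable P" unfolding F_def by measurable
  define r where "r = (LINT x:space M - T m|M. (g x)\<^sup>2)"
  \<comment> \<open>The excess of exp x + exp (- x) over its minimum 2 when |x| \<ge>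
    \<epsilon>.\<close>
  define c where "c = \<epsilon>\<^sup>2 / 4"
  have c: "0 < c" using \<epsilon> by (simp add: c_def)
  have "(\<integral>\<^sup>+\<eta>. F \<eta> \<partial>P) = (\<integral>\<^sup>+\<eta>. ennreal (exp (R n \<eta>)) \<partial>P) + (\<integral>\<^sup>+\<eta>. ennreal (exp (- R n \<eta>)) \<partial>P)"
    unfolding F_def by (rule nn_integral_add) measurable
  also have "\<dots> \<le> ennreal (exp r) + ennreal (exp r)"
    using nn_integral_exp_comp_sum_le[OF mn] neg.nn_integral_exp_comp_sum_le[OF mn]
    by (intro add_mono) (simp_all add: R_def r_def comp_sum_uminus)
  finally have upper: "(\<integral>\<^sup>+\<eta>. F \<eta> \<partial>P) \<le> ennreal (2 * exp r)"
    by (simp flip: ennreal_plus)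
  have ge: "ennreal (x\<^sup>2 / 4 + 2) \<le> ennreal (exp x) + ennreal (exp (- x))" for x :: real
    using exp_plus_exp_uminus_ge[of x] by (simp add: ennreal_leI flip: ennreal_plus)
  have hit: "ennreal (c + 2) * emeasure P (A k) \<le> (\<integral>\<^sup>+\<eta>. F \<eta> * indicator (A k) \<eta> \<partial>P)"
    if k: "k \<in> {m..n}" for k
  proof -
    \<comment> \<open>Whether k is the first passage index depends only on \<open>R j\<close> with j
      \<le> k, hence only on the points in \<open>T k\<close>.\<close>
    have inv: "restrict_pattern (T k) \<eta> \<in> A k \<longleftrightarrow> \<eta> \<in> A k" if "\<eta> \<in> space P" for \<eta>
    proof -
      have "R j (restrict_pattern (T k) \<eta>) = R j \<eta>" if "j \<le> k" for j
        using that k \<open>\<eta> \<in> space P\<close> by (simp add: R_def comp_sum_restrict_pattern space_P)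
      then show ?thesis
        using that by (auto simp: A_def space_P restrict_pattern_point_patterns)
    qed
    have "ennreal (c + 2) * emeasure P (A k) = (\<integral>\<^sup>+\<eta>. ennreal (c + 2) * indicator (A k) \<eta> \<partial>P)"
      by (simp add: nn_integral_cmult_indicator)
    also have "\<dots> \<le> (\<integral>\<^sup>+\<eta>. (ennreal (exp (R k \<eta>)) + ennreal (exp (- R k \<eta>))) * indicator (A k) \<eta> \<partial>P)"
    proof (rule nn_integral_mono)
      fix \<eta>
      show "ennreal (c + 2) * indicator (A k) \<eta> \<le> (ennreal (exp (R k \<eta>)) + ennreal (exp (- R k \<eta>))) * indicator (A k) \<eta>"
      proof (cases "\<eta> \<in> A k")
        case True
        then have "\<epsilon>\<^sup>2 \<le> (R k \<eta>)\<^sup>2" using \<epsilon> by (simp add: A_def abs_le_square_iff[symmetric])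
        then have "ennreal (c + 2) \<le> ennreal ((R k \<eta>)\<^sup>2 / 4 + 2)" by (intro ennreal_leI) (simp add: c_def)
        also note ge
        finally show ?thesis using True by simp
      qed simp
    qed
    also have "\<dots> = (\<integral>\<^sup>+\<eta>. ennreal (exp (R k \<eta>)) * indicator (A k) \<eta> \<partial>P)
        + (\<integral>\<^sup>+\<eta>. ennreal (exp (- R k \<eta>)) * indicator (A k) \<eta> \<partial>P)"
      by (simp add: distrib_right nn_integral_add)
    also have "\<dots> \<le> (\<integral>\<^sup>+\<eta>. ennreal (exp (R n \<eta>)) * indicator (A k) \<eta> \<partial>P)
        + (\<integral>\<^sup>+\<eta>. ennreal (exp (- R n \<eta>)) * indicator (A k) \<eta> \<partial>P)"
      using exp_comp_sum_submartingale[of m k n "A k"] neg.exp_comp_sum_submartingale[of m k n "A k"] k inv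
      by (intro add_mono) (auto simp: R_def comp_sum_uminus)
    also have "\<dots> = (\<integral>\<^sup>+\<eta>. F \<eta> * indicator (A k) \<eta> \<partial>P)"
      by (simp add: F_def distrib_right nn_integral_add)
    finally show ?thesis .
  qed
  have UA: "U = (\<Union>k\<in>{m..n}. A k)"
  proof (intro equalityI subsetI)
    fix \<eta> assume \<eta>: "\<eta> \<in> U"
    define k where "k = (LEAST k. m \<le> k \<and> \<epsilon> \<le> \<bar>R k \<eta>\<bar>)"
    from \<eta> obtain k0 where k0: "k0 \<in> {m..n}" "\<epsilon> \<le> \<bar>R k0 \<eta>\<bar>" by (auto simp: U_def)
    have k: "m \<le> k" "\<epsilon> \<le> \<bar>R k \<eta>\<bar>"
      using LeastI[of "\<lambda>k. m \<le> k \<and> \<epsilon> \<le> \<bar>R k \<eta>\<bar>" k0] k0 by (auto simp: k_def)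
    have "k \<le> k0" unfolding k_def by (rule Least_le) (use k0 in auto)
    moreover have "\<bar>R j \<eta>\<bar> < \<epsilon>" if "j \<in> {m..<k}" for j
      using not_less_Least[of j "\<lambda>k. m \<le> k \<and> \<epsilon> \<le> \<bar>R k \<eta>\<bar>"] that by (auto simp: k_def)
    ultimately show "\<eta> \<in> (\<Union>k\<in>{m..n}. A k)"
      using k k0 \<eta> by (auto simp: A_def U_def intro!: bexI[of _ k])
  qed (auto simp: A_def U_def)
  have dA: "disjoint_family_on A {m..n}"
    unfolding disjoint_family_on_def
  proof (intro ballI impI)
    fix j k assume jk: "j \<in> {m..n}" "k \<in> {m..n}" "j \<noteq> k"
    then consider "j < k" | "k < j" by linarith
    then show "A j \<inter> A k = {}"
      by cases (use jk in \<open>force simp: A_def\<close>)+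
  qed
  define D where "D = density P F"
  have D: "emeasure D B = (\<integral>\<^sup>+\<eta>. F \<eta> * indicator B \<eta> \<partial>P)" if "B \<in> sets P" for B
    using that by (simp add: D_def emeasure_density)
  have "ennreal (c + 2) * emeasure P U = (\<Sum>k\<in>{m..n}. ennreal (c + 2) * emeasure P (A k))"
    unfolding UA sum_distrib_left[symmetric] using dA by (subst sum_emeasure) auto
  also have "\<dots> \<le> (\<Sum>k\<in>{m..n}. emeasure D (A k))"
    by (intro sum_mono) (simp add: hit D)
  also have "\<dots> = emeasure D U"
    unfolding UA using dA by (intro sum_emeasure) (auto simp: D_def)
  finally have 1: "ennreal (c + 2) * emeasure P U \<le> emeasure D U" .
  \<comment> \<open>Off U the minimum 2 of F is kept. Subtracting 2 from the bound 2 exp r then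
    leaves 2 (exp r - 1), which is small for large m; division by c yields the constant 8.\<close>
  have "2 * emeasure P (space P - U) = (\<integral>\<^sup>+\<eta>. 2 * indicator (space P - U) \<eta> \<partial>P)"
    by (simp add: nn_integral_cmult_indicator)
  also have "\<dots> \<le> (\<integral>\<^sup>+\<eta>. F \<eta> * indicator (space P - U) \<eta> \<partial>P)"
  proof (intro nn_integral_mono mult_right_mono)
    fix \<eta>
    have "(2::ennreal) = ennreal 2" by simp
    also have "\<dots> \<le> ennreal ((R n \<eta>)\<^sup>2 / 4 + 2)" by (rule ennreal_leI) simp
    also have "\<dots> \<le> F \<eta>" unfolding F_def by (rule ge)
    finally show "2 \<le> F \<eta>" .
  qed simp
  finally have 2: "2 * emeasure P (space P - U) \<le> emeasure D (space P - U)" by (simp add: D)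
  have "emeasure D U + emeasure D (space P - U) = emeasure D (space P)"
    using sets.sets_into_space[OF U] by (subst plus_emeasure) (auto simp: D_def Un_absorb1)
  also have "\<dots> = (\<integral>\<^sup>+\<eta>. F \<eta> \<partial>P)" by (simp add: D cong: nn_integral_cong)
  also note upper
  finally have "ennreal (c + 2) * emeasure P U + 2 * emeasure P (space P - U) \<le> ennreal (2 * exp r)"
    using add_mono[OF 1 2] by (rule order_trans[rotated])
  then have "ennreal ((c + 2) * prob U + 2 * prob (space P - U)) \<le> ennreal (2 * exp r)"
    using c by (simp add: emeasure_eq_measure ennreal_mult'' ennreal_plus)
  then have "(c + 2) * prob U + 2 * (1 - prob U) \<le> 2 * exp r"
    by (simp add: prob_compl)
  then have "c * prob U \<le> 2 * (exp r - 1)" by (simp add: algebra_simps)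
  then have "prob U \<le> 2 * (exp r - 1) / c" using c by (simp add: field_simps)
  then show ?thesis by (simp add: U_def R_def r_def c_def mult.commute)
qed

text \<open>The maximal inequality is uniform in n, so after index m the path ever moves \<epsilon>
  away from its value at m with probability at most \<open>b m\<close>. Since \<open>b m\<close>
  tends to 0, almost every path stays \<epsilon>-close from some m on; countably many \<epsilon>
  give the Cauchy property.\<close>

theorem AE_convergent_comp_sum: "AE \<eta> in P. convergent (\<lambda>n. comp_sum g n \<eta>)"
proof -
  have ae: "AE \<eta> in P. \<exists>m. \<forall>k\<ge>m. \<bar>comp_sum g k \<eta> - comp_sum g m \<eta>\<bar> < \<epsilon>" if \<epsilon>: "0 < \<epsilon>" for \<epsilon>
  proof -
    define b where "b m = 8 / \<epsilon>\<^sup>2 * (exp (LINT x:space M - T m|M. (g x)\<^sup>2) - 1)" for m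
    have "b \<longlonglongrightarrow> 8 / \<epsilon>\<^sup>2 * (exp 0 - 1)"
      unfolding b_def by (intro tendsto_intros tail_tendsto_zero[OF g2])
    then have b: "b \<longlonglongrightarrow> 0" by simp
    define E where "E m n = {\<eta>\<in>space P. \<exists>k\<in>{m..n}. \<epsilon> \<le> \<bar>comp_sum g k \<eta> - comp_sum g m \<eta>\<bar>}" for m n
    have E [measurable]: "E m n \<in> sets P" for m n unfolding E_def by measurable
    have Eb: "prob (E m n) \<le> b m" for m n
    proof (cases "m \<le> n")
      case True
      then show ?thesis using maximal_inequality[OF _ \<epsilon>] by (simp add: E_def b_def)
    next
      case False
      then have "E m n = {}" by (auto simp: E_def)
      moreover have "0 \<le> (LINT x:space M - T m|M. (g x)\<^sup>2)"
        unfolding set_lebesgue_integral_def by (rule Bochner_Integration.integral_nonneg) simp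
      ultimately show ?thesis by (simp add: b_def)
    qed
    have UE: "prob (\<Union>n. E m n) \<le> b m" for m
    proof (rule LIMSEQ_le_const2)
      show "(\<lambda>n. prob (E m n)) \<longlonglongrightarrow> prob (\<Union>n. E m n)"
        by (rule finite_Lim_measure_incseq) (use E in \<open>blast, fastforce simp: incseq_def E_def\<close>)
    qed (use Eb in auto)
    have "prob (\<Inter>m. \<Union>n. E m n) \<le> b m" for m
      by (rule order_trans[OF finite_measure_mono UE[of m]]) auto
    then have "prob (\<Inter>m. \<Union>n. E m n) \<le> 0"
      by (intro LIMSEQ_le_const[OF b]) auto
    then have "emeasure P (\<Inter>m. \<Union>n. E m n) = 0"
      by (simp add: emeasure_eq_measure measure_le_0_iff)
    then have "(\<Inter>m. \<Union>n. E m n) \<in> null_sets P" by (auto simp: null_sets_def)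
    from AE_not_in[OF this] AE_space show ?thesis
    proof eventually_elim
      case (elim \<eta>)
      then obtain m where "\<forall>n. \<eta> \<notin> E m n" by auto
      then have "\<bar>comp_sum g k \<eta> - comp_sum g m \<eta>\<bar> < \<epsilon>" if "k \<ge> m" for k
        using that elim(2) by (auto simp: E_def not_le dest!: spec[of _ k])
      then show ?case by blast
    qed
  qed
  have "AE \<eta> in P. \<forall>j. \<exists>m. \<forall>k\<ge>m. \<bar>comp_sum g k \<eta> - comp_sum g m \<eta>\<bar> < inverse (real (Suc j))"
    unfolding AE_all_countable by (intro allI ae) simp
  then show ?thesis
  proof eventually_elim
    case (elim \<eta>)
    have "Cauchy (\<lambda>n. comp_sum g n \<eta>)"
      unfolding Cauchy_altdef2 dist_real_def
    proof (intro allI impI)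
      fix e :: real assume "0 < e"
      then obtain j where j: "inverse (real (Suc j)) < e" using reals_Archimedean by blast
      from elim obtain m where "\<forall>k\<ge>m. \<bar>comp_sum g k \<eta> - comp_sum g m \<eta>\<bar> < inverse (real (Suc j))"
        by blast
      with j show "\<exists>N. \<forall>n\<ge>N. \<bar>comp_sum g n \<eta> - comp_sum g N \<eta>\<bar> < e" by force
    qed
    then show ?case by (simp add: Cauchy_convergent_iff)
  qed
qed

end

section \<open>Consequences of a finite Hellinger distance\<close>

lemma sqrt_exp: "sqrt (exp y) = exp (y / 2)"
  by (rule real_sqrt_unique) (simp_all add: power2_eq_square flip: exp_add)

text \<open>For y < 0, the linear term |y| / 2 loses at most (y / 2)^2 \<le> |y| / 4, and 1/4 is
  what remains. Its square is the origin of the constant 16 in the estimates below.\<close>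

lemma sqrt_exp_minus_one_ge:
  fixes y :: real
  assumes "\<bar>y\<bar> \<le> 1"
  shows "\<bar>y\<bar> / 4 \<le> \<bar>sqrt (exp y) - 1\<bar>"
proof (cases "0 \<le> y")
  case True
  then show ?thesis using exp_ge_add_one_self[of "y / 2"] unfolding sqrt_exp by linarith
next
  case False
  have "exp (y / 2) - 1 - y / 2 \<le> (y / 2)\<^sup>2"
    by (rule exp_minus_one_minus_le_square) (use assms in simp)
  moreover have "(y / 2)\<^sup>2 \<le> \<bar>y\<bar> / 4"
    using assms False mult_right_mono[of "\<bar>y\<bar>" 1 "\<bar>y\<bar>"] by (simp add: power2_eq_square)
  ultimately show ?thesis using False unfolding sqrt_exp by linarith
qed

lemma ln_square_le:
  fixes t :: real
  assumes "0 < t" "\<bar>ln t\<bar> \<le> 1"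
  shows "(ln t)\<^sup>2 \<le> 16 * (sqrt t - 1)\<^sup>2"
proof -
  have "\<bar>ln t\<bar> \<le> 4 * \<bar>sqrt t - 1\<bar>"
    using sqrt_exp_minus_one_ge[OF assms(2)] assms(1) by simp
  also have "\<dots> = \<bar>4 * (sqrt t - 1)\<bar>" by (simp only: abs_mult abs_numeral)
  finally have "\<bar>ln t\<bar> \<le> \<bar>4 * (sqrt t - 1)\<bar>" .
  then show ?thesis by (simp only: abs_le_square_iff power_mult_distrib) simp
qed

text \<open>Monotonicity of the square root reduces the claim to t = exp 1 and t = exp (- 1), where
  the preceding estimate with |y| = 1 gives 1/4.\<close>

lemma sqrt_minus_one_ge_of_ln_large:
  fixes t :: real
  assumes "0 \<le> t" "t = 0 \<or> 1 < \<bar>ln t\<bar>"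
  shows "1 / 4 \<le> \<bar>sqrt t - 1\<bar>"
proof (cases "t = 0")
  case False
  with assms have t: "0 < t" "1 < \<bar>ln t\<bar>" by auto
  show ?thesis
  proof (cases "0 \<le> ln t")
    case True
    with t(2) have "exp 1 \<le> exp (ln t)" by simp
    with t(1) have "exp 1 \<le> t" by simp
    then have "sqrt (exp 1) \<le> sqrt t" by simp
    moreover have "1 \<le> sqrt (exp 1)" by simp
    ultimately show ?thesis using sqrt_exp_minus_one_ge[of 1] by linarith
  next
    case False
    with t(2) have "exp (ln t) \<le> exp (- 1)" by simp
    with t(1) have "t \<le> exp (- 1)" by simp
    then have "sqrt t \<le> sqrt (exp (- 1))" by simp
    moreover have "sqrt (exp (- 1)) \<le> 1" by simp
    ultimately show ?thesis using sqrt_exp_minus_one_ge[of "- 1"] by linarith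
  qed
qed simp

lemma abs_minus_one_le:
  fixes t :: real
  assumes "0 \<le> t"
  shows "\<bar>t - 1\<bar> \<le> 2 * \<bar>sqrt t - 1\<bar> + (sqrt t - 1)\<^sup>2"
proof -
  have "t - 1 = 2 * (sqrt t - 1) + (sqrt t - 1)\<^sup>2"
    using assms by (simp add: power2_diff)
  then have "\<bar>t - 1\<bar> = \<bar>2 * (sqrt t - 1) + (sqrt t - 1)\<^sup>2\<bar>" by simp
  also have "\<dots> \<le> \<bar>2 * (sqrt t - 1)\<bar> + \<bar>(sqrt t - 1)\<^sup>2\<bar>" by (rule abs_triangle_ineq)
  also have "\<dots> = 2 * \<bar>sqrt t - 1\<bar> + (sqrt t - 1)\<^sup>2" by (simp only: abs_mult) simp
  finally show ?thesis .
qed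

section \<open>Limits of weighted squares\<close>

lemma le_of_le_one_plus_mult:
  fixes x y :: real
  assumes y: "0 \<le> y" and le: "\<And>t. 0 < t \<Longrightarrow> x \<le> (1 + t) * y"
  shows "x \<le> y"
proof (rule field_le_epsilon)
  fix e :: real assume e: "0 < e"
  have "x \<le> (1 + e / (y + 1)) * y" by (rule le) (use e y in simp)
  also have "\<dots> = y + e * (y / (y + 1))" by (simp add: algebra_simps)
  also have "e * (y / (y + 1)) \<le> e * 1" using e y by (intro mult_left_mono) auto
  finally show "x \<le> y + e" by simp
qed

text \<open>Young's inequality for u = w + (u - w). A small t puts a factor close to 1 on w at the
  cost of a large one on the difference.\<close>

lemma square_le_weighted:
  fixes u w t :: real
  assumes "0 < t"
  shows "u\<^sup>2 \<le> (1 + t) * w\<^sup>2 + (1 + 1 / t) * (u - w)\<^sup>2"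
proof -
  have "(1 + t) * w\<^sup>2 + (1 + 1 / t) * (u - w)\<^sup>2 - u\<^sup>2 = (t * w - (u - w))\<^sup>2 / t"
    using assms by (simp add: field_simps power2_eq_square)
  also have "0 \<le> \<dots>" using assms by simp
  finally show ?thesis by simp
qed

text \<open>Continuity of the weighted L^2 norm. Young's inequality, used in both directions, holds
  for nonnegative integrals whose finiteness is not known beforehand; letting m grow removes the
  distance term, and then t tending to 0 removes the factor 1 + t.\<close>

lemma nn_integral_square_limit:
  fixes a :: "nat \<Rightarrow> 'a \<Rightarrow> real" and b Z :: "'a \<Rightarrow> real"
  assumes [measurable]: "\<And>m. a m \<in> borel_measurable N" "b \<in> borel_measurable N" "Z \<in> borel_measurable N"
    and Z: "AE x in N. 0 \<le> Z x \<and> Z x \<le> 1"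
    and \<delta>: "\<delta> \<longlonglongrightarrow> 0" "\<And>m. 0 \<le> \<delta> m"
    and ab: "\<And>m. (\<integral>\<^sup>+x. ennreal ((a m x - b x)\<^sup>2) \<partial>N) \<le> ennreal (\<delta> m)"
    and C: "\<And>m. m \<ge> k \<Longrightarrow> (\<integral>\<^sup>+x. ennreal ((a m x)\<^sup>2) * ennreal (Z x) \<partial>N) = ennreal C" "0 \<le> C"
  shows "(\<integral>\<^sup>+x. ennreal ((b x)\<^sup>2) * ennreal (Z x) \<partial>N) = ennreal C"
proof -
  have key: "(\<integral>\<^sup>+x. ennreal ((u x)\<^sup>2) * ennreal (Z x) \<partial>N)
      \<le> ennreal (1 + t) * (\<integral>\<^sup>+x. ennreal ((w x)\<^sup>2) * ennreal (Z x) \<partial>N)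
        + ennreal (1 + 1 / t) * (\<integral>\<^sup>+x. ennreal ((u x - w x)\<^sup>2) \<partial>N)"
    if t: "0 < t" and [measurable]: "u \<in> borel_measurable N" "w \<in> borel_measurable N"
    for t :: real and u w :: "'a \<Rightarrow> real"
  proof -
    have "(\<integral>\<^sup>+x. ennreal ((u x)\<^sup>2) * ennreal (Z x) \<partial>N)
      \<le> (\<integral>\<^sup>+x. ennreal (1 + t) * (ennreal ((w x)\<^sup>2) * ennreal (Z x)) + ennreal (1 + 1 / t) * ennreal ((u x - w x)\<^sup>2) \<partial>N)"
    proof (rule nn_integral_mono_AE)
      show "AE x in N. ennreal ((u x)\<^sup>2) * ennreal (Z x)
          \<le> ennreal (1 + t) * (ennreal ((w x)\<^sup>2) * ennreal (Z x)) + ennreal (1 + 1 / t) * ennreal ((u x - w x)\<^sup>2)"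
        using Z
      proof eventually_elim
        case (elim x)
        have "(u x)\<^sup>2 * Z x \<le> ((1 + t) * (w x)\<^sup>2 + (1 + 1 / t) * (u x - w x)\<^sup>2) * Z x"
          using elim square_le_weighted[OF t] by (intro mult_right_mono) auto
        also have "\<dots> = (1 + t) * ((w x)\<^sup>2 * Z x) + ((1 + 1 / t) * (u x - w x)\<^sup>2) * Z x"
          by (simp add: algebra_simps)
        also have "((1 + 1 / t) * (u x - w x)\<^sup>2) * Z x \<le> ((1 + 1 / t) * (u x - w x)\<^sup>2) * 1"
          using elim t by (intro mult_left_mono) auto
        finally have "(u x)\<^sup>2 * Z x \<le> (1 + t) * ((w x)\<^sup>2 * Z x) + (1 + 1 / t) * (u x - w x)\<^sup>2" by simp
        then have "ennreal ((u x)\<^sup>2 * Z x) \<le> ennreal ((1 + t) * ((w x)\<^sup>2 * Z x) + (1 + 1 / t) * (u x - w x)\<^sup>2)"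
          by (rule ennreal_leI)
        also have "\<dots> = ennreal ((1 + t) * ((w x)\<^sup>2 * Z x)) + ennreal ((1 + 1 / t) * (u x - w x)\<^sup>2)"
          using elim t by (intro ennreal_plus) auto
        finally show ?case using elim t by (simp add: ennreal_mult)
      qed
    qed
    also have "\<dots> = ennreal (1 + t) * (\<integral>\<^sup>+x. ennreal ((w x)\<^sup>2) * ennreal (Z x) \<partial>N)
        + ennreal (1 + 1 / t) * (\<integral>\<^sup>+x. ennreal ((u x - w x)\<^sup>2) \<partial>N)"
      by (subst nn_integral_add) (auto simp: nn_integral_cmult)
    finally show ?thesis .
  qed
  have ba: "(\<integral>\<^sup>+x. ennreal ((b x - a m x)\<^sup>2) \<partial>N) \<le> ennreal (\<delta> m)" for m
    using ab[of m] by (simp add: power2_commute)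
  have up: "(\<integral>\<^sup>+x. ennreal ((b x)\<^sup>2) * ennreal (Z x) \<partial>N) \<le> ennreal ((1 + t) * C + (1 + 1 / t) * \<delta> m)"
    if t: "0 < t" and m: "m \<ge> k" for t :: real and m
  proof -
    have "(\<integral>\<^sup>+x. ennreal ((b x)\<^sup>2) * ennreal (Z x) \<partial>N)
      \<le> ennreal (1 + t) * ennreal C + ennreal (1 + 1 / t) * ennreal (\<delta> m)"
      unfolding C(1)[OF m, symmetric]
      by (rule order_trans[OF key[OF t, of b "a m"]]) (auto intro!: add_left_mono mult_left_mono ba)
    then show ?thesis using t C(2) \<delta>(2)[of m] by (simp add: ennreal_mult ennreal_plus)
  qed
  have "(\<integral>\<^sup>+x. ennreal ((b x)\<^sup>2) * ennreal (Z x) \<partial>N) < \<infinity>"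
    using up[of 1 k] by (rule order_le_less_trans) auto
  \<comment> \<open>Finite by \<open>up\<close> with t = 1 and m = k; hence the integral is a real
    number J, and both inequalities can be argued in the reals.\<close>
  then have "ennreal (enn2real (\<integral>\<^sup>+x. ennreal ((b x)\<^sup>2) * ennreal (Z x) \<partial>N))
      = (\<integral>\<^sup>+x. ennreal ((b x)\<^sup>2) * ennreal (Z x) \<partial>N)"
    by (intro ennreal_enn2real) simp
  then obtain J where J: "0 \<le> J" "(\<integral>\<^sup>+x. ennreal ((b x)\<^sup>2) * ennreal (Z x) \<partial>N) = ennreal J"
    using enn2real_nonneg by metis
  have lim: "x \<le> (1 + t) * y" if "\<And>m. m \<ge> k \<Longrightarrow> x \<le> (1 + t) * y + (1 + 1 / t) * \<delta> m" for x y t :: real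
  proof (rule LIMSEQ_le_const)
    have "(\<lambda>m. (1 + t) * y + (1 + 1 / t) * \<delta> m) \<longlonglongrightarrow> (1 + t) * y + (1 + 1 / t) * 0"
      by (intro tendsto_intros \<delta>(1))
    then show "(\<lambda>m. (1 + t) * y + (1 + 1 / t) * \<delta> m) \<longlonglongrightarrow> (1 + t) * y" by simp
  qed (use that in blast)
  have "J \<le> C"
  proof (rule le_of_le_one_plus_mult[OF C(2)], rule lim)
    fix t :: real and m assume "0 < t" "m \<ge> k"
    with up[OF this] J show "J \<le> (1 + t) * C + (1 + 1 / t) * \<delta> m"
      using C(2) \<delta>(2)[of m] by (subst (asm) J(2)) (simp add: ennreal_le_iff del: ennreal_plus)
  qed
  moreover have "C \<le> J"
  proof (rule le_of_le_one_plus_mult[OF J(1)], rule lim)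
    fix t :: real and m assume t: "0 < t" and m: "m \<ge> k"
    have "ennreal C \<le> ennreal (1 + t) * ennreal J + ennreal (1 + 1 / t) * ennreal (\<delta> m)"
      unfolding C(1)[OF m, symmetric] J(2)[symmetric]
      by (rule order_trans[OF key[OF t, of "a m" b]]) (auto intro!: add_left_mono mult_left_mono ab)
    then have "ennreal C \<le> ennreal ((1 + t) * J + (1 + 1 / t) * \<delta> m)"
      using t J(1) \<delta>(2)[of m] by (simp add: ennreal_mult ennreal_plus)
    then show "C \<le> (1 + t) * J + (1 + 1 / t) * \<delta> m"
      using t J(1) \<delta>(2)[of m] by (simp add: ennreal_le_iff del: ennreal_plus)
  qed
  ultimately show ?thesis using J(2) by simp
qed

text \<open>\<open>hellinger_integrable\<close> is the finiteness of the Hellinger distance with the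
  intensity M itself as dominating measure, the two densities being \<phi> and 1.\<close>

locale hellinger_density = poisson_exhaustion +
  fixes \<phi> :: "'a \<Rightarrow> real"
  assumes \<phi> [measurable]: "\<phi> \<in> borel_measurable M" and \<phi>_nonneg: "\<And>x. x \<in> space M \<Longrightarrow> 0 \<le> \<phi> x"
    and hellinger_integrable: "integrable M (\<lambda>x. (sqrt (\<phi> x) - 1)\<^sup>2)"
begin

abbreviation "q x \<equiv> (sqrt (\<phi> x) - 1)\<^sup>2"
abbreviation "S \<equiv> log_small M \<phi>"
abbreviation "L \<equiv> log_large M \<phi>"

lemma log_small_eq: "S = {x\<in>space M. \<phi> x \<noteq> 0 \<and> \<bar>ln (\<phi> x)\<bar> \<le> 1}"
  by (auto simp: log_small_def log_ext_def)

lemma log_large_eq: "L = {x\<in>space M. \<phi> x = 0 \<or> 1 < \<bar>ln (\<phi> x)\<bar>}"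
  by (auto simp: log_large_def log_ext_def)

lemma sets_log [measurable]: "S \<in> sets M" "L \<in> sets M"
  unfolding log_small_eq log_large_eq by measurable

lemma log_partition: "S \<union> L = space M" "S \<inter> L = {}"
  unfolding log_small_eq log_large_eq by auto

lemma set_integrable_hellinger_bound:
  fixes f :: "'a \<Rightarrow> real"
  assumes A: "A \<in> sets M" and [measurable]: "f \<in> borel_measurable M"
    and b: "\<And>x. x \<in> A \<Longrightarrow> \<bar>f x\<bar> \<le> C * q x"
  shows "set_integrable M A f"
proof -
  note [measurable] = A
  have "integrable M (\<lambda>x. indicator A x *\<^sub>R (C * q x))"
    using hellinger_integrable by (intro integrable_mult_indicator A) auto
  then show ?thesis
    unfolding set_integrable_def
    by (rule Bochner_Integration.integrable_bound)
      (measurable, auto intro!: AE_I2 order_trans[OF b abs_ge_self] split: split_indicator)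
qed

lemma small_bound:
  assumes "x \<in> S"
  shows "(ln (\<phi> x))\<^sup>2 \<le> 16 * q x" "\<bar>ln (\<phi> x) + 1 - \<phi> x\<bar> \<le> 16 * q x"
proof -
  have *: "0 < \<phi> x" "\<bar>ln (\<phi> x)\<bar> \<le> 1"
    using assms \<phi>_nonneg[of x] by (auto simp: log_small_eq)
  show 1: "(ln (\<phi> x))\<^sup>2 \<le> 16 * q x" by (rule ln_square_le[OF *])
  have "\<phi> x - 1 - ln (\<phi> x) \<le> (ln (\<phi> x))\<^sup>2"
    using exp_minus_one_minus_le_square[OF *(2)] *(1) by simp
  moreover have "ln (\<phi> x) + 1 \<le> \<phi> x" using ln_le_minus_one[OF *(1)] by simp
  ultimately show "\<bar>ln (\<phi> x) + 1 - \<phi> x\<bar> \<le> 16 * q x" using 1 by simp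
qed

lemma large_bound:
  assumes "x \<in> L"
  shows "1 \<le> 16 * q x" "\<bar>1 - \<phi> x\<bar> \<le> 16 * q x"
proof -
  have 0: "0 \<le> \<phi> x" using assms \<phi>_nonneg[of x] by (simp add: log_large_eq)
  have *: "1 / 4 \<le> \<bar>sqrt (\<phi> x) - 1\<bar>"
    by (rule sqrt_minus_one_ge_of_ln_large[OF 0]) (use assms in \<open>simp add: log_large_eq\<close>)
  then have "(1 / 4)\<^sup>2 \<le> \<bar>sqrt (\<phi> x) - 1\<bar>\<^sup>2" by (intro power_mono) auto
  then show "1 \<le> 16 * q x" by (simp add: power2_eq_square)
  have "1 / 4 * \<bar>sqrt (\<phi> x) - 1\<bar> \<le> \<bar>sqrt (\<phi> x) - 1\<bar> * \<bar>sqrt (\<phi> x) - 1\<bar>"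
    using * by (intro mult_right_mono) auto
  then have "\<bar>sqrt (\<phi> x) - 1\<bar> \<le> 4 * q x" by (simp add: power2_eq_square)
  \<comment> \<open>This gives the factor 2 * 4 + 1 = 9, enlarged to 16 so that one constant serves
    all estimates.\<close>
  with abs_minus_one_le[OF 0] have "\<bar>\<phi> x - 1\<bar> \<le> 2 * (4 * q x) + q x"
    by (elim order_trans) (intro add_right_mono mult_left_mono, simp_all)
  then have "\<bar>1 - \<phi> x\<bar> \<le> 9 * q x"
    by (simp add: abs_minus_commute)
  also have "\<dots> \<le> 16 * q x" by (intro mult_right_mono) simp_all
  finally show "\<bar>1 - \<phi> x\<bar> \<le> 16 * q x" .
qed

lemma set_integrable_small: "set_integrable M S (\<lambda>x. ln (\<phi> x) + 1 - \<phi> x)"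
  by (rule set_integrable_hellinger_bound[where C=16]) (auto intro: small_bound)

lemma set_integrable_large: "set_integrable M L (\<lambda>x. 1 - \<phi> x)"
  by (rule set_integrable_hellinger_bound[where C=16]) (auto intro: large_bound)

text \<open>Consequently almost every pattern has only finitely many points in L, where ln \<phi>
  can be summed without compensation.\<close>

lemma finite_large: "emeasure M L < \<infinity>"
proof -
  have "set_integrable M L (\<lambda>_. 1::real)"
    by (rule set_integrable_hellinger_bound[where C=16]) (auto intro: large_bound)
  then show ?thesis by (simp add: set_integrable_def integrable_indicator_iff)
qed

lemma bounded_integrand_ln: "bounded_integrand P M T (\<lambda>x. indicator S x * ln (\<phi> x))"
proof unfold_locales
  show "\<bar>indicator S x * ln (\<phi> x)\<bar> \<le> 1" for x
    by (simp add: log_small_eq indicator_def)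
  have "set_integrable M S (\<lambda>x. (ln (\<phi> x))\<^sup>2)"
    by (rule set_integrable_hellinger_bound[where C=16]) (auto intro: small_bound)
  then show "integrable M (\<lambda>x. (indicator S x * ln (\<phi> x))\<^sup>2)"
    unfolding set_integrable_def
    by (rule Bochner_Integration.integrable_cong[THEN iffD1, OF refl, rotated])
      (simp split: split_indicator)
qed measurable

text \<open>Constants are integrable over \<open>T n\<close>, and both \<phi> and sqrt \<phi> are at
  most 2 + 2 q there. In particular the measure with density \<phi> is finite on \<open>T n\<close>,
  so the Laplace functional is available for both intensities.\<close>

lemma set_integrable_T:
  "set_integrable M (T n) \<phi>" "set_integrable M (T n) (\<lambda>x. sqrt (\<phi> x))" "set_integrable M (T n) (\<lambda>_. 1::real)"
proof -
  have 1: "set_integrable M (T n) (\<lambda>_. 1::real)" using finite_T[of n] by (simp add: set_integrable_def)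
  have q: "set_integrable M (T n) q"
    by (rule set_integrable_hellinger_bound[where C=1]) auto
  have "set_integrable M (T n) (\<lambda>x. 2 * (1 + q x))"
    by (intro set_integrable_mult_right set_integral_add(1) 1 q)
  then have *: "integrable M (\<lambda>x. indicator (T n) x *\<^sub>R (2 + 2 * q x))"
    by (simp add: set_integrable_def)
  have b: "0 \<le> \<phi> x" "\<phi> x \<le> 2 + 2 * q x" "sqrt (\<phi> x) \<le> 2 + 2 * q x" if "x \<in> T n" for x
  proof -
    show 0: "0 \<le> \<phi> x" using that sets.sets_into_space[OF sets_T] \<phi>_nonneg by auto
    have "2 * \<bar>sqrt (\<phi> x) - 1\<bar> \<le> 1 + q x"
      using sum_squares_bound[of 1 "\<bar>sqrt (\<phi> x) - 1\<bar>"] by simp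
    moreover define r Q where "r = \<bar>sqrt (\<phi> x) - 1\<bar>" and "Q = q x"
    ultimately have "2 * r \<le> 1 + Q" "0 \<le> Q" "sqrt (\<phi> x) \<le> 1 + r" "\<phi> x \<le> 1 + 2 * r + Q"
      using abs_minus_one_le[OF 0] by auto
    then show "\<phi> x \<le> 2 + 2 * q x" "sqrt (\<phi> x) \<le> 2 + 2 * q x"
      unfolding Q_def[symmetric] by linarith+
  qed
  show "set_integrable M (T n) \<phi>" "set_integrable M (T n) (\<lambda>x. sqrt (\<phi> x))"
    unfolding set_integrable_def
    using b by (auto intro!: Bochner_Integration.integrable_bound[OF *] AE_I2 split: split_indicator)
  show "set_integrable M (T n) (\<lambda>_. 1::real)" by (rule 1)
qed

end

section \<open>Truncated likelihood ratios\<close>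

lemma sqrt_pp_prod: "sqrt (pp_prod A w \<eta>) = pp_prod A (\<lambda>x. sqrt (w x)) \<eta>"
proof -
  \<comment> \<open>At negative arguments \<open>sqrt\<close> is extended as an odd and
    \<open>ln\<close> as an even function, so the identity persists.\<close>
  have "ln (sqrt t) = ln t / 2" for t :: real
    using ln_sqrt[of t] ln_sqrt[of "- t"] ln_minus[of t] ln_minus[of "sqrt t"]
    by (cases t "0 :: real" rule: linorder_cases) (simp_all add: real_sqrt_minus)
  then have "(LINT x:A|\<eta>. ln (sqrt (w x))) = (LINT x:A|\<eta>. ln (w x)) / 2"
    by (simp only: set_integral_divide_zero)
  then show ?thesis by (simp add: pp_prod_def sqrt_exp)
qed

section \<open>Integrals along the exhaustion\<close>

context exhaustion
begin

lemma set_integral_T_split: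
  assumes "k \<le> n" and [measurable]: "f \<in> borel_measurable M" and "set_integrable M (T n) (f :: 'a \<Rightarrow> real)"
  shows "(LINT x:T n|M. f x) = (LINT x:T k|M. f x) + (LINT x:T n - T k|M. f x)"
proof -
  have sub: "T k \<subseteq> T n" using incseqD[OF inc_T assms(1)] .
  then have U: "T k \<union> (T n - T k) = T n" by auto
  have "(LINT x:T k \<union> (T n - T k)|M. f x) = (LINT x:T k|M. f x) + (LINT x:T n - T k|M. f x)"
    by (intro set_integral_Un set_integrable_subset[OF assms(3)]) (use sub in auto)
  then show ?thesis unfolding U .
qed

text \<open>N stands for the intensity or for a single pattern; the exponent of the likelihood ratio
  contains integrals of both kinds.\<close>

lemma set_integral_T_tendsto:
  fixes f :: "'a \<Rightarrow> real"
  assumes N: "sets N = sets M" and A: "A \<in> sets M" and f: "set_integrable N A f"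
  shows "(\<lambda>n. LINT x:A \<inter> T n|N. f x) \<longlonglongrightarrow> (LINT x:A|N. f x)"
proof -
  have U: "(\<Union>n. A \<inter> T n) = A"
    using UN_T sets.sets_into_space[OF A] by blast
  have "(\<lambda>n. LINT x:A \<inter> T n|N. f x) \<longlonglongrightarrow> (LINT x:(\<Union>n. A \<inter> T n)|N. f x)"
  proof (rule set_integral_cont_up)
    show "incseq (\<lambda>n. A \<inter> T n)" using inc_T by (auto simp: incseq_def)
    show "set_integrable N (\<Union>n. A \<inter> T n) f" unfolding U by (rule f)
  qed (use N A in auto)
  then show ?thesis unfolding U .
qed

end

context poisson_exhaustion
begin

text \<open>Over \<open>T k\<close> the weights multiply, over \<open>T n - T k\<close> only w is
  left; these two disjoint pieces are independent.\<close>

lemma laplace_nested: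
  assumes kn: "k \<le> n"
    and w [measurable]: "w \<in> borel_measurable M" "\<And>x. x \<in> T n \<Longrightarrow> 0 \<le> w x" "set_integrable M (T n) w"
    and v [measurable]: "v \<in> borel_measurable M" "\<And>x. x \<in> T k \<Longrightarrow> 0 \<le> v x"
    and wv: "set_integrable M (T k) (\<lambda>x. w x * v x)"
  shows "(\<integral>\<^sup>+\<eta>. ennreal (pp_prod (T n) w \<eta> * pp_prod (T k) v \<eta>) \<partial>P)
    = ennreal (exp ((LINT x:T k|M. w x * v x - 1) + (LINT x:T n - T k|M. w x - 1)))"
proof -
  have sub: "T k \<subseteq> T n" using incseqD[OF inc_T kn] .
  then have U: "T k \<union> (T n - T k) = T n" by auto
  have fd: "emeasure M (T n - T k) < \<infinity>"
    by (rule order_le_less_trans[OF emeasure_mono finite_T[of n]]) auto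
  have "AE \<eta> in P. pp_prod (T n) w \<eta> * pp_prod (T k) v \<eta>
      = pp_prod (T k) (\<lambda>x. w x * v x) \<eta> * pp_prod (T n - T k) w \<eta>"
    using AE_finite_T AE_emeasure_finite[OF _ fd, simplified] AE_space
  proof eventually_elim
    case (elim \<eta>)
    then have \<eta>: "\<eta> \<in> point_patterns M" by (simp add: space_P)
    have "pp_prod (T n) w \<eta> = pp_prod (T k) w \<eta> * pp_prod (T n - T k) w \<eta>"
      using pp_prod_Un[OF \<eta>, of "T k" "T n - T k" w] elim unfolding U by auto
    then show ?case using elim by (simp add: pp_prod_mult[OF \<eta>] mult_ac)
  qed
  then have "(\<integral>\<^sup>+\<eta>. ennreal (pp_prod (T n) w \<eta> * pp_prod (T k) v \<eta>) \<partial>P)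
      = (\<integral>\<^sup>+\<eta>. ennreal (pp_prod (T k) (\<lambda>x. w x * v x) \<eta>) * ennreal (pp_prod (T n - T k) w \<eta>) \<partial>P)"
    by (intro nn_integral_cong_AE, eventually_elim) (simp add: ennreal_mult)
  also have "\<dots> = ennreal (exp (LINT x:T k|M. w x * v x - 1)) * ennreal (exp (LINT x:T n - T k|M. w x - 1))"
  proof (rule laplace_Un)
    show "set_integrable M (T n - T k) w" by (rule set_integrable_subset[OF w(3)]) auto
  qed (use fd finite_T wv w(2) v(2) sub in auto)
  finally show ?thesis by (simp add: exp_add ennreal_mult)
qed

end

section \<open>Moments of the truncated ratios\<close>

context hellinger_density
begin

definition truncated_ratio :: "nat \<Rightarrow> 'a measure \<Rightarrow> real" where
  "truncated_ratio n \<eta> = pp_prod (T n) \<phi> \<eta> * exp (- (LINT x:T n|M. \<phi> x - 1))"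

lemma truncated_ratio_nonneg: "0 \<le> truncated_ratio n \<eta>"
  by (simp add: truncated_ratio_def)

lemma measurable_truncated_ratio [measurable]:
  "truncated_ratio n \<in> borel_measurable (point_pattern_algebra M)"
  unfolding truncated_ratio_def by measurable

lemma T_nonneg: "x \<in> T n \<Longrightarrow> 0 \<le> \<phi> x"
  using sets.sets_into_space[OF sets_T] \<phi>_nonneg by blast

lemma set_integrable_T_minus_one:
  "set_integrable M (T n) (\<lambda>x. \<phi> x - 1)" "set_integrable M (T n) (\<lambda>x. sqrt (\<phi> x) - 1)"
  using set_integrable_T by (auto intro!: set_integral_diff)

text \<open>The normalisation cancels the contribution of \<open>T n - T k\<close>, so the value is
  the same for all n \<ge> k, as for a martingale. It is the Laplace functional over
  \<open>T k\<close> of the Poisson law whose intensity has density \<phi>.\<close>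

lemma nn_integral_truncated_ratio:
  assumes kn: "k \<le> n" and v [measurable]: "v \<in> borel_measurable M" and v0: "\<And>x. 0 < v x" "\<And>x. v x \<le> 1"
  shows "(\<integral>\<^sup>+\<eta>. ennreal (truncated_ratio n \<eta>) * ennreal (pp_prod (T k) v \<eta>) \<partial>P)
    = ennreal (exp (LINT x:T k|M. \<phi> x * (v x - 1)))"
proof -
  have i: "set_integrable M (T k) (\<lambda>x. \<phi> x * v x)"
    unfolding set_integrable_def
  proof (rule Bochner_Integration.integrable_bound[OF set_integrable_T(1)[of k, unfolded set_integrable_def]])
    show "AE x in M. norm (indicator (T k) x *\<^sub>R (\<phi> x * v x)) \<le> norm (indicator (T k) x *\<^sub>R \<phi> x)"
      using v0 T_nonneg[of _ k]
      by (auto intro!: AE_I2 mult_left_le simp: abs_mult abs_of_pos indicator_def)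
  qed measurable
  define c where "c = exp (- (LINT x:T n|M. \<phi> x - 1))"
  have "(\<integral>\<^sup>+\<eta>. ennreal (truncated_ratio n \<eta>) * ennreal (pp_prod (T k) v \<eta>) \<partial>P)
    = (\<integral>\<^sup>+\<eta>. ennreal c * ennreal (pp_prod (T n) \<phi> \<eta> * pp_prod (T k) v \<eta>) \<partial>P)"
    by (intro nn_integral_cong) (simp add: truncated_ratio_def c_def ennreal_mult[symmetric] mult_ac)
  also have "\<dots> = ennreal c * (\<integral>\<^sup>+\<eta>. ennreal (pp_prod (T n) \<phi> \<eta> * pp_prod (T k) v \<eta>) \<partial>P)"
    by (rule nn_integral_cmult) measurable
  also have "\<dots> = ennreal c * ennreal (exp ((LINT x:T k|M. \<phi> x * v x - 1) + (LINT x:T n - T k|M. \<phi> x - 1)))"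
    by (subst laplace_nested[OF kn \<phi>]) (use T_nonneg v0 i set_integrable_T in \<open>auto intro: less_imp_le\<close>)
  also have "\<dots> = ennreal (exp ((LINT x:T k|M. \<phi> x * v x - 1) + (LINT x:T n - T k|M. \<phi> x - 1) - (LINT x:T n|M. \<phi> x - 1)))"
    by (simp add: c_def mult_exp_exp flip: ennreal_mult)
  also have "(LINT x:T k|M. \<phi> x * v x - 1) + (LINT x:T n - T k|M. \<phi> x - 1) - (LINT x:T n|M. \<phi> x - 1)
      = (LINT x:T k|M. \<phi> x * v x - 1) - (LINT x:T k|M. \<phi> x - 1)"
    using set_integral_T_split[OF kn _ set_integrable_T_minus_one(1)[of n]] by simp
  also have "\<dots> = (LINT x:T k|M. (\<phi> x * v x - 1) - (\<phi> x - 1))"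
    using i set_integrable_T set_integrable_T_minus_one by (intro set_integral_diff(2)[symmetric] set_integral_diff(1)) auto
  also have "\<dots> = (LINT x:T k|M. \<phi> x * (v x - 1))"
    by (simp add: right_diff_distrib)
  finally show ?thesis .
qed

lemma sqrt_truncated_ratio:
  "sqrt (truncated_ratio n \<eta>) = pp_prod (T n) (\<lambda>x. sqrt (\<phi> x)) \<eta> * exp (- (LINT x:T n|M. \<phi> x - 1) / 2)"
  by (simp add: truncated_ratio_def real_sqrt_mult sqrt_pp_prod sqrt_exp)

text \<open>The left-hand side is the Hellinger affinity of the two truncated laws.\<close>

lemma nn_integral_sqrt_truncated_ratio:
  assumes kn: "k \<le> n"
  shows "(\<integral>\<^sup>+\<eta>. ennreal (sqrt (truncated_ratio n \<eta>) * sqrt (truncated_ratio k \<eta>)) \<partial>P)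
    = ennreal (exp (- (LINT x:T n - T k|M. q x) / 2))"
proof -
  define c where "c = exp (- (LINT x:T n|M. \<phi> x - 1) / 2) * exp (- (LINT x:T k|M. \<phi> x - 1) / 2)"
  have i: "set_integrable M (T k) (\<lambda>x. sqrt (\<phi> x) * sqrt (\<phi> x))"
    using set_integrable_T(1)[of k] by (subst set_integrable_cong[OF refl refl, of _ _ \<phi>]) (auto simp: T_nonneg)
  have c': "(LINT x:T k|M. sqrt (\<phi> x) * sqrt (\<phi> x) - 1) = (LINT x:T k|M. \<phi> x - 1)"
    by (rule set_lebesgue_integral_cong) (auto simp: T_nonneg)
  have "(\<integral>\<^sup>+\<eta>. ennreal (sqrt (truncated_ratio n \<eta>) * sqrt (truncated_ratio k \<eta>)) \<partial>P)
    = (\<integral>\<^sup>+\<eta>. ennreal c * ennreal (pp_prod (T n) (\<lambda>x. sqrt (\<phi> x)) \<eta> * pp_prod (T k) (\<lambda>x. sqrt (\<phi> x)) \<eta>) \<partial>P)"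
    by (intro nn_integral_cong)
      (simp only: sqrt_truncated_ratio c_def ennreal_mult[symmetric] mult_nonneg_nonneg pp_prod_nonneg exp_ge_zero mult_ac)
  also have "\<dots> = ennreal c * (\<integral>\<^sup>+\<eta>. ennreal (pp_prod (T n) (\<lambda>x. sqrt (\<phi> x)) \<eta> * pp_prod (T k) (\<lambda>x. sqrt (\<phi> x)) \<eta>) \<partial>P)"
    by (rule nn_integral_cmult) measurable
  also have "\<dots> = ennreal c * ennreal (exp ((LINT x:T k|M. sqrt (\<phi> x) * sqrt (\<phi> x) - 1) + (LINT x:T n - T k|M. sqrt (\<phi> x) - 1)))"
    by (subst laplace_nested[OF kn]) (use T_nonneg i set_integrable_T in auto)
  also have "\<dots> = ennreal (exp ((LINT x:T k|M. \<phi> x - 1) + (LINT x:T n - T k|M. sqrt (\<phi> x) - 1)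
      - (LINT x:T n|M. \<phi> x - 1) / 2 - (LINT x:T k|M. \<phi> x - 1) / 2))"
    unfolding c' by (simp add: c_def mult_exp_exp flip: ennreal_mult)
  also have "(LINT x:T k|M. \<phi> x - 1) + (LINT x:T n - T k|M. sqrt (\<phi> x) - 1)
      - (LINT x:T n|M. \<phi> x - 1) / 2 - (LINT x:T k|M. \<phi> x - 1) / 2
     = (LINT x:T n - T k|M. sqrt (\<phi> x) - 1) - (LINT x:T n - T k|M. \<phi> x - 1) / 2"
    using set_integral_T_split[OF kn _ set_integrable_T_minus_one(1)[of n]] by (simp add: field_simps)
  also have "\<dots> = - (LINT x:T n - T k|M. q x) / 2"
  proof -
    have j: "set_integrable M (T n - T k) (\<lambda>x. sqrt (\<phi> x) - 1)" "set_integrable M (T n - T k) (\<lambda>x. \<phi> x - 1)"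
      by (rule set_integrable_subset[OF set_integrable_T_minus_one(2)], auto,
          rule set_integrable_subset[OF set_integrable_T_minus_one(1)], auto)
    \<comment> \<open>Expanding the square gives q = (\<phi> - 1) - 2 (sqrt \<phi> - 1), which is
      minus twice the remaining integrand.\<close>
    have "(LINT x:T n - T k|M. q x) = (LINT x:T n - T k|M. (\<phi> x - 1) - 2 * (sqrt (\<phi> x) - 1))"
      using T_nonneg[of _ n] by (intro set_lebesgue_integral_cong) (auto simp: power2_diff)
    also have "\<dots> = (LINT x:T n - T k|M. \<phi> x - 1) - (LINT x:T n - T k|M. 2 * (sqrt (\<phi> x) - 1))"
      by (intro set_integral_diff(2) set_integrable_mult_right j)
    also have "(LINT x:T n - T k|M. 2 * (sqrt (\<phi> x) - 1)) = 2 * (LINT x:T n - T k|M. sqrt (\<phi> x) - 1)"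
      by (rule set_integral_mult_right)
    finally show ?thesis by (simp add: field_simps)
  qed
  finally show ?thesis .
qed

text \<open>Two roots of norm 1 in L^2 have squared distance 2 minus twice their affinity. Taking
  the whole complement of \<open>T k\<close> yields a bound for all n \<ge> k at once.\<close>

definition affinity_gap :: "nat \<Rightarrow> real" where
  "affinity_gap k = 2 - 2 * exp (- (LINT x:space M - T k|M. q x) / 2)"

lemma affinity_gap_tendsto: "affinity_gap \<longlonglongrightarrow> 0"
proof -
  have "affinity_gap \<longlonglongrightarrow> 2 - 2 * exp (- 0 / 2)"
    unfolding affinity_gap_def by (intro tendsto_intros tail_tendsto_zero hellinger_integrable) simp
  then show ?thesis by simp
qed

lemma nn_integral_truncated_ratio_one: "(\<integral>\<^sup>+\<eta>. ennreal (truncated_ratio n \<eta>) \<partial>P) = 1"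
  using nn_integral_truncated_ratio[of n n "\<lambda>_. 1"] by simp

lemma affinity_gap_nonneg: "0 \<le> affinity_gap k"
proof -
  have "0 \<le> (LINT x:space M - T k|M. q x)"
    unfolding set_lebesgue_integral_def by (rule Bochner_Integration.integral_nonneg) simp
  then show ?thesis by (simp add: affinity_gap_def)
qed

lemma truncated_ratio_L2:
  assumes kn: "k \<le> n"
  shows "(\<integral>\<^sup>+\<eta>. ennreal ((sqrt (truncated_ratio k \<eta>) - sqrt (truncated_ratio n \<eta>))\<^sup>2) \<partial>P) \<le> ennreal (affinity_gap k)"
proof -
  let ?a = "\<lambda>\<eta>. sqrt (truncated_ratio k \<eta>)" and ?b = "\<lambda>\<eta>. sqrt (truncated_ratio n \<eta>)"
  define e where "e = exp (- (LINT x:T n - T k|M. q x) / 2)"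
  define I where "I = (\<integral>\<^sup>+\<eta>. ennreal ((?a \<eta> - ?b \<eta>)\<^sup>2) \<partial>P)"
  \<comment> \<open>The cross term is added on the left, so no subtraction of nonnegative integrals
    is involved: the sum of the integrands is that of two ratios, each with expectation 1.\<close>
  have "I + 2 * ennreal e = (\<integral>\<^sup>+\<eta>. ennreal ((?a \<eta> - ?b \<eta>)\<^sup>2) + 2 * ennreal (?b \<eta> * ?a \<eta>) \<partial>P)"
    unfolding I_def e_def nn_integral_sqrt_truncated_ratio[OF kn, symmetric]
    by (subst nn_integral_add) (auto simp: nn_integral_cmult)
  also have "\<dots> = (\<integral>\<^sup>+\<eta>. ennreal (truncated_ratio k \<eta>) + ennreal (truncated_ratio n \<eta>) \<partial>P)"
  proof (rule nn_integral_cong)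
    fix \<eta>
    have "(?a \<eta> - ?b \<eta>)\<^sup>2 + 2 * (?b \<eta> * ?a \<eta>) = truncated_ratio k \<eta> + truncated_ratio n \<eta>"
      using truncated_ratio_nonneg by (simp add: power2_diff)
    moreover have "ennreal ((?a \<eta> - ?b \<eta>)\<^sup>2) + 2 * ennreal (?b \<eta> * ?a \<eta>) = ennreal ((?a \<eta> - ?b \<eta>)\<^sup>2 + 2 * (?b \<eta> * ?a \<eta>))"
      using truncated_ratio_nonneg by (simp add: ennreal_mult)
    ultimately show "ennreal ((?a \<eta> - ?b \<eta>)\<^sup>2) + 2 * ennreal (?b \<eta> * ?a \<eta>)
        = ennreal (truncated_ratio k \<eta>) + ennreal (truncated_ratio n \<eta>)"
      using truncated_ratio_nonneg by simp
  qed
  also have "\<dots> = 2"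
    by (subst nn_integral_add) (auto simp: nn_integral_truncated_ratio_one)
  finally have "I + 2 * ennreal e = 2" .
  moreover have "2 * ennreal e = ennreal (2 * e)" by (simp add: ennreal_mult e_def)
  ultimately have "I + ennreal (2 * e) = ennreal 2" by simp
  then have "I = ennreal 2 - ennreal (2 * e)"
    by (metis ennreal_add_diff_cancel_right ennreal_neq_top)
  also have "\<dots> = ennreal (2 - 2 * e)" by (rule ennreal_minus) (simp add: e_def)
  also have "\<dots> \<le> ennreal (affinity_gap k)"
  proof (rule ennreal_leI)
    have "(LINT x:T n - T k|M. q x) \<le> (LINT x:space M - T k|M. q x)"
      using hellinger_integrable sets.sets_into_space[OF sets_T[of n]]
      unfolding set_lebesgue_integral_def
      by (intro integral_mono integrable_mult_indicator) (auto split: split_indicator)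
    then show "2 - 2 * e \<le> affinity_gap k" by (simp add: e_def affinity_gap_def)
  qed
  finally show ?thesis by (simp add: I_def)
qed

end

section \<open>The likelihood ratio\<close>

context hellinger_density
begin

lemma comp_sum_small:
  "comp_sum (\<lambda>x. indicator S x * ln (\<phi> x)) n \<eta>
    = (LINT x:S \<inter> T n|\<eta>. ln (\<phi> x)) - (LINT x:S \<inter> T n|M. ln (\<phi> x))"
proof -
  have "(LINT x:T n|N. indicator S x * ln (\<phi> x)) = (LINT x:S \<inter> T n|N. ln (\<phi> x))" for N
    unfolding set_lebesgue_integral_def
    by (rule Bochner_Integration.integral_cong) (auto split: split_indicator)
  then show ?thesis by (simp add: comp_sum_def)
qed

text \<open>Collects the almost sure properties behind the limit of the truncated ratios, so that
  this limit can be computed for one fixed pattern.\<close>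

definition regular_pattern :: "'a measure \<Rightarrow> bool" where
  "regular_pattern \<eta> \<longleftrightarrow> \<eta> \<in> point_patterns M \<and> (\<forall>n. emeasure \<eta> (T n) < \<infinity>) \<and> emeasure \<eta> L < \<infinity> \<and>
     convergent (\<lambda>n. (LINT x:S \<inter> T n|\<eta>. ln (\<phi> x)) - (LINT x:S \<inter> T n|M. ln (\<phi> x)))"

lemma AE_regular_pattern: "AE \<eta> in P. regular_pattern \<eta>"
  using AE_finite_T AE_emeasure_finite[OF sets_log(2) finite_large]
    bounded_integrand.AE_convergent_comp_sum[OF bounded_integrand_ln] AE_space
  by eventually_elim (simp add: regular_pattern_def comp_sum_small space_P)

lemma regular_pattern_integrals:
  assumes "regular_pattern \<eta>"
  shows "compensated_integral_converges T M \<eta> S (\<lambda>x. ln (\<phi> x))" "set_integrable \<eta> L (\<lambda>x. ln (\<phi> x))"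
proof -
  from assms have \<eta>: "\<eta> \<in> point_patterns M" and fT: "\<And>n. emeasure \<eta> (T n) < \<infinity>"
    and fL: "emeasure \<eta> L < \<infinity>"
    and conv: "convergent (\<lambda>n. (LINT x:S \<inter> T n|\<eta>. ln (\<phi> x)) - (LINT x:S \<inter> T n|M. ln (\<phi> x)))"
    by (auto simp: regular_pattern_def)
  have fin: "(\<integral>\<^sup>+x\<in>S \<inter> T n. ennreal \<bar>ln (\<phi> x)\<bar> \<partial>N) < \<infinity>"
    if N: "sets N = sets M" "emeasure N (T n) < \<infinity>" for N n
  proof -
    have "(\<integral>\<^sup>+x\<in>S \<inter> T n. ennreal \<bar>ln (\<phi> x)\<bar> \<partial>N) \<le> (\<integral>\<^sup>+x. indicator (T n) x \<partial>N)"
      by (rule nn_integral_mono) (auto simp: log_small_eq split: split_indicator)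
    also have "\<dots> = emeasure N (T n)" using N by simp
    finally show ?thesis using N(2) by (rule order_le_less_trans)
  qed
  show "compensated_integral_converges T M \<eta> S (\<lambda>x. ln (\<phi> x))"
    unfolding compensated_integral_converges_def
    using conv fin[OF sets_point_pattern[OF \<eta>] fT] fin[OF refl finite_T] by simp
  show "set_integrable \<eta> L (\<lambda>x. ln (\<phi> x))"
    by (rule point_pattern_set_integrable[OF \<eta> _ fL]) auto
qed

text \<open>If the pattern charges the zeros of \<phi>, it charges them within some
  \<open>T n\<close>, and all ratios from that index on are 0. Otherwise the exponent is split along
  S and L, and every part converges to the corresponding term of the log-likelihood ratio.\<close>

lemma truncated_ratio_tendsto:
  assumes "regular_pattern \<eta>"
  shows "(\<lambda>n. truncated_ratio n \<eta>) \<longlonglongrightarrow> likelihood_ratio T M \<phi> \<eta>"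
proof (cases "\<eta> \<in> no_zero_patterns M \<phi>")
  case False
  from assms have \<eta>: "\<eta> \<in> point_patterns M" by (simp add: regular_pattern_def)
  note z = sets_zeros[OF sets_T \<phi>]
  have U: "(\<Union>n. {x\<in>T n. \<phi> x = 0}) = {x\<in>space M. \<phi> x = 0}"
    using UN_T by blast
  have "\<exists>n. emeasure \<eta> {x\<in>T n. \<phi> x = 0} \<noteq> 0"
  proof (rule ccontr)
    assume "\<not> ?thesis"
    then have "emeasure \<eta> (\<Union>n. {x\<in>T n. \<phi> x = 0}) = 0"
      using z by (intro emeasure_UN_eq_0) (auto simp: sets_point_pattern[OF \<eta>])
    then show False using False \<eta> unfolding U by (simp add: no_zero_patterns_def)
  qed
  then obtain n where n: "emeasure \<eta> {x\<in>T n. \<phi> x = 0} \<noteq> 0" by blast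
  have "truncated_ratio m \<eta> = 0" if "m \<ge> n" for m
  proof -
    have "emeasure \<eta> {x\<in>T n. \<phi> x = 0} \<le> emeasure \<eta> {x\<in>T m. \<phi> x = 0}"
      using z incseqD[OF inc_T that] by (intro emeasure_mono) (auto simp: sets_point_pattern[OF \<eta>])
    with n have "emeasure \<eta> {x\<in>T m. \<phi> x = 0} \<noteq> 0" by auto
    then show ?thesis by (simp add: truncated_ratio_def pp_prod_def)
  qed
  then have "eventually (\<lambda>m. truncated_ratio m \<eta> = 0) sequentially"
    by (auto simp: eventually_sequentially)
  then have "(\<lambda>n. truncated_ratio n \<eta>) \<longlonglongrightarrow> 0" by (rule tendsto_eventually)
  then show ?thesis using False by (simp add: likelihood_ratio_def)
next
  case True
  from assms have \<eta>: "\<eta> \<in> point_patterns M" and fT: "\<And>n. emeasure \<eta> (T n) < \<infinity>"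
    and fL: "emeasure \<eta> L < \<infinity>"
    and conv: "convergent (\<lambda>n. (LINT x:S \<inter> T n|\<eta>. ln (\<phi> x)) - (LINT x:S \<inter> T n|M. ln (\<phi> x)))"
    by (auto simp: regular_pattern_def)
  note s\<eta> = sets_point_pattern[OF \<eta>]
  have split: "(LINT x:T n|N. f x) = (LINT x:S \<inter> T n|N. f x) + (LINT x:L \<inter> T n|N. f x)"
    if "set_integrable N (T n) f" and N: "sets N = sets M" for N n and f :: "'a \<Rightarrow> real"
  proof -
    have U: "(S \<inter> T n) \<union> (L \<inter> T n) = T n"
      using log_partition(1) sets.sets_into_space[OF sets_T[of n]] by blast
    have "(LINT x:(S \<inter> T n) \<union> (L \<inter> T n)|N. f x) = (LINT x:S \<inter> T n|N. f x) + (LINT x:L \<inter> T n|N. f x)"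
      using log_partition(2) N
      by (intro set_integral_Un set_integrable_subset[OF that(1)]) auto
    then show ?thesis unfolding U .
  qed
  \<comment> \<open>The integral of ln \<phi> over \<open>S \<inter> T n\<close> with respect to M
    is subtracted in the first line and added back in the second. After this regrouping, each
    summand, with the compensated difference counted as one, converges by itself.\<close>
  define X where "X n = (LINT x:S \<inter> T n|\<eta>. ln (\<phi> x)) - (LINT x:S \<inter> T n|M. ln (\<phi> x))
      + (LINT x:L \<inter> T n|\<eta>. ln (\<phi> x)) + (LINT x:S \<inter> T n|M. ln (\<phi> x) + 1 - \<phi> x)
      + (LINT x:L \<inter> T n|M. 1 - \<phi> x)" for n
  have "truncated_ratio n \<eta> = exp (X n)" for n
  proof -
    have "emeasure \<eta> {x\<in>T n. \<phi> x = 0} \<le> emeasure \<eta> {x\<in>space M. \<phi> x = 0}"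
      using sets.sets_into_space[OF sets_T[of n]]
      by (intro emeasure_mono) (auto simp: s\<eta>)
    then have 0: "emeasure \<eta> {x\<in>T n. \<phi> x = 0} = 0" using True by (simp add: no_zero_patterns_def)
    have i1: "set_integrable \<eta> (T n) (\<lambda>x. ln (\<phi> x))"
      by (rule point_pattern_set_integrable[OF \<eta> _ fT]) auto
    have i2: "set_integrable M (S \<inter> T n) (\<lambda>x. ln (\<phi> x))"
    proof (rule set_integrable_bounded[where C=1])
      show "emeasure M (S \<inter> T n) < \<infinity>"
        by (rule order_le_less_trans[OF emeasure_mono finite_T[of n]]) auto
    qed (auto simp: log_small_eq)
    have i3: "set_integrable M (S \<inter> T n) (\<lambda>x. \<phi> x - 1)"
      by (rule set_integrable_subset[OF set_integrable_T_minus_one(1)[of n]]) auto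
    have "(LINT x:T n|M. \<phi> x - 1) = (LINT x:S \<inter> T n|M. \<phi> x - 1) + (LINT x:L \<inter> T n|M. \<phi> x - 1)"
      by (rule split[OF set_integrable_T_minus_one(1) refl])
    moreover have "(LINT x:S \<inter> T n|M. ln (\<phi> x) + 1 - \<phi> x) = (LINT x:S \<inter> T n|M. ln (\<phi> x)) - (LINT x:S \<inter> T n|M. \<phi> x - 1)"
      by (subst set_integral_diff(2)[OF i2 i3, symmetric]) (simp add: algebra_simps)
    moreover have "(LINT x:L \<inter> T n|M. 1 - \<phi> x) = - (LINT x:L \<inter> T n|M. \<phi> x - 1)"
      unfolding set_lebesgue_integral_def by (subst integral_minus[symmetric]) (simp add: algebra_simps)
    moreover have "(LINT x:T n|\<eta>. ln (\<phi> x)) = (LINT x:S \<inter> T n|\<eta>. ln (\<phi> x)) + (LINT x:L \<inter> T n|\<eta>. ln (\<phi> x))"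
      by (rule split[OF i1 s\<eta>])
    ultimately have "(LINT x:T n|\<eta>. ln (\<phi> x)) + - (LINT x:T n|M. \<phi> x - 1) = X n"
      unfolding X_def by linarith
    then show ?thesis
      using 0 unfolding truncated_ratio_def pp_prod_def by (simp add: mult_exp_exp)
  qed
  moreover have "(\<lambda>n. exp (X n)) \<longlonglongrightarrow> exp (log_likelihood_ratio T M \<phi> \<eta>)"
    unfolding X_def log_likelihood_ratio_def compensated_integral_def
    by (intro tendsto_intros set_integral_T_tendsto s\<eta> refl sets_log set_integrable_small set_integrable_large
        regular_pattern_integrals(2)[OF assms] conv[unfolded convergent_LIMSEQ_iff])
  ultimately show ?thesis using True by (simp add: likelihood_ratio_def)
qed

lemma likelihood_ratio_nonneg: "0 \<le> likelihood_ratio T M \<phi> \<eta>"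
  by (simp add: likelihood_ratio_def)

lemma measurable_likelihood_ratio [measurable]:
  "likelihood_ratio T M \<phi> \<in> borel_measurable (point_pattern_algebra M)"
proof -
  have "no_zero_patterns M \<phi> = {\<eta>\<in>space (point_pattern_algebra M). emeasure \<eta> {x\<in>space M. \<phi> x = 0} = 0}"
    by (simp add: no_zero_patterns_def)
  also have "\<dots> \<in> sets (point_pattern_algebra M)" by measurable
  finally have [measurable]: "no_zero_patterns M \<phi> \<in> sets (point_pattern_algebra M)" .
  show ?thesis
    unfolding likelihood_ratio_def[abs_def] log_likelihood_ratio_def compensated_integral_def by measurable
qed

text \<open>Fatou's lemma along n: the bound on the distance of two truncated ratios is uniform in
  the later index and passes to the almost sure limit.\<close>

lemma likelihood_ratio_L2:
  "(\<integral>\<^sup>+\<eta>. ennreal ((sqrt (truncated_ratio k \<eta>) - sqrt (likelihood_ratio T M \<phi> \<eta>))\<^sup>2) \<partial>P) \<le> ennreal (affinity_gap k)"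
proof -
  have "(\<integral>\<^sup>+\<eta>. ennreal ((sqrt (truncated_ratio k \<eta>) - sqrt (likelihood_ratio T M \<phi> \<eta>))\<^sup>2) \<partial>P)
    = (\<integral>\<^sup>+\<eta>. liminf (\<lambda>n. ennreal ((sqrt (truncated_ratio k \<eta>) - sqrt (truncated_ratio n \<eta>))\<^sup>2)) \<partial>P)"
  proof (rule nn_integral_cong_AE)
    show "AE \<eta> in P. ennreal ((sqrt (truncated_ratio k \<eta>) - sqrt (likelihood_ratio T M \<phi> \<eta>))\<^sup>2)
      = liminf (\<lambda>n. ennreal ((sqrt (truncated_ratio k \<eta>) - sqrt (truncated_ratio n \<eta>))\<^sup>2))"
      using AE_regular_pattern
    proof eventually_elim
      case (elim \<eta>)
      have "(\<lambda>n. ennreal ((sqrt (truncated_ratio k \<eta>) - sqrt (truncated_ratio n \<eta>))\<^sup>2))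
        \<longlonglongrightarrow> ennreal ((sqrt (truncated_ratio k \<eta>) - sqrt (likelihood_ratio T M \<phi> \<eta>))\<^sup>2)"
        by (intro tendsto_ennrealI tendsto_intros truncated_ratio_tendsto[OF elim])
      then show ?case by (intro lim_imp_Liminf[symmetric]) simp
    qed
  qed
  also have "\<dots> \<le> liminf (\<lambda>n. \<integral>\<^sup>+\<eta>. ennreal ((sqrt (truncated_ratio k \<eta>) - sqrt (truncated_ratio n \<eta>))\<^sup>2) \<partial>P)"
    by (rule nn_integral_liminf) measurable
  \<comment> \<open>The bound is available from n = k on, which is enough for the upper
    limit.\<close>
  also have "\<dots> \<le> limsup (\<lambda>n. \<integral>\<^sup>+\<eta>. ennreal ((sqrt (truncated_ratio k \<eta>) - sqrt (truncated_ratio n \<eta>))\<^sup>2) \<partial>P)"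
    by (rule Liminf_le_Limsup) simp
  also have "\<dots> \<le> ennreal (affinity_gap k)"
    by (rule Limsup_bounded) (use truncated_ratio_L2 in \<open>auto simp: eventually_sequentially\<close>)
  finally show ?thesis .
qed

text \<open>This is where no mass gets lost: the expectation is the same for all truncated ratios
  from index k on, and L^2 convergence of their roots carries it to the limit.\<close>

lemma nn_integral_likelihood_ratio:
  assumes v [measurable]: "v \<in> borel_measurable M" and v0: "\<And>x. 0 < v x" "\<And>x. v x \<le> 1"
  shows "(\<integral>\<^sup>+\<eta>. ennreal (likelihood_ratio T M \<phi> \<eta>) * ennreal (pp_prod (T k) v \<eta>) \<partial>P)
    = ennreal (exp (LINT x:T k|M. \<phi> x * (v x - 1)))"
proof -
  have "(\<integral>\<^sup>+\<eta>. ennreal ((sqrt (likelihood_ratio T M \<phi> \<eta>))\<^sup>2) * ennreal (pp_prod (T k) v \<eta>) \<partial>P)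
    = ennreal (exp (LINT x:T k|M. \<phi> x * (v x - 1)))"
  proof (rule nn_integral_square_limit[OF _ _ _ _ affinity_gap_tendsto affinity_gap_nonneg likelihood_ratio_L2])
    show "AE \<eta> in P. 0 \<le> pp_prod (T k) v \<eta> \<and> pp_prod (T k) v \<eta> \<le> 1"
      using AE_finite_T AE_space
    proof eventually_elim
      case (elim \<eta>)
      have "pp_prod (T k) v \<eta> \<le> pp_prod (T k) (\<lambda>_. 1) \<eta>"
        by (rule pp_prod_mono[of _ M]) (use elim v0 in \<open>auto simp: space_P intro: less_imp_le\<close>)
      then show ?case by simp
    qed
    fix m assume "k \<le> m"
    from nn_integral_truncated_ratio[OF this v v0]
    show "(\<integral>\<^sup>+\<eta>. ennreal ((sqrt (truncated_ratio m \<eta>))\<^sup>2) * ennreal (pp_prod (T k) v \<eta>) \<partial>P)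
        = ennreal (exp (LINT x:T k|M. \<phi> x * (v x - 1)))"
      by (simp add: truncated_ratio_nonneg)
  qed (simp_all, measurable)
  then show ?thesis by (simp add: likelihood_ratio_nonneg)
qed

text \<open>Both sides are finite measures whose Laplace functional over \<open>T n\<close> at v is
  the exponential of the integral of \<phi> (v - 1) over \<open>T n\<close>.\<close>

theorem density_likelihood_ratio:
  assumes Q: "poisson_pp_distribution (density M (\<lambda>x. ennreal (\<phi> x))) Q"
  shows "density P (\<lambda>\<eta>. ennreal (likelihood_ratio T M \<phi> \<eta>)) = Q"
proof -
  let ?\<Lambda> = "density M (\<lambda>x. ennreal (\<phi> x))"
  interpret Q: poisson_pattern Q ?\<Lambda>
  proof (intro poisson_pattern.intro poisson_pattern_axioms.intro)
    show "prob_space Q" using Q by (simp add: poisson_pp_distribution_def)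
  qed (rule Q)
  have sQ: "sets Q = sets (point_pattern_algebra M)"
    using Q.sets_P point_pattern_algebra_cong[of ?\<Lambda> M] by simp
  have fin: "emeasure ?\<Lambda> (T n) < \<infinity>" for n
  proof -
    have "emeasure ?\<Lambda> (T n) = (\<integral>\<^sup>+x. ennreal (indicator (T n) x * \<phi> x) \<partial>M)"
      by (subst emeasure_density) (auto intro!: nn_integral_cong simp: indicator_def)
    also have "\<dots> \<le> (\<integral>\<^sup>+x. ennreal (norm (indicator (T n) x * \<phi> x)) \<partial>M)"
      by (intro nn_integral_mono ennreal_leI) simp
    also have "\<dots> < \<infinity>"
      using set_integrable_T(1)[of n] by (simp add: set_integrable_def integrable_iff_bounded)
    finally show ?thesis .
  qed
  have dens: "(\<integral>\<^sup>+\<eta>. Z \<eta> \<partial>density P (\<lambda>\<eta>. ennreal (likelihood_ratio T M \<phi> \<eta>)))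
      = (\<integral>\<^sup>+\<eta>. ennreal (likelihood_ratio T M \<phi> \<eta>) * Z \<eta> \<partial>P)"
    if [measurable]: "Z \<in> borel_measurable (point_pattern_algebra M)" for Z
    by (rule nn_integral_density) measurable
  show ?thesis
  proof (rule measure_eqI_laplace)
    show "sets (density P (\<lambda>\<eta>. ennreal (likelihood_ratio T M \<phi> \<eta>))) = sets (point_pattern_algebra M)"
      by (simp add: sets_P)
    show "sets Q = sets (point_pattern_algebra M)" by (rule sQ)
    show "finite_measure (density P (\<lambda>\<eta>. ennreal (likelihood_ratio T M \<phi> \<eta>)))"
    proof (rule finite_measureI)
      \<comment> \<open>The constant weight v = 1 turns the Laplace functional into the total
        mass.\<close>
      have "emeasure (density P (\<lambda>\<eta>. ennreal (likelihood_ratio T M \<phi> \<eta>)))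
          (space (density P (\<lambda>\<eta>. ennreal (likelihood_ratio T M \<phi> \<eta>)))) = 1"
        using dens[of "\<lambda>_. 1"] nn_integral_likelihood_ratio[of "\<lambda>_. 1" 0] by simp
      then show "emeasure (density P (\<lambda>\<eta>. ennreal (likelihood_ratio T M \<phi> \<eta>)))
          (space (density P (\<lambda>\<eta>. ennreal (likelihood_ratio T M \<phi> \<eta>)))) \<noteq> \<infinity>" by simp
    qed
    show "finite_measure Q" by unfold_locales
    show "AE \<eta> in density P (\<lambda>\<eta>. ennreal (likelihood_ratio T M \<phi> \<eta>)). emeasure \<eta> (T n) < \<infinity>" for n
      using AE_finite_T by (subst AE_density) auto
    show "AE \<eta> in Q. emeasure \<eta> (T n) < \<infinity>" for n
      by (rule Q.AE_emeasure_finite[OF _ fin]) simp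
    fix n and v :: "'a \<Rightarrow> real"
    assume v [measurable]: "v \<in> borel_measurable M" and v0: "\<And>x. 0 < v x" "\<And>x. v x \<le> 1"
    have "(\<integral>\<^sup>+\<eta>. ennreal (pp_prod (T n) v \<eta>) \<partial>Q) = ennreal (exp (LINT x:T n|?\<Lambda>. v x - 1))"
    proof (rule Q.laplace)
      have "\<bar>v x\<bar> \<le> 1" for x using v0[of x] by (simp add: abs_of_pos)
      then show "set_integrable ?\<Lambda> (T n) v"
        by (intro set_integrable_bounded[where C=1] fin) auto
    qed (use v0 fin in \<open>auto intro: less_imp_le\<close>)
    also have "(LINT x:T n|?\<Lambda>. v x - 1) = (LINT x:T n|M. \<phi> x * (v x - 1))"
      unfolding set_lebesgue_integral_def
      by (subst integral_density) (auto simp: \<phi>_nonneg mult_ac)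
    finally show "(\<integral>\<^sup>+\<eta>. ennreal (pp_prod (T n) v \<eta>) \<partial>density P (\<lambda>\<eta>. ennreal (likelihood_ratio T M \<phi> \<eta>)))
        = (\<integral>\<^sup>+\<eta>. ennreal (pp_prod (T n) v \<eta>) \<partial>Q)"
      using nn_integral_likelihood_ratio[OF v v0] by (subst dens) auto
  qed
qed

end

text \<open>The Hellinger distance may be computed with any dominating measure; the choice of M
  itself gives the densities \<phi> and 1.\<close>

lemma hellinger_finite_integrable:
  assumes "sigma_finite_measure M" and d: "is_density K M \<phi>" and fin: "hellinger K M < \<infinity>"
  shows "integrable M (\<lambda>x. (sqrt (\<phi> x) - 1)\<^sup>2)"
proof -
  have [measurable]: "\<phi> \<in> borel_measurable M" using d by (simp add: is_density_def)
  have "is_density M M (\<lambda>_. 1)" by (simp add: is_density_def density_1)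
  then have "hellinger_densities M \<phi> (\<lambda>_. 1) < \<infinity>"
    using hellinger_eq[OF assms(1) d] fin by simp
  then have "(\<integral>\<^sup>+x. ennreal ((sqrt (\<phi> x) - 1)\<^sup>2) \<partial>M) / 2 \<noteq> \<infinity>"
    by (auto simp: hellinger_densities_def sqrt_ennreal_def split: if_splits)
  then have "(\<integral>\<^sup>+x. ennreal ((sqrt (\<phi> x) - 1)\<^sup>2) \<partial>M) < \<infinity>"
    by (auto simp: less_top[symmetric] ennreal_top_divide)
  then show ?thesis
    by (intro integrableI_nonneg) auto
qed

theorem theorem4p4:
  fixes \<Lambda> \<mu> :: "'a measure" and P\<^sub>\<Lambda> P\<^sub>\<mu> :: "'a measure measure"
    and \<phi> :: "'a \<Rightarrow> real" and T :: "nat \<Rightarrow> 'a set"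
  assumes "sets \<Lambda> = sets \<mu>"
    and "sigma_finite_measure \<Lambda>" and "sigma_finite_measure \<mu>"
    and "absolutely_continuous \<mu> \<Lambda>"
    and "hellinger \<Lambda> \<mu> < \<infinity>"
    and "poisson_pp_distribution \<Lambda> P\<^sub>\<Lambda>" and "poisson_pp_distribution \<mu> P\<^sub>\<mu>"
    and "is_density \<Lambda> \<mu> \<phi>"
    and "range T \<subseteq> sets \<mu>" and "incseq T" and "(\<Union>n. T n) = space \<mu>"
    and "\<And>n. emeasure \<mu> (T n) < \<infinity>"
  shows "absolutely_continuous P\<^sub>\<mu> P\<^sub>\<Lambda>
    \<and> set_integrable \<mu> (log_small \<mu> \<phi>) (\<lambda>x. ln (\<phi> x) + 1 - \<phi> x)
    \<and> set_integrable \<mu> (log_large \<mu> \<phi>) (\<lambda>x. 1 - \<phi> x)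
    \<and> (AE \<eta> in P\<^sub>\<mu>. \<eta> \<in> no_zero_patterns \<mu> \<phi> \<longrightarrow>
         compensated_integral_converges T \<mu> \<eta> (log_small \<mu> \<phi>) (\<lambda>x. ln (\<phi> x)) \<and>
         set_integrable \<eta> (log_large \<mu> \<phi>) (\<lambda>x. ln (\<phi> x)))
    \<and> is_density P\<^sub>\<Lambda> P\<^sub>\<mu> (likelihood_ratio T \<mu> \<phi>)"
proof -
  have \<Lambda>: "\<Lambda> = density \<mu> (\<lambda>x. ennreal (\<phi> x))" using assms(8) by (simp add: is_density_def)
  interpret prob_space P\<^sub>\<mu> using assms(7) by (simp add: poisson_pp_distribution_def)
  interpret hellinger_density P\<^sub>\<mu> \<mu> T \<phi>
  proof (unfold_locales)
    show "poisson_pp_distribution \<mu> P\<^sub>\<mu>" "incseq T" "(\<Union>n. T n) = space \<mu>" by fact+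
    show "T n \<in> sets \<mu>" for n using assms(9) by blast
    show "emeasure \<mu> (T n) < \<infinity>" for n by fact
    show "\<phi> \<in> borel_measurable \<mu>" using assms(8) by (simp add: is_density_def)
    show "0 \<le> \<phi> x" if "x \<in> space \<mu>" for x using assms(8) that by (simp add: is_density_def)
    show "integrable \<mu> (\<lambda>x. (sqrt (\<phi> x) - 1)\<^sup>2)"
      by (rule hellinger_finite_integrable[OF assms(3,8,5)])
  qed
  have d: "density P\<^sub>\<mu> (\<lambda>\<eta>. ennreal (likelihood_ratio T \<mu> \<phi> \<eta>)) = P\<^sub>\<Lambda>"
    by (rule density_likelihood_ratio) (use assms(6) \<Lambda> in simp)
  have m: "likelihood_ratio T \<mu> \<phi> \<in> borel_measurable P\<^sub>\<mu>" by measurable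
  then have "absolutely_continuous P\<^sub>\<mu> (density P\<^sub>\<mu> (\<lambda>\<eta>. ennreal (likelihood_ratio T \<mu> \<phi> \<eta>)))"
    by (intro absolutely_continuousI_density) measurable
  moreover have "AE \<eta> in P\<^sub>\<mu>. \<eta> \<in> no_zero_patterns \<mu> \<phi> \<longrightarrow>
         compensated_integral_converges T \<mu> \<eta> (log_small \<mu> \<phi>) (\<lambda>x. ln (\<phi> x)) \<and>
         set_integrable \<eta> (log_large \<mu> \<phi>) (\<lambda>x. ln (\<phi> x))"
    using AE_regular_pattern by eventually_elim (simp add: regular_pattern_integrals)
  moreover have "is_density P\<^sub>\<Lambda> P\<^sub>\<mu> (likelihood_ratio T \<mu> \<phi>)"
    using m d by (simp add: is_density_def likelihood_ratio_nonneg)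
  ultimately show ?thesis
    using set_integrable_small set_integrable_large by (simp add: d)
qed

end
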